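(* Let $0<l_1\le l_2$. Let $X=\{(\sigma,\gamma)\in(0,1)\times[0,\infty)\}$ and define $$A:=\{(\sigma,\gamma)\in X:\gamma\ge\sigma^{-1}\},\qquad B:=\{(\sigma,\gamma)\in X:\sigma^{-4/9}\le\gamma<\sigma^{-1}\},$$ $$C:=\{(\sigma,\gamma)\in X:\sigma^{4/5}\le\gamma<\sigma^{-4/9}\},\qquad D:=\{(\sigma,\gamma)\in X:\gamma<\sigma^{4/5}\}.$$ There exists a positive constant $c$, independent of $l_1$, $l_2$, $\sigma$ and $\gamma$, such that $$\min_V I^{(\sigma,\gamma)}\le c\,l_1l_2\begin{cases}1&\text{if }(\sigma,\gamma)\in A,\\(\sigma\gamma)^{2/5}&\text{if }(\sigma,\gamma)\in B,\\\sigma^{1/2}\gamma^{5/8}&\text{if }(\sigma,\gamma)\in C,\\\sigma&\text{if }(\sigma,\gamma)\in D.\end{cases}$$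
   Context: Let $\Omega:=(0,l_1)\times(0,l_2)$. The admissible set is $$V:=\{(\mathbf u,w)\in H^1(\Omega;\mathbb R^2)\times H^2(\Omega): w=0,\ \mathbf u=Dw=\mathbf 0\text{ on }\{0\}\times(0,l_2),\ w\ge0\},$$ boundary values being understood in the sense of traces. For $(\mathbf u,w)\in V$ the energy is $$I^{(\sigma,\gamma)}[\mathbf u,w]=I^{(\sigma,\gamma)}[\mathbf u,w,l_1,l_2]:=\int_\Omega|D\mathbf u+(D\mathbf u)^{\mathrm T}+Dw\otimes Dw-\mathrm{Id}|^2\,dx\,dy+(\sigma l_1)^2\int_\Omega|D^2w|^2\,dx\,dy+\gamma\,|\{(x,y)\in\Omega:w(x,y)>0\}|,$$ where matrix norms are Frobenius norms, $(Dw\otimes Dw)_{ij}=\partial_iw\,\partial_jw$, $\mathrm{Id}$ is the $2\times2$ identity matrix, and $|\cdot|$ of a set is its Lebesgue measure. $\min_V I^{(\sigma,\gamma)}$ denotes the minimum value of $I^{(\sigma,\gamma)}$ over $V$. *)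

theory Defs
  imports "HOL-Analysis.Analysis"
begin

section \<open>Sobolev functions on open subsets of Euclidean space\<close>

definition partial_deriv :: "'n::finite \<Rightarrow> (real ^ 'n \<Rightarrow> real) \<Rightarrow> real ^ 'n \<Rightarrow> real" where
  "partial_deriv i \<phi> x = frechet_derivative \<phi> (at x) (axis i 1)"

primrec Ck :: "nat \<Rightarrow> (real ^ 'n::finite \<Rightarrow> real) \<Rightarrow> bool" where
  "Ck 0 \<phi> \<longleftrightarrow> continuous_on UNIV \<phi>"
| "Ck (Suc k) \<phi> \<longleftrightarrow> (\<forall>x. \<phi> differentiable (at x)) \<and> (\<forall>i. Ck k (partial_deriv i \<phi>))"

definition test_functions :: "(real ^ 'n::finite) set \<Rightarrow> (real ^ 'n \<Rightarrow> real) set" where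
  "test_functions \<Omega> = {\<phi>. (\<forall>k. Ck k \<phi>) \<and>
     compact (closure {x. \<phi> x \<noteq> 0}) \<and> closure {x. \<phi> x \<noteq> 0} \<subseteq> \<Omega>}"

definition locally_integrable :: "(real ^ 'n::finite) set \<Rightarrow> (real ^ 'n \<Rightarrow> real) \<Rightarrow> bool" where
  "locally_integrable \<Omega> f \<longleftrightarrow> (\<forall>K. compact K \<and> K \<subseteq> \<Omega> \<longrightarrow> f absolutely_integrable_on K)"

definition is_weak_partial ::
  "(real ^ 'n::finite) set \<Rightarrow> 'n \<Rightarrow> (real ^ 'n \<Rightarrow> real) \<Rightarrow> (real ^ 'n \<Rightarrow> real) \<Rightarrow> bool" where
  "is_weak_partial \<Omega> i f g \<longleftrightarrow> locally_integrable \<Omega> f \<and> locally_integrable \<Omega> g \<and>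
     (\<forall>\<phi>\<in>test_functions \<Omega>.
        (\<integral>x. f x * partial_deriv i \<phi> x \<partial>lebesgue_on \<Omega>) = - (\<integral>x. g x * \<phi> x \<partial>lebesgue_on \<Omega>))"

text \<open>
  Sobolev functions are represented by everywhere defined functions; all notions below depend on
  their values in \<open>\<Omega>\<close> only up to null sets. A weak partial derivative is unique almost everywhere
  in \<open>\<Omega>\<close>, and \<open>weak_partial\<close> picks one representative of it.
\<close>

definition weak_partial ::
  "(real ^ 'n::finite) set \<Rightarrow> 'n \<Rightarrow> (real ^ 'n \<Rightarrow> real) \<Rightarrow> real ^ 'n \<Rightarrow> real" where
  "weak_partial \<Omega> i f = (SOME g. is_weak_partial \<Omega> i f g)"

definition L2_on :: "'a::euclidean_space set \<Rightarrow> ('a \<Rightarrow> real) \<Rightarrow> bool" where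
  "L2_on \<Omega> f \<longleftrightarrow> f \<in> borel_measurable (lebesgue_on \<Omega>) \<and>
     integrable (lebesgue_on \<Omega>) (\<lambda>x. (f x)\<^sup>2)"

definition H1_on :: "(real ^ 'n::finite) set \<Rightarrow> (real ^ 'n \<Rightarrow> real) \<Rightarrow> bool" where
  "H1_on \<Omega> f \<longleftrightarrow> L2_on \<Omega> f \<and> (\<forall>i. \<exists>g. is_weak_partial \<Omega> i f g \<and> L2_on \<Omega> g)"

definition H2_on :: "(real ^ 'n::finite) set \<Rightarrow> (real ^ 'n \<Rightarrow> real) \<Rightarrow> bool" where
  "H2_on \<Omega> f \<longleftrightarrow> H1_on \<Omega> f \<and> (\<forall>i. H1_on \<Omega> (weak_partial \<Omega> i f))"

definition H1_norm_sq :: "(real ^ 'n::finite) set \<Rightarrow> (real ^ 'n \<Rightarrow> real) \<Rightarrow> ennreal" where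
  "H1_norm_sq \<Omega> f = (\<integral>\<^sup>+x. ennreal ((f x)\<^sup>2) \<partial>lebesgue_on \<Omega>) +
     (\<Sum>i\<in>UNIV. \<integral>\<^sup>+x. ennreal ((weak_partial \<Omega> i f x)\<^sup>2) \<partial>lebesgue_on \<Omega>)"

section \<open>The rectangle and traces on its left edge\<close>

definition rect :: "real \<Rightarrow> real \<Rightarrow> (real ^ 2) set" where
  "rect l1 l2 = {x. 0 < x $ 1 \<and> x $ 1 < l1 \<and> 0 < x $ 2 \<and> x $ 2 < l2}"

text \<open>
  The trace operator is the continuous extension to \<open>H\<^sup>1\<close> of the restriction map
  \<open>\<phi> \<mapsto> \<phi>|\<^bsub>\<Gamma>\<^esub>\<close>, defined on the \<open>H\<^sup>1\<close> functions that are continuous up to the boundary, with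
  values in \<open>L\<^sup>2(\<Gamma>)\<close>. Here \<open>\<Gamma> = {0} \<times> (0, l2)\<close> is parametrised by its second coordinate, and
  \<open>has_left_trace l1 l2 f g\<close> says that the trace of \<open>f\<close> on \<open>\<Gamma>\<close> is \<open>g\<close>.
\<close>

definition has_left_trace :: "real \<Rightarrow> real \<Rightarrow> (real ^ 2 \<Rightarrow> real) \<Rightarrow> (real \<Rightarrow> real) \<Rightarrow> bool" where
  "has_left_trace l1 l2 f g \<longleftrightarrow> H1_on (rect l1 l2) f \<and> L2_on {0<..<l2} g \<and>
     (\<exists>\<phi> :: nat \<Rightarrow> real ^ 2 \<Rightarrow> real.
        (\<forall>n. H1_on (rect l1 l2) (\<phi> n) \<and> continuous_on (closure (rect l1 l2)) (\<phi> n)) \<and>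
        (\<lambda>n. H1_norm_sq (rect l1 l2) (\<lambda>x. \<phi> n x - f x)) \<longlonglongrightarrow> 0 \<and>
        (\<lambda>n. \<integral>\<^sup>+t. ennreal ((\<phi> n (vector [0, t]) - g t)\<^sup>2) \<partial>lebesgue_on {0<..<l2}) \<longlonglongrightarrow> 0)"

section \<open>Admissible set and energy\<close>

definition admissible ::
  "real \<Rightarrow> real \<Rightarrow> ((real ^ 2 \<Rightarrow> real ^ 2) \<times> (real ^ 2 \<Rightarrow> real)) set" where
  "admissible l1 l2 = {(u, w).
     (\<forall>i. H1_on (rect l1 l2) (\<lambda>x. u x $ i)) \<and> H2_on (rect l1 l2) w \<and>
     has_left_trace l1 l2 w (\<lambda>_. 0) \<and>
     (\<forall>i. has_left_trace l1 l2 (\<lambda>x. u x $ i) (\<lambda>_. 0)) \<and>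
     (\<forall>i. has_left_trace l1 l2 (weak_partial (rect l1 l2) i w) (\<lambda>_. 0)) \<and>
     (AE x in lebesgue_on (rect l1 l2). 0 \<le> w x)}"

definition weak_grad :: "(real ^ 'n::finite) set \<Rightarrow> (real ^ 'n \<Rightarrow> real) \<Rightarrow> real ^ 'n \<Rightarrow> real ^ 'n" where
  "weak_grad \<Omega> f x = (\<chi> i. weak_partial \<Omega> i f x)"

definition weak_jacobian ::
  "(real ^ 'n::finite) set \<Rightarrow> (real ^ 'n \<Rightarrow> real ^ 'm::finite) \<Rightarrow> real ^ 'n \<Rightarrow> real ^ 'n ^ 'm" where
  "weak_jacobian \<Omega> u x = (\<chi> i. weak_grad \<Omega> (\<lambda>y. u y $ i) x)"

definition weak_hessian ::
  "(real ^ 'n::finite) set \<Rightarrow> (real ^ 'n \<Rightarrow> real) \<Rightarrow> real ^ 'n \<Rightarrow> real ^ 'n ^ 'n" where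
  "weak_hessian \<Omega> f = weak_jacobian \<Omega> (weak_grad \<Omega> f)"

definition tensor :: "real ^ 'n \<Rightarrow> real ^ 'm \<Rightarrow> real ^ 'm ^ 'n" where
  "tensor a b = (\<chi> i j. a $ i * b $ j)"

text \<open>
  The library norm on \<open>real ^ 2 ^ 2\<close> is the Frobenius norm. The energy is a nonnegative extended
  real, so that no integrability is presupposed and its infimum has no junk value.
\<close>

definition energy ::
  "real \<Rightarrow> real \<Rightarrow> (real ^ 2 \<Rightarrow> real ^ 2) \<Rightarrow> (real ^ 2 \<Rightarrow> real) \<Rightarrow> real \<Rightarrow> real \<Rightarrow> ennreal" where
  "energy \<sigma> \<gamma> u w l1 l2 = (let \<Omega> = rect l1 l2 in
     (\<integral>\<^sup>+x. ennreal ((norm (weak_jacobian \<Omega> u x + transpose (weak_jacobian \<Omega> u x)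
                          + tensor (weak_grad \<Omega> w x) (weak_grad \<Omega> w x) - mat 1))\<^sup>2) \<partial>lebesgue_on \<Omega>)
     + ennreal ((\<sigma> * l1)\<^sup>2) * (\<integral>\<^sup>+x. ennreal ((norm (weak_hessian \<Omega> w x))\<^sup>2) \<partial>lebesgue_on \<Omega>)
     + ennreal \<gamma> * emeasure lebesgue {x \<in> \<Omega>. 0 < w x})"

text \<open>The minimum value of the energy, as the infimum of its values on the admissible set.\<close>

definition min_energy :: "real \<Rightarrow> real \<Rightarrow> real \<Rightarrow> real \<Rightarrow> ennreal" where
  "min_energy \<sigma> \<gamma> l1 l2 = (INF (u, w)\<in>admissible l1 l2. energy \<sigma> \<gamma> u w l1 l2)"

section \<open>Parameter regimes\<close>

definition regime_X :: "(real \<times> real) set" where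
  "regime_X = {0<..<1} \<times> {0..}"

definition regime_A :: "(real \<times> real) set" where
  "regime_A = {(\<sigma>, \<gamma>) \<in> regime_X. \<sigma> powr (-1) \<le> \<gamma>}"

definition regime_B :: "(real \<times> real) set" where
  "regime_B = {(\<sigma>, \<gamma>) \<in> regime_X. \<sigma> powr (-4/9) \<le> \<gamma> \<and> \<gamma> < \<sigma> powr (-1)}"

definition regime_C :: "(real \<times> real) set" where
  "regime_C = {(\<sigma>, \<gamma>) \<in> regime_X. \<sigma> powr (4/5) \<le> \<gamma> \<and> \<gamma> < \<sigma> powr (-4/9)}"

definition regime_D :: "(real \<times> real) set" where
  "regime_D = {(\<sigma>, \<gamma>) \<in> regime_X. \<gamma> < \<sigma> powr (4/5)}"

end

theory Submission
  imports Defs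
begin

text \<open>
  In the three nontrivial regimes the bound follows from one estimate: the minimum is at most
  \<open>C E l1 l2\<close> whenever \<open>\<sigma> \<le> E \<le> 1\<close> and \<open>\<gamma> \<sigma> \<le> E powr (9/5)\<close> (lemma \<open>min_energy_le_branching\<close>). The value
  of \<open>E\<close> claimed in each of the regimes satisfies these two conditions. The remaining regime is
  covered by the undeformed film.

  The competitor for this estimate is bonded on most of the rectangle, where \<open>w = 0\<close> and \<open>u\<close> has
  gradient one half of the identity up to small errors. As \<open>u\<close> has to vanish on the clamped edge,
  its second component may not grow like \<open>y / 2\<close>; it is kept periodic in \<open>y\<close> with a small period
  \<open>h\<close>, and the film that is in excess in every period is taken up by one thin fold parallel to the
  \<open>x\<close>-axis, of width \<open>d\<close> and height of order \<open>sqrt (h d)\<close>. Wide folds are cheap to bend and narrow folds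
  are cheap to delaminate. Towards the clamped edge the period has to be refined. At the
  distance \<open>x\<close> from the edge, over a length of order \<open>x\<close>, a family of folds of period \<open>h\<close> is
  replaced by a finer family. The passage uses weights whose squares sum to one, and it uses
  families of folds whose supports are disjoint. Then all squares and products of first derivatives of
  \<open>w\<close> superpose without cross terms, the strain in the \<open>y\<close>-direction and the shear strain can be
  cancelled exactly by an explicit \<open>u\<close>, and the strain in the \<open>x\<close>-direction is of order
  \<open>(h / x)\<^sup>2\<close>.

  The layers \<open>j = 0, 1, \<dots>\<close> sit at distances \<open>X j = E l1 32^j\<close> and have periods
  \<open>h j = E l1 12^j\<close> and widths \<open>d j = \<sigma> l1 6^j / 16\<close>. Per unit length of the edge a layer costs
  \<open>X (h / X)^4\<close> of stretching, \<open>(\<sigma> l1)\<^sup>2 X / d\<^sup>2\<close> of bending and \<open>\<gamma> X d / h\<close> of delamination, up to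
  constants. The first two are \<open>E l1\<close> times the geometric sequences with ratios
  \<open>12^4 / 32^3 < 1\<close> and \<open>32 / 6\<^sup>2 < 1\<close>. The third is \<open>\<gamma> \<sigma> l1 16^j\<close>. It increases up to the last layer, where
  \<open>32^j\<close> is about \<open>1 / E\<close>, and \<open>16 = 32 powr (4/5)\<close> makes the sum of order
  \<open>\<gamma> \<sigma> l1 E powr (-4/5)\<close>. This is at most \<open>E l1\<close> precisely by the second
  condition on \<open>E\<close>. In the strip of width \<open>4 X 0\<close> next to the edge, where the layers end, the
  strain is merely bounded, which costs another multiple of \<open>E l1 l2\<close>.

  The energy is defined with weak derivatives that are picked by a choice operator. To evaluate
  it on the competitor, which is continuously differentiable as often as needed, one has to know that weak
  derivatives are unique almost everywhere (lemma \<open>weak_partial_AE_unique\<close>) and that classical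
  derivatives are weak derivatives (lemma \<open>has_continuous_partials_is_weak_partial\<close>).
\<close>

section \<open>Integrals of directional derivatives\<close>

lemma integrable_continuous_compact_support:
  fixes f :: "'a::euclidean_space \<Rightarrow> real"
  assumes "continuous_on UNIV f" "compact K" "\<And>x. x \<notin> K \<Longrightarrow> f x = 0"
  shows "integrable lborel f"
proof -
  have "integrable lborel (\<lambda>x. indicator K x *\<^sub>R f x)"
    using borel_integrable_compact[of K f] assms continuous_on_subset by blast
  moreover have "(\<lambda>x. indicator K x *\<^sub>R f x) = f" using assms(3) by (auto simp: indicator_def fun_eq_iff)
  ultimately show ?thesis by simp
qed

lemma lborel_integral_shift:
  fixes G :: "'a::euclidean_space \<Rightarrow> real"
  assumes "G \<in> borel_measurable borel"
  shows "(\<integral>x. G (x + c) \<partial>lborel) = (\<integral>x. G x \<partial>lborel)"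
proof -
  have "(\<integral>x. G x \<partial>lborel) = (\<integral>x. G x \<partial>(distr lborel borel ((+) c)))"
    by (metis lborel_distr_plus)
  also have "\<dots> = (\<integral>x. G (c + x) \<partial>lborel)"
    using assms by (intro integral_distr) auto
  finally show ?thesis by (simp add: add.commute)
qed

text \<open>
  The integral of \<open>x \<mapsto> G (x + t e)\<close> does not depend on \<open>t\<close>, so the integrals of the difference
  quotients vanish, and dominated convergence carries this over to the derivative. The argument treats every
  direction alike.
\<close>

lemma integral_directional_derivative_eq_0:
  fixes G G' :: "'a::euclidean_space \<Rightarrow> real"
  assumes der: "\<And>x. ((\<lambda>t. G (x + t *\<^sub>R e)) has_real_derivative G' x) (at 0)"
    and cont: "continuous_on UNIV G" "continuous_on UNIV G'"
    and K: "compact K" "\<And>x. x \<notin> K \<Longrightarrow> G x = 0" "\<And>x. x \<notin> K \<Longrightarrow> G' x = 0"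
  shows "(\<integral>x. G' x \<partial>lborel) = 0"
proof -
  have der': "((\<lambda>t. G (x + t *\<^sub>R e)) has_real_derivative G' (x + t *\<^sub>R e)) (at t)" for x t
  proof -
    have "((\<lambda>s. G ((x + t *\<^sub>R e) + (s - t) *\<^sub>R e)) has_real_derivative G' (x + t *\<^sub>R e) * 1) (at t)"
      by (rule DERIV_chain'[of "\<lambda>s. s - t" 1 t UNIV]) (use der[of "x + t *\<^sub>R e"] in \<open>auto intro!: derivative_eq_intros\<close>)
    moreover have "(\<lambda>s. G ((x + t *\<^sub>R e) + (s - t) *\<^sub>R e)) = (\<lambda>s. G (x + s *\<^sub>R e))"
      by (auto simp: algebra_simps)
    ultimately show ?thesis by simp
  qed
  have "compact (G' ` K)" using K(1) cont(2) by (meson compact_continuous_image continuous_on_subset subset_UNIV)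
  then obtain B0 where "\<forall>x\<in>G' ` K. norm x \<le> B0" using compact_imp_bounded bounded_iff by blast
  then have B: "\<bar>G' x\<bar> \<le> \<bar>B0\<bar>" for x
  proof (cases "x \<in> K")
    case True
    with \<open>\<forall>x\<in>G' ` K. norm x \<le> B0\<close> have "\<bar>G' x\<bar> \<le> B0" by simp
    then show ?thesis by linarith
  qed (use K(3) in simp)
  obtain r where r: "\<forall>x\<in>K. norm x \<le> r"
    using compact_imp_bounded[OF K(1)] unfolding bounded_iff by auto
  define g where "g = (\<lambda>n::nat. \<lambda>x. (G (x + (1 / real (Suc n)) *\<^sub>R e) - G x) / (1 / real (Suc n)))"
  have meas [measurable]: "G \<in> borel_measurable borel" "G' \<in> borel_measurable borel"
    using cont by (auto intro: borel_measurable_continuous_onI)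
  have intG: "integrable lborel G"
    using integrable_continuous_compact_support[OF cont(1) K(1,2)] .
  have g0: "(\<integral>x. g n x \<partial>lborel) = 0" for n
  proof -
    have "integrable lborel (\<lambda>x. G (x + (1 / real (Suc n)) *\<^sub>R e))"
    proof -
      have "integrable (distr lborel borel ((+) ((1 / real (Suc n)) *\<^sub>R e))) G"
        using intG by (metis lborel_distr_plus)
      then show ?thesis by (subst (asm) integrable_distr_eq) (auto simp: add.commute)
    qed
    then show ?thesis unfolding g_def using intG lborel_integral_shift[OF meas(1)] by simp
  qed
  have "(\<lambda>n. \<integral>x. g n x \<partial>lborel) \<longlonglongrightarrow> (\<integral>x. G' x \<partial>lborel)"
  proof (rule integral_dominated_convergence[where w = "\<lambda>x. \<bar>B0\<bar> * indicator (cball (0::'a) (r + norm e)) x"])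
    show "G' \<in> borel_measurable lborel" by simp
    show "\<And>i. g i \<in> borel_measurable lborel" unfolding g_def by simp
    show "integrable lborel (\<lambda>x. \<bar>B0\<bar> * indicator (cball (0::'a) (r + norm e)) x)"
      using emeasure_bounded_finite[of "cball (0::'a) (r + norm e)"]
      by (intro integrable_mult_right integrable_real_indicator) (auto)
    show "AE x in lborel. (\<lambda>i. g i x) \<longlonglongrightarrow> G' x"
    proof (rule AE_I2)
      fix x
      have "((\<lambda>h. (G (x + h *\<^sub>R e) - G x) / h) \<longlongrightarrow> G' x) (at 0)"
        using der[of x] by (simp add: DERIV_def)
      moreover have "filterlim (\<lambda>n. 1 / real (Suc n)) (at 0) sequentially"
        unfolding filterlim_at using LIMSEQ_inverse_real_of_nat by (auto simp: inverse_eq_divide)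
      ultimately show "(\<lambda>i. g i x) \<longlonglongrightarrow> G' x" unfolding g_def by (rule filterlim_compose)
    qed
    show "AE x in lborel. norm (g n x) \<le> \<bar>B0\<bar> * indicator (cball (0::'a) (r + norm e)) x" for n
    proof (rule AE_I2)
      fix x
      let ?h = "1 / real (Suc n)"
      have h: "0 < ?h" "?h \<le> 1" by auto
      show "norm (g n x) \<le> \<bar>B0\<bar> * indicator (cball (0::'a) (r + norm e)) x"
      proof (cases "x \<in> cball 0 (r + norm e)")
        case True
        obtain z where "G (x + ?h *\<^sub>R e) - G (x + 0 *\<^sub>R e) = (?h - 0) * G' (x + z *\<^sub>R e)"
          using MVT2[OF h(1), of "\<lambda>t. G (x + t *\<^sub>R e)" "\<lambda>t. G' (x + t *\<^sub>R e)"] der' by blast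
        then have "g n x = G' (x + z *\<^sub>R e)" unfolding g_def using h by simp
        then show ?thesis using B True by simp
      next
        case False
        then have "norm x > r + norm e" by simp
        then have "x \<notin> K" using r norm_ge_zero[of e] by fastforce
        have "norm (?h *\<^sub>R e) \<le> norm e" using h mult_right_mono[of ?h 1 "norm e"] by simp
        then have "norm (x + ?h *\<^sub>R e) > r" 
          using \<open>norm x > r + norm e\<close> norm_triangle_ineq2[of x "- (?h *\<^sub>R e)"] by simp
        then have "x + ?h *\<^sub>R e \<notin> K" using r by fastforce
        with \<open>x \<notin> K\<close> show ?thesis using K(2) False by (simp add: g_def)
      qed
    qed
  qed
  then show ?thesis using g0 LIMSEQ_unique by (simp add: LIMSEQ_const_iff)
qed

section \<open>Test functions approximating boxes\<close>

text \<open>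
  The extensions by zero of \<open>p (1 / t) exp (- 1 / t)\<close>. They form a class that is closed under
  differentiation and whose members vanish on the negative half-line.
\<close>

definition flat :: "real poly \<Rightarrow> real \<Rightarrow> real" where
  "flat p t = (if t > 0 then poly p (1 / t) * exp (- (1 / t)) else 0)"

lemma poly_times_exp_minus_tendsto_0:
  "((\<lambda>s::real. poly p s * exp (- s)) \<longlongrightarrow> 0) at_top"
proof (induction p)
  case 0
  then show ?case by simp
next
  case (pCons a p)
  have *: "((\<lambda>s::real. s ^ k * exp (- s)) \<longlongrightarrow> 0) at_top" for k
    using tendsto_power_div_exp_0[of k] by (simp add: exp_minus divide_inverse)
  have "((\<lambda>s::real. \<Sum>i\<le>degree (pCons a p). coeff (pCons a p) i * (s ^ i * exp (- s))) \<longlongrightarrow> 0) at_top"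
    by (rule tendsto_null_sum) (intro tendsto_mult_right_zero *)
  then show ?case by (simp add: poly_altdef sum_distrib_right mult.assoc)
qed

text \<open>
  At \<open>0\<close> the substitution \<open>s = 1 / t\<close> turns the difference quotient into a polynomial times
  \<open>exp (- s)\<close>, which tends to \<open>0\<close>.
\<close>

lemma flat_has_derivative:
  "(flat p has_real_derivative flat ([:0, 0, 1:] * (p - pderiv p)) t) (at t)"
proof (cases t "0::real" rule: linorder_cases)
  case less
  have "((\<lambda>_. 0) has_real_derivative 0) (at t)" by simp
  then have "(flat p has_real_derivative 0) (at t)"
    by (rule has_field_derivative_transform_within_open[of _ _ _ "{..<0}"]) (use less in \<open>auto simp: flat_def\<close>)
  then show ?thesis using less by (simp add: flat_def)
next
  case greater
  have "((\<lambda>t. poly p (1 / t) * exp (- (1 / t))) has_real_derivative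
     flat ([:0, 0, 1:] * (p - pderiv p)) t) (at t)"
    using greater
    by (auto intro!: derivative_eq_intros simp: flat_def field_simps power2_eq_square)
  then show ?thesis
    by (rule has_field_derivative_transform_within_open[of _ _ _ "{0<..}"]) (use greater in \<open>auto simp: flat_def\<close>)
next
  case equal
  have lim: "((\<lambda>s. poly ([:0, 1:] * p) s * exp (- s)) \<longlongrightarrow> 0) at_top"
    by (rule poly_times_exp_minus_tendsto_0)
  have "((\<lambda>h. flat p h / h) \<longlongrightarrow> 0) (at_right 0)"
  proof (rule Lim_transform_eventually)
    show "((\<lambda>h. poly ([:0, 1:] * p) (inverse h) * exp (- inverse h)) \<longlongrightarrow> 0) (at_right 0)"
      using filterlim_compose[OF lim filterlim_inverse_at_top_right] .
    show "\<forall>\<^sub>F h in at_right 0. poly ([:0, 1:] * p) (inverse h) * exp (- inverse h) = flat p h / h"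
      by (auto simp: eventually_at_filter flat_def field_simps)
  qed
  moreover have "((\<lambda>h. flat p h / h) \<longlongrightarrow> 0) (at_left 0)"
    by (rule tendsto_eventually) (auto simp: eventually_at_filter flat_def)
  ultimately have "((\<lambda>h. flat p h / h) \<longlongrightarrow> 0) (at 0)"
    by (simp add: filterlim_at_split)
  then show ?thesis unfolding equal by (simp add: DERIV_def flat_def)
qed

text \<open>
  An algebra of functions that is closed under all partial derivatives. Hence its members are of
  class \<open>C\<^sup>k\<close> for every \<open>k\<close> by induction on \<open>k\<close>.
\<close>

inductive_set flat_algebra :: "(real ^ 'n::finite \<Rightarrow> real) set" where
  const: "(\<lambda>_. c) \<in> flat_algebra"
| coord: "(\<lambda>x. flat p (c * x $ i + d)) \<in> flat_algebra"
| add: "f \<in> flat_algebra \<Longrightarrow> g \<in> flat_algebra \<Longrightarrow> (\<lambda>x. f x + g x) \<in> flat_algebra"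
| mult: "f \<in> flat_algebra \<Longrightarrow> g \<in> flat_algebra \<Longrightarrow> (\<lambda>x. f x * g x) \<in> flat_algebra"

lemma partial_deriv_eq:
  assumes "(f has_derivative D) (at x)"
  shows "partial_deriv i f x = D (axis i 1)"
  using frechet_derivative_at[OF assms] by (simp add: partial_deriv_def)

lemma flat_algebra_differentiable_closed:
  fixes f :: "real ^ 'n::finite \<Rightarrow> real"
  assumes "f \<in> flat_algebra"
  shows "(\<forall>x. f differentiable (at x)) \<and> (\<forall>i. partial_deriv i f \<in> flat_algebra)"
  using assms
proof induction
  case (const c)
  have "partial_deriv i (\<lambda>x::real ^ 'n. c) = (\<lambda>_. 0)" for i
    by (rule ext, subst partial_deriv_eq[OF has_derivative_const]) simp
  then show ?case by (auto intro: flat_algebra.const)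
next
  case (coord p c j d)
  let ?q = "[:0, 0, 1:] * (p - pderiv p)"
  have D: "((\<lambda>x::real ^ 'n. flat p (c * x $ j + d)) has_derivative
     (\<lambda>v. flat ?q (c * x $ j + d) * (c * v $ j))) (at x)" for x
  proof (rule has_derivative_compose[of "\<lambda>x. c * x $ j + d" "\<lambda>v. c * v $ j" x UNIV "flat p"
      "(*) (flat ?q (c * x $ j + d))"])
    show "((\<lambda>x. c * x $ j + d) has_derivative (\<lambda>v. c * v $ j)) (at x)"
      by (auto intro!: derivative_eq_intros bounded_linear.has_derivative[OF bounded_linear_vec_nth])
    show "(flat p has_derivative (*) (flat ?q (c * x $ j + d))) (at (c * x $ j + d))"
      using flat_has_derivative[of p "c * x $ j + d"] unfolding has_field_derivative_def .
  qed
  have "partial_deriv i (\<lambda>x::real ^ 'n. flat p (c * x $ j + d))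
     = (\<lambda>x. flat ?q (c * x $ j + d) * (c * axis i 1 $ j))" for i
    by (rule ext) (rule partial_deriv_eq[OF D])
  then show ?case using D
    by (auto simp: differentiable_def intro!: flat_algebra.intros)
next
  case (add f g)
  have D: "((\<lambda>x. f x + g x) has_derivative (\<lambda>v. frechet_derivative f (at x) v + frechet_derivative g (at x) v)) (at x)" for x
    using add.IH by (intro derivative_intros) (auto simp: frechet_derivative_works[symmetric])
  have "partial_deriv i (\<lambda>x. f x + g x) = (\<lambda>x. partial_deriv i f x + partial_deriv i g x)" for i
    by (rule ext) (subst partial_deriv_eq[OF D], simp add: partial_deriv_def)
  then show ?case using add D by (auto simp: differentiable_def intro!: flat_algebra.intros)
next
  case (mult f g)
  have D: "((\<lambda>x. f x * g x) has_derivative (\<lambda>v. f x * frechet_derivative g (at x) v + frechet_derivative f (at x) v * g x)) (at x)" for x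
    using mult.IH by (intro derivative_intros) (auto simp: frechet_derivative_works[symmetric])
  have "partial_deriv i (\<lambda>x. f x * g x) = (\<lambda>x. f x * partial_deriv i g x + partial_deriv i f x * g x)" for i
    by (rule ext) (subst partial_deriv_eq[OF D], simp add: partial_deriv_def)
  then show ?case using mult D by (auto simp: differentiable_def intro!: flat_algebra.intros)
qed

lemma flat_algebra_Ck: "f \<in> flat_algebra \<Longrightarrow> Ck k f"
proof (induction k arbitrary: f)
  case 0
  then show ?case
    using flat_algebra_differentiable_closed[OF 0]
    by (auto intro!: continuous_at_imp_continuous_on differentiable_imp_continuous_within)
next
  case (Suc k)
  then show ?case using flat_algebra_differentiable_closed[OF Suc.prems] by auto
qed

lemma flat_algebra_prod:
  assumes "finite I" "\<And>i. i \<in> I \<Longrightarrow> f i \<in> flat_algebra"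
  shows "(\<lambda>x. \<Prod>i\<in>I. f i x) \<in> flat_algebra"
  using assms by (induction I rule: finite_induct) (auto intro: flat_algebra.intros)

text \<open>
  A product of functions \<open>exp (- 1 / (n t))\<close>, with \<open>t\<close> running through the distances of \<open>x\<close> to the
  faces of the box. Every factor tends to \<open>1\<close> inside the box, so the sequence approximates the
  indicator function of the box by test functions.
\<close>

definition box_bump :: "real ^ 'n::finite \<Rightarrow> real ^ 'n \<Rightarrow> nat \<Rightarrow> real ^ 'n \<Rightarrow> real" where
  "box_bump a b n x = (\<Prod>i\<in>UNIV. flat 1 (real (Suc n) * x $ i + - real (Suc n) * a $ i) *
     flat 1 (- real (Suc n) * x $ i + real (Suc n) * b $ i))"

lemma flat_1_bounds: "flat 1 t > 0 \<longleftrightarrow> t > 0" "flat 1 t \<noteq> 0 \<longleftrightarrow> t > 0" "0 \<le> flat 1 t" "flat 1 t \<le> 1"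
  by (auto simp: flat_def)

lemma box_bump_nonzero_iff: "box_bump a b n x \<noteq> 0 \<longleftrightarrow> x \<in> box a b"
proof -
  have *: "0 < real (Suc n) * y + - real (Suc n) * z \<longleftrightarrow> z < y" for y z
  proof -
    have "real (Suc n) * y + - real (Suc n) * z = real (Suc n) * (y - z)" by (simp add: algebra_simps)
    then show ?thesis by (simp add: zero_less_mult_iff)
  qed
  have **: "0 < - real (Suc n) * y + real (Suc n) * z \<longleftrightarrow> y < z" for y z
    using *[of z y] by (simp add: algebra_simps)
  show ?thesis
    unfolding box_bump_def by (auto simp: flat_1_bounds(2) mem_box_cart * ** simp del: of_nat_Suc)
qed

lemma box_bump_bounds: "0 \<le> box_bump a b n x" "box_bump a b n x \<le> 1"
  unfolding box_bump_def
  by (auto intro!: prod_nonneg prod_le_1 mult_nonneg_nonneg mult_le_one simp: flat_1_bounds simp del: of_nat_Suc)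

lemma box_bump_test_function:
  assumes "cbox a b \<subseteq> \<Omega>"
  shows "box_bump a b n \<in> test_functions \<Omega>"
proof -
  have "box_bump a b n \<in> flat_algebra"
    unfolding box_bump_def by (intro flat_algebra_prod flat_algebra.intros) auto
  moreover have "{x. box_bump a b n x \<noteq> 0} = box a b" by (simp add: box_bump_nonzero_iff)
  moreover have "closure (box a b) \<subseteq> cbox a b" by (simp add: box_subset_cbox closure_minimal closed_cbox)
  ultimately show ?thesis using assms flat_algebra_Ck
    by (auto simp: test_functions_def compact_closure bounded_box)
qed

lemma flat_1_scaled_tendsto:
  assumes "t > 0" shows "(\<lambda>n. flat 1 (real (Suc n) * t)) \<longlonglongrightarrow> 1"
proof -
  have "(\<lambda>n. exp (- (inverse (real (Suc n)) * inverse t))) \<longlonglongrightarrow> exp (- (0 * inverse t))"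
    by (intro tendsto_intros LIMSEQ_inverse_real_of_nat)
  moreover have "flat 1 (real (Suc n) * t) = exp (- (inverse (real (Suc n)) * inverse t))" for n
    using assms by (simp add: flat_def field_simps zero_less_mult_iff del: of_nat_Suc)
  ultimately show ?thesis by simp
qed

lemma box_bump_tendsto: "(\<lambda>n. box_bump a b n x) \<longlonglongrightarrow> indicator (box a b) x"
proof (cases "x \<in> box a b")
  case True
  have "(\<lambda>n. \<Prod>i\<in>UNIV. flat 1 (real (Suc n) * (x $ i - a $ i)) * flat 1 (real (Suc n) * (b $ i - x $ i)))
      \<longlonglongrightarrow> (\<Prod>i\<in>(UNIV::'a set). 1 * 1)"
    using True by (intro tendsto_prod tendsto_mult flat_1_scaled_tendsto) (auto simp: mem_box_cart)
  then show ?thesis using True by (simp add: box_bump_def algebra_simps)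
next
  case False
  then have "box_bump a b n x = 0" for n using box_bump_nonzero_iff by blast
  then show ?thesis using False by simp
qed

section \<open>The fundamental lemma of the calculus of variations\<close>

text \<open>
  Boxes form an intersection stable generator of the Borel sets. The sets over which the integral
  of \<open>h\<close> vanishes form a Dynkin system, once it is known that the whole space, as
  an increasing union of boxes, is one of them.
\<close>

lemma null_box_integrals_imp_AE_0:
  fixes h :: "'a::euclidean_space \<Rightarrow> real"
  assumes int: "integrable lborel h"
    and box: "\<And>a b. set_lebesgue_integral lborel (box a b) h = 0"
  shows "AE x in lborel. h x = 0"
proof (rule sigma_finite_measure.density_zero[OF sigma_finite_lborel int])
  fix A :: "'a set" assume "A \<in> sets lborel"
  have total: "set_lebesgue_integral lborel UNIV h = 0"
  proof -
    have "(\<lambda>n. set_lebesgue_integral lborel (box (- real n *\<^sub>R One) (real n *\<^sub>R One)) h)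
       \<longlonglongrightarrow> set_lebesgue_integral lborel UNIV h"
      unfolding set_lebesgue_integral_def
    proof (rule integral_dominated_convergence[where w = "\<lambda>x. norm (h x)"])
      show "AE x in lborel. (\<lambda>n. indicat_real (box (- real n *\<^sub>R One) (real n *\<^sub>R One)) x *\<^sub>R h x)
        \<longlonglongrightarrow> indicat_real UNIV x *\<^sub>R h x"
      proof (rule AE_I2)
        fix x :: 'a
        obtain N where N: "x \<in> box (- real N *\<^sub>R One) (real N *\<^sub>R One)"
        proof -
          obtain N where "norm x < real N" using reals_Archimedean2 by blast
          then have "x \<in> box (- real N *\<^sub>R One) (real N *\<^sub>R One)"
            using Basis_le_norm[of _ x] by (fastforce simp: mem_box abs_le_iff)
          then show ?thesis by (rule that)
        qed
        have "x \<in> box (- real n *\<^sub>R One) (real n *\<^sub>R One)" if "n \<ge> N" for n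
          using N that by (fastforce simp: mem_box)
        then show "(\<lambda>n. indicat_real (box (- real n *\<^sub>R One) (real n *\<^sub>R One)) x *\<^sub>R h x)
          \<longlonglongrightarrow> indicat_real UNIV x *\<^sub>R h x"
          by (intro tendsto_eventually) (auto simp: eventually_sequentially intro!: exI[of _ N])
      qed
    qed (use int in \<open>auto simp: indicator_def\<close>)
    then show ?thesis using box by (simp add: LIMSEQ_const_iff)
  qed
  have si: "set_integrable lborel B h" if "B \<in> sets borel" for B
    unfolding set_integrable_def using that int by (intro integrable_mult_indicator) auto
  have "Int_stable (range (\<lambda>(a, b). box a b :: 'a set))"
    by (auto simp: Int_stable_def box_Int_box)
  moreover have "range (\<lambda>(a, b). box a b :: 'a set) \<subseteq> Pow UNIV" by simp
  moreover have "A \<in> sigma_sets UNIV (range (\<lambda>(a, b). box a b :: 'a set))"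
    using \<open>A \<in> sets lborel\<close> by (simp add: borel_eq_box)
  ultimately show "set_lebesgue_integral lborel A h = 0"
  proof (induction rule: sigma_sets_induct_disjoint)
    case (basic A)
    then show ?case using box by auto
  next
    case empty
    then show ?case by (simp add: set_lebesgue_integral_def)
  next
    case (compl A)
    then have A: "A \<in> sets borel" by (simp add: borel_eq_box)
    have "set_lebesgue_integral lborel (A \<union> (UNIV - A)) h
       = set_lebesgue_integral lborel A h + set_lebesgue_integral lborel (UNIV - A) h"
      by (rule set_integral_Un) (use A in \<open>auto intro!: si\<close>)
    then show ?case using compl.IH total by simp
  next
    case (union A)
    then have A: "\<And>i. A i \<in> sets borel" by (auto simp: borel_eq_box)
    have "set_lebesgue_integral lborel (\<Union>i. A i) h = (\<Sum>i. set_lebesgue_integral lborel (A i) h)"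
      by (rule lebesgue_integral_countable_add) (use A union(1) in \<open>auto intro!: si simp: disjoint_family_on_def\<close>)
    then show ?case using union.IH by simp
  qed
qed

lemma null_box_integrals_imp_AE_0_lebesgue:
  fixes h :: "'a::euclidean_space \<Rightarrow> real"
  assumes int: "integrable lebesgue h"
    and box: "\<And>a b. (\<integral>x. indicator (box a b) x * h x \<partial>lebesgue) = 0"
  shows "AE x in lebesgue. h x = 0"
proof -
  obtain g where g [measurable]: "g \<in> borel_measurable lborel" and gh: "AE x in lborel. h x = g x"
    using completion_ex_borel_measurable_real[OF borel_measurable_integrable[OF int]] by auto
  have gh': "AE x in lebesgue. h x = g x" using gh by (rule AE_completion)
  have g' [measurable]: "g \<in> borel_measurable lebesgue" using g by (rule measurable_completion)
  note [measurable] = borel_measurable_integrable[OF int]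
  have [measurable]: "box a b \<in> sets lebesgue" for a b :: 'a
    by (simp add: borel_open)
  have "integrable lebesgue g" using int gh' by (subst integrable_cong_AE[symmetric, OF _ _ gh']) auto
  then have "integrable lborel g" using g by (simp add: integrable_completion)
  moreover have "set_lebesgue_integral lborel (box a b) g = 0" for a b
  proof -
    have "set_lebesgue_integral lborel (box a b) g = (\<integral>x. indicator (box a b) x * g x \<partial>lebesgue)"
      unfolding set_lebesgue_integral_def by (subst integral_completion) auto
    also have "\<dots> = (\<integral>x. indicator (box a b) x * h x \<partial>lebesgue)"
      by (rule integral_cong_AE) (use gh' in auto)
    finally show ?thesis using box by simp
  qed
  ultimately have "AE x in lborel. g x = 0" by (rule null_box_integrals_imp_AE_0)
  then have "AE x in lebesgue. g x = 0" by (rule AE_completion)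
  with gh' show ?thesis by eventually_elim simp
qed

text \<open>
  Inserting the test functions \<open>box_bump\<close> and passing to the limit shows that the integral over
  every closed box inside \<open>\<Omega>\<close> vanishes. As \<open>h\<close> is only locally integrable, the previous lemma is applied
  on each member of a countable cover of \<open>\<Omega>\<close> by such boxes.
\<close>

lemma fundamental_lemma_calculus_of_variations:
  fixes h :: "real ^ 'n::finite \<Rightarrow> real"
  assumes \<Omega>: "open \<Omega>" and loc: "locally_integrable \<Omega> h"
    and test: "\<And>\<phi>. \<phi> \<in> test_functions \<Omega> \<Longrightarrow> (\<integral>x. h x * \<phi> x \<partial>lebesgue_on \<Omega>) = 0"
  shows "AE x in lebesgue_on \<Omega>. h x = 0"
proof -
  have [measurable]: "\<Omega> \<in> sets lebesgue" using \<Omega> by simp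
  have sub: "(\<integral>x. indicator (box a b) x * h x \<partial>lebesgue) = 0" if ab: "cbox a b \<subseteq> \<Omega>" for a b
  proof -
    have int: "integrable lebesgue (\<lambda>x. indicator (cbox a b) x *\<^sub>R h x)"
      using loc ab by (auto simp: locally_integrable_def set_integrable_def)
    have "(\<lambda>n. \<integral>x. box_bump a b n x * (indicator (cbox a b) x *\<^sub>R h x) \<partial>lebesgue) \<longlonglongrightarrow>
       (\<integral>x. indicator (box a b) x * (indicator (cbox a b) x *\<^sub>R h x) \<partial>lebesgue)"
    proof (rule integral_dominated_convergence[where w = "\<lambda>x. norm (indicator (cbox a b) x *\<^sub>R h x)"])
      have "continuous_on UNIV (box_bump a b n)" for n
        using box_bump_test_function[OF ab, of n] Ck.simps(1) unfolding test_functions_def by blast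
      then have bm: "box_bump a b n \<in> borel_measurable lebesgue" for n
        by (intro measurable_completion) (auto intro: borel_measurable_continuous_onI)
      have hm: "(\<lambda>x. indicator (cbox a b) x *\<^sub>R h x) \<in> borel_measurable lebesgue"
        using int by (rule borel_measurable_integrable)
      show "(\<lambda>x. box_bump a b n x * (indicator (cbox a b) x *\<^sub>R h x)) \<in> borel_measurable lebesgue" for n
        by (rule borel_measurable_times[OF bm hm])
      show "(\<lambda>x. indicator (box a b) x * (indicator (cbox a b) x *\<^sub>R h x)) \<in> borel_measurable lebesgue"
        by (rule borel_measurable_times[OF borel_measurable_indicator hm]) (simp add: borel_open)
      show "integrable lebesgue (\<lambda>x. norm (indicat_real (cbox a b) x *\<^sub>R h x))"
        using int by (rule integrable_norm)
      show "AE x in lebesgue. (\<lambda>n. box_bump a b n x * (indicat_real (cbox a b) x *\<^sub>R h x))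
        \<longlonglongrightarrow> indicat_real (box a b) x * (indicat_real (cbox a b) x *\<^sub>R h x)"
        by (intro AE_I2 tendsto_mult box_bump_tendsto tendsto_const)
      show "AE x in lebesgue. norm (box_bump a b n x * (indicat_real (cbox a b) x *\<^sub>R h x))
        \<le> norm (indicat_real (cbox a b) x *\<^sub>R h x)" for n
        unfolding norm_mult[of "box_bump a b n _"] real_norm_def[of "box_bump a b n _"]
        using box_bump_bounds[of a b n] by (intro AE_I2 mult_left_le_one_le norm_ge_zero) auto
    qed
    moreover have "(\<integral>x. box_bump a b n x * (indicator (cbox a b) x *\<^sub>R h x) \<partial>lebesgue) = 0" for n
    proof -
      have "(\<integral>x. h x * box_bump a b n x \<partial>lebesgue_on \<Omega>)
         = (\<integral>x. indicator \<Omega> x *\<^sub>R (h x * box_bump a b n x) \<partial>lebesgue)"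
        by (rule integral_restrict_space) simp
      also have "(\<lambda>x. indicat_real \<Omega> x *\<^sub>R (h x * box_bump a b n x))
         = (\<lambda>x. box_bump a b n x * (indicator (cbox a b) x *\<^sub>R h x))"
      proof
        fix x
        show "indicat_real \<Omega> x *\<^sub>R (h x * box_bump a b n x) = box_bump a b n x * (indicator (cbox a b) x *\<^sub>R h x)"
          using box_bump_nonzero_iff[of a b n x] ab box_subset_cbox[of a b]
          by (cases "x \<in> box a b") (auto simp: indicator_def)
      qed
      finally show ?thesis using test[OF box_bump_test_function[OF ab]] by simp
    qed
    moreover have "(\<lambda>x. indicator (box a b) x * (indicator (cbox a b) x *\<^sub>R h x)) = (\<lambda>x. indicator (box a b) x * h x)"
      using box_subset_cbox[of a b] by (auto simp: indicator_def fun_eq_iff)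
    ultimately show ?thesis by (simp add: LIMSEQ_const_iff)
  qed
  obtain \<D> where \<D>: "countable \<D>" "\<D> \<subseteq> Pow \<Omega>" "\<And>X. X \<in> \<D> \<Longrightarrow> \<exists>a b. X = cbox a b" "\<Union>\<D> = \<Omega>"
    using open_countable_Union_open_cbox[OF \<Omega>] by metis
  have "AE x in lebesgue. \<forall>X\<in>\<D>. x \<in> X \<longrightarrow> h x = 0"
  proof (subst AE_ball_countable[OF \<D>(1)], rule ballI)
    fix X assume X: "X \<in> \<D>"
    then obtain a b where ab: "X = cbox a b" using \<D>(3) by blast
    then have sub\<Omega>: "cbox a b \<subseteq> \<Omega>" using X \<D>(2) by blast
    have "AE x in lebesgue. indicator (cbox a b) x *\<^sub>R h x = 0"
    proof (rule null_box_integrals_imp_AE_0_lebesgue)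
      show int: "integrable lebesgue (\<lambda>x. indicator (cbox a b) x *\<^sub>R h x)"
        using loc sub\<Omega> by (auto simp: locally_integrable_def set_integrable_def)
      fix c d :: "real ^ 'n"
      define p q where "p = (\<chi> i. max (a $ i) (c $ i))" and "q = (\<chi> i. min (b $ i) (d $ i))"
      then have pq: "box p q = box a b \<inter> box c d" "cbox p q = cbox a b \<inter> cbox c d"
        by (auto simp: mem_box_cart)
      have neg: "negligible (cbox a b - box a b)" by (simp add: negligible_frontier_interval)
      have "AE x in lebesgue. x \<notin> cbox a b - box a b"
        using neg unfolding negligible_iff_null_sets by (rule AE_not_in)
      then have "(\<integral>x. indicator (box c d) x * (indicator (cbox a b) x *\<^sub>R h x) \<partial>lebesgue)
         = (\<integral>x. indicator (box p q) x * (indicator (cbox a b) x *\<^sub>R h x) \<partial>lebesgue)"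
        using pq(1)
        by (intro integral_cong_AE borel_measurable_times borel_measurable_integrable[OF int] borel_measurable_indicator)
          (auto elim!: eventually_mono simp: indicator_def borel_open)
      also have "(\<lambda>x. indicator (box p q) x * (indicator (cbox a b) x *\<^sub>R h x)) = (\<lambda>x. indicator (box p q) x * h x)"
        using pq box_subset_cbox[of a b] by (auto simp: indicator_def fun_eq_iff)
      finally show "(\<integral>x. indicator (box c d) x * (indicator (cbox a b) x *\<^sub>R h x) \<partial>lebesgue) = 0"
        using sub[of p q] pq sub\<Omega> by auto
    qed
    then show "AE x in lebesgue. x \<in> X \<longrightarrow> h x = 0" by eventually_elim (auto simp: ab indicator_def)
  qed
  then show ?thesis
    by (subst AE_restrict_space_iff) (use \<D>(4) in \<open>auto elim!: eventually_mono\<close>)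
qed

section \<open>Weak derivatives of continuously differentiable functions\<close>

text \<open>
  Functions of class \<open>C\<^sup>1\<close> on the whole space, recorded with their partial derivatives. Only
  derivatives along coordinate directions enter, which suits sums of products \<open>a (x\<^sub>1) b (x\<^sub>2)\<close>.
\<close>

definition has_continuous_partials ::
  "(real ^ 'n::finite \<Rightarrow> real) \<Rightarrow> ('n \<Rightarrow> real ^ 'n \<Rightarrow> real) \<Rightarrow> bool" where
  "has_continuous_partials f D \<longleftrightarrow> continuous_on UNIV f \<and> (\<forall>i. continuous_on UNIV (D i)) \<and>
     (\<forall>i x. ((\<lambda>t. f (x + t *\<^sub>R axis i 1)) has_real_derivative D i x) (at 0))"

lemma integrable_lborel_imp_lebesgue:
  fixes f :: "'a::euclidean_space \<Rightarrow> real"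
  assumes "integrable lborel f" shows "integrable lebesgue f"
  using integrable_completion[OF borel_measurable_integrable[OF assms]] assms by simp

lemma continuous_imp_locally_integrable:
  assumes "continuous_on UNIV f" shows "locally_integrable \<Omega> f"
  unfolding locally_integrable_def set_integrable_def
proof (intro allI impI)
  fix K assume K: "compact K \<and> K \<subseteq> \<Omega>"
  then have "integrable lborel (\<lambda>x. indicator K x *\<^sub>R f x)"
    using borel_integrable_compact[of K f] assms continuous_on_subset by blast
  then show "integrable lebesgue (\<lambda>x. indicat_real K x *\<^sub>R f x)"
    by (rule integrable_lborel_imp_lebesgue)
qed

text \<open>
  This supplies the integrability, and with it the measurability, that is needed to split integrals against
  test functions and to change functions on null sets.
\<close>

lemma locally_integrable_mult_integrable:
  fixes h :: "real ^ 'n::finite \<Rightarrow> real"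
  assumes \<Omega>: "open \<Omega>" and h: "locally_integrable \<Omega> h" and \<phi>: "continuous_on UNIV \<phi>"
    and K: "compact K" "K \<subseteq> \<Omega>" "\<And>x. x \<notin> K \<Longrightarrow> \<phi> x = 0"
  shows "integrable (lebesgue_on \<Omega>) (\<lambda>x. h x * \<phi> x)"
proof -
  have int: "integrable lebesgue (\<lambda>x. indicator K x *\<^sub>R h x)"
    using h K by (auto simp: locally_integrable_def set_integrable_def)
  have "compact (\<phi> ` K)" using K(1) \<phi> by (meson compact_continuous_image continuous_on_subset subset_UNIV)
  then have "bounded (\<phi> ` K)" by (rule compact_imp_bounded)
  then obtain B where B: "\<forall>y\<in>\<phi> ` K. norm y \<le> B" by (auto simp: bounded_iff)
  have \<phi>m: "\<phi> \<in> borel_measurable lebesgue"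
    using \<phi> by (intro measurable_completion) (auto intro: borel_measurable_continuous_onI)
  have "integrable lebesgue (\<lambda>x. \<phi> x * (indicator K x *\<^sub>R h x))"
  proof (rule Bochner_Integration.integrable_bound)
    show "integrable lebesgue (\<lambda>x. B * (indicator K x *\<^sub>R h x))" using int by (rule integrable_mult_right)
    show "(\<lambda>x. \<phi> x * (indicator K x *\<^sub>R h x)) \<in> borel_measurable lebesgue"
      by (rule borel_measurable_times[OF \<phi>m borel_measurable_integrable[OF int]])
    show "AE x in lebesgue. norm (\<phi> x * (indicat_real K x *\<^sub>R h x)) \<le> norm (B * (indicat_real K x *\<^sub>R h x))"
    proof (rule AE_I2)
      fix x
      show "norm (\<phi> x * (indicat_real K x *\<^sub>R h x)) \<le> norm (B * (indicat_real K x *\<^sub>R h x))"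
      proof (cases "x \<in> K")
        case True
        then have "\<bar>\<phi> x\<bar> \<le> \<bar>B\<bar>" using B by force
        then show ?thesis by (simp add: abs_mult mult_right_mono)
      qed simp
    qed
  qed
  moreover have "(\<lambda>x. \<phi> x * (indicator K x *\<^sub>R h x)) = (\<lambda>x. indicator \<Omega> x *\<^sub>R (h x * \<phi> x))"
    using K by (auto simp: indicator_def fun_eq_iff)
  ultimately show ?thesis using \<Omega> by (subst integrable_restrict_space) auto
qed

lemma test_functionD:
  assumes "\<phi> \<in> test_functions \<Omega>"
  shows "continuous_on UNIV \<phi>" "continuous_on UNIV (partial_deriv i \<phi>)" 
    "((\<lambda>t. \<phi> (x + t *\<^sub>R axis i 1)) has_real_derivative partial_deriv i \<phi> x) (at 0)"
    "\<exists>K. compact K \<and> K \<subseteq> \<Omega> \<and> (\<forall>x. x \<notin> K \<longrightarrow> \<phi> x = 0 \<and> partial_deriv i \<phi> x = 0)"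
proof -
  have 1: "Ck 0 \<phi>" "Ck (Suc 0) \<phi>" using assms unfolding test_functions_def by blast+
  then show "continuous_on UNIV \<phi>" "continuous_on UNIV (partial_deriv i \<phi>)" by auto
  have d: "(\<phi> has_derivative frechet_derivative \<phi> (at x)) (at x)" for x
    using 1(2) by (simp add: frechet_derivative_works[symmetric])
  have "((\<lambda>t. \<phi> (x + t *\<^sub>R axis i 1)) has_derivative (\<lambda>t. frechet_derivative \<phi> (at x) (t *\<^sub>R axis i 1))) (at 0)"
    by (rule has_derivative_compose[where f = "\<lambda>t. x + t *\<^sub>R axis i 1" and g = \<phi>])
       (use d[of x] in \<open>auto intro!: derivative_eq_intros\<close>)
  moreover have "(\<lambda>t. frechet_derivative \<phi> (at x) (t *\<^sub>R axis i 1)) = (*) (partial_deriv i \<phi> x)"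
    using linear_scale[OF has_derivative_linear[OF d[of x]]] by (auto simp: partial_deriv_def mult.commute)
  ultimately show "((\<lambda>t. \<phi> (x + t *\<^sub>R axis i 1)) has_real_derivative partial_deriv i \<phi> x) (at 0)"
    by (simp add: has_field_derivative_def)
  let ?K = "closure {x. \<phi> x \<noteq> 0}"
  have "partial_deriv i \<phi> x = 0" if "x \<notin> ?K" for x
  proof -
    have "(\<phi> has_derivative (\<lambda>_. 0)) (at x)"
      by (rule has_derivative_transform_within_open[OF has_derivative_const[of 0], where s = "- ?K"])
         (use that closure_subset[of "{x. \<phi> x \<noteq> 0}"] in auto)
    then show ?thesis by (rule partial_deriv_eq)
  qed
  then show "\<exists>K. compact K \<and> K \<subseteq> \<Omega> \<and> (\<forall>x. x \<notin> K \<longrightarrow> \<phi> x = 0 \<and> partial_deriv i \<phi> x = 0)"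
    using assms closure_subset[of "{x. \<phi> x \<noteq> 0}"] unfolding test_functions_def
    by (intro exI[of _ ?K]) auto
qed

text \<open>
  The product \<open>f \<phi>\<close> has compact support, so the integral of its partial derivative vanishes. The
  product rule turns this into integration by parts.
\<close>

lemma has_continuous_partials_is_weak_partial:
  assumes \<Omega>: "open \<Omega>" and f: "has_continuous_partials f D"
  shows "is_weak_partial \<Omega> i f (D i)"
  unfolding is_weak_partial_def
proof (intro conjI ballI)
  have fc: "continuous_on UNIV f" "continuous_on UNIV (D i)"
    and fd: "\<And>x. ((\<lambda>t. f (x + t *\<^sub>R axis i 1)) has_real_derivative D i x) (at 0)"
    using f by (auto simp: has_continuous_partials_def)
  show "locally_integrable \<Omega> f" "locally_integrable \<Omega> (D i)"
    using fc by (auto intro: continuous_imp_locally_integrable)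
  fix \<phi> assume \<phi>: "\<phi> \<in> test_functions \<Omega>"
  note \<phi>c = test_functionD(1)[OF \<phi>] test_functionD(2)[OF \<phi>, of i] and \<phi>d = test_functionD(3)[OF \<phi>]
  obtain K where K: "compact K" "K \<subseteq> \<Omega>" "\<And>x. x \<notin> K \<Longrightarrow> \<phi> x = 0" "\<And>x. x \<notin> K \<Longrightarrow> partial_deriv i \<phi> x = 0"
    using test_functionD(4)[OF \<phi>, of i] by blast
  have conv: "(\<integral>x. h x \<partial>lebesgue_on \<Omega>) = (\<integral>x. h x \<partial>lborel)"
    if "continuous_on UNIV h" "\<And>x. x \<notin> K \<Longrightarrow> h x = 0" for h :: "real ^ 'a \<Rightarrow> real"
  proof -
    have "(\<integral>x. h x \<partial>lebesgue_on \<Omega>) = (\<integral>x. indicator \<Omega> x *\<^sub>R h x \<partial>lebesgue)"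
      by (rule integral_restrict_space) (use \<Omega> in simp)
    also have "(\<lambda>x. indicator \<Omega> x *\<^sub>R h x) = h" using that(2) K(2) by (auto simp: indicator_def fun_eq_iff)
    also have "(\<integral>x. h x \<partial>lebesgue) = (\<integral>x. h x \<partial>lborel)"
      by (rule integral_completion) (use that in \<open>auto intro: borel_measurable_continuous_onI\<close>)
    finally show ?thesis .
  qed
  have i1: "integrable lborel (\<lambda>x. f x * partial_deriv i \<phi> x)"
    by (rule integrable_continuous_compact_support[OF _ K(1)]) (use fc \<phi>c K in \<open>auto intro: continuous_intros\<close>)
  have i2: "integrable lborel (\<lambda>x. D i x * \<phi> x)"
    by (rule integrable_continuous_compact_support[OF _ K(1)]) (use fc \<phi>c K in \<open>auto intro: continuous_intros\<close>)
  have "(\<integral>x. f x * partial_deriv i \<phi> x + D i x * \<phi> x \<partial>lborel) = 0"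
  proof (rule integral_directional_derivative_eq_0[where G = "\<lambda>x. f x * \<phi> x" and K = K and e = "axis i 1"])
    show "((\<lambda>t. f (x + t *\<^sub>R axis i 1) * \<phi> (x + t *\<^sub>R axis i 1)) has_real_derivative
         f x * partial_deriv i \<phi> x + D i x * \<phi> x) (at 0)" for x
      using DERIV_mult[OF fd[of x] \<phi>d[where x = x and i = i]] by (simp add: add.commute mult.commute)
  qed (use fc \<phi>c K in \<open>auto intro!: continuous_intros\<close>)
  then have "(\<integral>x. f x * partial_deriv i \<phi> x \<partial>lborel) + (\<integral>x. D i x * \<phi> x \<partial>lborel) = 0"
    using i1 i2 by simp
  then show "(\<integral>x. f x * partial_deriv i \<phi> x \<partial>lebesgue_on \<Omega>) = - (\<integral>x. D i x * \<phi> x \<partial>lebesgue_on \<Omega>)"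
    using fc \<phi>c K by (subst (1 2) conv) (auto intro!: continuous_intros)
qed

lemma weak_partial_AE_unique:
  assumes \<Omega>: "open \<Omega>" and g: "is_weak_partial \<Omega> i f g"
  shows "AE x in lebesgue_on \<Omega>. weak_partial \<Omega> i f x = g x"
proof -
  let ?h = "weak_partial \<Omega> i f"
  have h: "is_weak_partial \<Omega> i f ?h" unfolding weak_partial_def using someI[of "is_weak_partial \<Omega> i f", OF g] .
  have "AE x in lebesgue_on \<Omega>. ?h x - g x = 0"
  proof (rule fundamental_lemma_calculus_of_variations[OF \<Omega>])
    show "locally_integrable \<Omega> (\<lambda>x. ?h x - g x)"
      using g h unfolding is_weak_partial_def locally_integrable_def
      by (auto intro!: set_integral_diff)
    fix \<phi> assume \<phi>: "\<phi> \<in> test_functions \<Omega>"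
    obtain K where K: "compact K" "K \<subseteq> \<Omega>" "\<And>x. x \<notin> K \<Longrightarrow> \<phi> x = 0"
      using test_functionD(4)[OF \<phi>, of i] by blast
    have "integrable (lebesgue_on \<Omega>) (\<lambda>x. ?h x * \<phi> x)" "integrable (lebesgue_on \<Omega>) (\<lambda>x. g x * \<phi> x)"
      using g h unfolding is_weak_partial_def
      by (auto intro!: locally_integrable_mult_integrable[OF \<Omega> _ test_functionD(1)[OF \<phi>] K])
    then show "(\<integral>x. (?h x - g x) * \<phi> x \<partial>lebesgue_on \<Omega>) = 0"
      using g h \<phi> unfolding is_weak_partial_def by (simp add: left_diff_distrib)
  qed
  then show ?thesis by simp
qed

lemma locally_integrable_cong_AE:
  assumes \<Omega>: "open \<Omega>" and f: "locally_integrable \<Omega> f" and eq: "AE x in lebesgue_on \<Omega>. f x = g x"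
  shows "locally_integrable \<Omega> g"
proof -
  have "AE x in lebesgue. x \<in> \<Omega> \<longrightarrow> f x = g x"
    using eq \<Omega> by (simp add: AE_restrict_space_iff)
  then have "{x. \<not> (x \<in> \<Omega> \<longrightarrow> f x = g x)} \<in> null_sets lebesgue"
    using completion.AE_iff_null_sets[of "\<lambda>x. x \<in> \<Omega> \<longrightarrow> f x = g x" lborel] by simp
  then have "negligible {x. \<not> (x \<in> \<Omega> \<longrightarrow> f x = g x)}" by (simp add: negligible_iff_null_sets)
  then show ?thesis using f unfolding locally_integrable_def
    by (auto intro: absolutely_integrable_spike[where S = "{x. \<not> (x \<in> \<Omega> \<longrightarrow> f x = g x)}"])
qed

lemma is_weak_partial_cong_AE:
  assumes \<Omega>: "open \<Omega>" and f: "is_weak_partial \<Omega> i f g" and eq: "AE x in lebesgue_on \<Omega>. f x = f' x"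
  shows "is_weak_partial \<Omega> i f' g"
proof -
  have f': "locally_integrable \<Omega> f'"
    using f locally_integrable_cong_AE[OF \<Omega> _ eq] by (auto simp: is_weak_partial_def)
  have "(\<integral>x. f' x * partial_deriv i \<phi> x \<partial>lebesgue_on \<Omega>) = (\<integral>x. f x * partial_deriv i \<phi> x \<partial>lebesgue_on \<Omega>)"
    if \<phi>: "\<phi> \<in> test_functions \<Omega>" for \<phi>
  proof (rule integral_cong_AE)
    obtain K where K: "compact K" "K \<subseteq> \<Omega>" "\<And>x. x \<notin> K \<Longrightarrow> partial_deriv i \<phi> x = 0"
      using test_functionD(4)[OF \<phi>, of i] by blast
    note int = locally_integrable_mult_integrable[OF \<Omega> _ test_functionD(2)[OF \<phi>] K]
    show "(\<lambda>x. f' x * partial_deriv i \<phi> x) \<in> borel_measurable (lebesgue_on \<Omega>)"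
      "(\<lambda>x. f x * partial_deriv i \<phi> x) \<in> borel_measurable (lebesgue_on \<Omega>)"
      using int f' f by (auto intro!: borel_measurable_integrable simp: is_weak_partial_def)
    show "AE x in lebesgue_on \<Omega>. f' x * partial_deriv i \<phi> x = f x * partial_deriv i \<phi> x"
      using eq by eventually_elim simp
  qed
  then show ?thesis using f f' by (simp add: is_weak_partial_def)
qed

lemma L2_on_continuous:
  fixes f :: "'a::euclidean_space \<Rightarrow> real"
  assumes "continuous_on UNIV f" "bounded \<Omega>" "open \<Omega>"
  shows "L2_on \<Omega> f"
proof -
  have m: "f \<in> borel_measurable lebesgue"
    using assms by (intro measurable_completion) (auto intro: borel_measurable_continuous_onI)
  have K: "compact (closure \<Omega>)" using assms by simp
  have "continuous_on (closure \<Omega>) (\<lambda>x. (f x)\<^sup>2)"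
    by (rule continuous_on_subset[of UNIV]) (use assms in \<open>auto intro!: continuous_intros\<close>)
  then have "set_integrable lborel (closure \<Omega>) (\<lambda>x. (f x)\<^sup>2)"
    unfolding set_integrable_def by (rule borel_integrable_compact[OF K])
  then have "set_integrable lborel \<Omega> (\<lambda>x. (f x)\<^sup>2)"
    by (rule set_integrable_subset) (use assms closure_subset in auto)
  then have "integrable lebesgue (\<lambda>x. indicator \<Omega> x *\<^sub>R (f x)\<^sup>2)"
    unfolding set_integrable_def by (rule integrable_lborel_imp_lebesgue)
  then show ?thesis unfolding L2_on_def using m assms
    by (auto simp: integrable_restrict_space intro: measurable_restrict_space1)
qed

lemma L2_on_cong_AE:
  fixes f :: "'a::euclidean_space \<Rightarrow> real"
  assumes \<Omega>: "open \<Omega>" and f: "L2_on \<Omega> f" and eq: "AE x in lebesgue_on \<Omega>. f x = g x"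
  shows "L2_on \<Omega> g"
proof -
  have eq': "AE x in lebesgue. (if x \<in> \<Omega> then f x else 0) = (if x \<in> \<Omega> then g x else 0)"
    using eq \<Omega> by (auto simp: AE_restrict_space_iff elim!: eventually_mono)
  have "(\<lambda>x. if x \<in> \<Omega> then f x else 0) \<in> borel_measurable lebesgue"
    using f \<Omega> by (subst borel_measurable_if) (auto simp: L2_on_def)
  then have "(\<lambda>x. if x \<in> \<Omega> then g x else 0) \<in> borel_measurable lebesgue"
    by (rule borel_measurable_AE[OF _ eq'])
  then have g: "g \<in> borel_measurable (lebesgue_on \<Omega>)"
    using \<Omega> by (subst (asm) borel_measurable_if) auto
  moreover have "integrable (lebesgue_on \<Omega>) (\<lambda>x. (g x)\<^sup>2)"
    by (rule integrable_cong_AE_imp[of _ "\<lambda>x. (f x)\<^sup>2"]) (use f g eq in \<open>auto simp: L2_on_def elim!: eventually_mono\<close>)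
  ultimately show ?thesis by (simp add: L2_on_def)
qed

text \<open>
  The function \<open>g\<close> is allowed to differ from \<open>f\<close> on a null set because second derivatives of \<open>w\<close> are
  weak derivatives of the chosen representative of a weak derivative.
\<close>

lemma has_continuous_partials_H1:
  assumes \<Omega>: "open \<Omega>" "bounded \<Omega>" and f: "has_continuous_partials f D"
    and eq: "AE x in lebesgue_on \<Omega>. f x = g x"
  shows "H1_on \<Omega> g" "AE x in lebesgue_on \<Omega>. weak_partial \<Omega> i g x = D i x"
proof -
  have w: "is_weak_partial \<Omega> i g (D i)" for i
    using is_weak_partial_cong_AE[OF \<Omega>(1) has_continuous_partials_is_weak_partial[OF \<Omega>(1) f] eq] .
  have "L2_on \<Omega> (D i)" for i
    using f \<Omega> by (intro L2_on_continuous) (auto simp: has_continuous_partials_def)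
  moreover have "L2_on \<Omega> g"
    by (rule L2_on_cong_AE[OF \<Omega>(1) L2_on_continuous eq]) (use f \<Omega> in \<open>auto simp: has_continuous_partials_def\<close>)
  ultimately show "H1_on \<Omega> g" using w unfolding H1_on_def by blast
  show "AE x in lebesgue_on \<Omega>. weak_partial \<Omega> i g x = D i x"
    using w by (rule weak_partial_AE_unique[OF \<Omega>(1)])
qed

section \<open>Admissible pairs given by classical functions\<close>

lemma rect_eq_box: "rect l1 l2 = box 0 (vector [l1, l2])"
  by (auto simp: rect_def mem_box_cart forall_2)

lemma open_rect: "open (rect l1 l2)" and bounded_rect: "bounded (rect l1 l2)"
  by (simp_all add: rect_eq_box bounded_box open_box)

lemma has_continuous_partials_zero: "has_continuous_partials (\<lambda>_. 0) (\<lambda>_ _. 0)"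
  by (auto simp: has_continuous_partials_def)

lemma H1_norm_sq_AE_0:
  assumes "AE x in lebesgue_on (rect l1 l2). f x = 0"
  shows "H1_norm_sq (rect l1 l2) f = 0"
proof -
  have "AE x in lebesgue_on (rect l1 l2). 0 = f x" using assms by eventually_elim simp
  note * = has_continuous_partials_H1(2)[OF open_rect bounded_rect has_continuous_partials_zero this]
  have "(\<integral>\<^sup>+x. ennreal ((f x)\<^sup>2) \<partial>lebesgue_on (rect l1 l2)) = (\<integral>\<^sup>+x. 0 \<partial>lebesgue_on (rect l1 l2))"
    by (rule nn_integral_cong_AE) (use assms in eventually_elim, simp)
  moreover have "(\<integral>\<^sup>+x. ennreal ((weak_partial (rect l1 l2) i f x)\<^sup>2) \<partial>lebesgue_on (rect l1 l2))
    = (\<integral>\<^sup>+x. 0 \<partial>lebesgue_on (rect l1 l2))" for i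
    by (rule nn_integral_cong_AE) (use *[of i] in eventually_elim, simp)
  ultimately show ?thesis by (simp add: H1_norm_sq_def)
qed

text \<open>
  The function \<open>f\<close> is a continuous representative of \<open>g\<close>, so the constant sequence \<open>f\<close> is an
  admissible approximation of \<open>g\<close> in the definition of the trace.
\<close>

lemma has_left_trace_zero:
  assumes f: "has_continuous_partials f D" and zero: "\<And>t. f (vector [0, t]) = 0"
    and eq: "AE x in lebesgue_on (rect l1 l2). f x = g x"
  shows "has_left_trace l1 l2 g (\<lambda>_. 0)"
  unfolding has_left_trace_def
proof (intro conjI exI[of _ "\<lambda>_. f"] allI)
  show "H1_on (rect l1 l2) g" by (rule has_continuous_partials_H1(1)[OF open_rect bounded_rect f eq])
  show "H1_on (rect l1 l2) f" by (rule has_continuous_partials_H1(1)[OF open_rect bounded_rect f]) simp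
  show "L2_on {0<..<l2} (\<lambda>_. 0)" by (simp add: L2_on_def)
  show "continuous_on (closure (rect l1 l2)) f"
    using f continuous_on_subset unfolding has_continuous_partials_def by blast
  have "H1_norm_sq (rect l1 l2) (\<lambda>x. f x - g x) = 0"
    by (rule H1_norm_sq_AE_0) (use eq in eventually_elim, simp)
  then show "(\<lambda>n. H1_norm_sq (rect l1 l2) (\<lambda>x. f x - g x)) \<longlonglongrightarrow> 0" by simp
  show "(\<lambda>n. \<integral>\<^sup>+ t. ennreal ((f (vector [0, t]) - 0)\<^sup>2) \<partial>lebesgue_on {0<..<l2}) \<longlonglongrightarrow> 0"
    using zero by simp
qed

text \<open>
  A pair of displacements given by classical functions on the plane, with \<open>DU i k\<close> the \<open>k\<close>-th
  derivative of \<open>u\<^sub>i\<close> and with \<open>DW\<close> and \<open>HW\<close> the gradient and the Hessian of \<open>w\<close>.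
\<close>

locale classical_pair =
  fixes l1 l2 :: real and u :: "real ^ 2 \<Rightarrow> real ^ 2" and w :: "real ^ 2 \<Rightarrow> real"
    and DU :: "2 \<Rightarrow> 2 \<Rightarrow> real ^ 2 \<Rightarrow> real" and DW :: "2 \<Rightarrow> real ^ 2 \<Rightarrow> real"
    and HW :: "2 \<Rightarrow> 2 \<Rightarrow> real ^ 2 \<Rightarrow> real"
  assumes DU: "\<And>i. has_continuous_partials (\<lambda>x. u x $ i) (DU i)"
    and DW: "has_continuous_partials w DW" and HW: "\<And>i. has_continuous_partials (DW i) (HW i)"
begin

abbreviation "\<Omega> \<equiv> rect l1 l2"

lemma weak_partial_u: "AE x in lebesgue_on \<Omega>. weak_partial \<Omega> j (\<lambda>y. u y $ i) x = DU i j x"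
  by (rule has_continuous_partials_H1(2)[OF open_rect bounded_rect DU]) simp

lemma weak_partial_w: "AE x in lebesgue_on \<Omega>. weak_partial \<Omega> i w x = DW i x"
  by (rule has_continuous_partials_H1(2)[OF open_rect bounded_rect DW]) simp

lemma weak_partial_w': "AE x in lebesgue_on \<Omega>. DW i x = weak_partial \<Omega> i w x"
  using weak_partial_w[of i] by eventually_elim simp

lemma weak_partial_weak_partial_w:
  "AE x in lebesgue_on \<Omega>. weak_partial \<Omega> j (weak_partial \<Omega> i w) x = HW i j x"
  by (rule has_continuous_partials_H1(2)[OF open_rect bounded_rect HW weak_partial_w'])

lemma admissibleI:
  assumes "\<And>t i. u (vector [0, t]) $ i = 0" "\<And>t. w (vector [0, t]) = 0"
    "\<And>t i. DW i (vector [0, t]) = 0" "\<And>x. 0 \<le> w x"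
  shows "(u, w) \<in> admissible l1 l2"
proof -
  have "H1_on \<Omega> (\<lambda>x. u x $ i)" for i
    by (rule has_continuous_partials_H1(1)[OF open_rect bounded_rect DU[of i]]) simp
  moreover have "H1_on \<Omega> w" by (rule has_continuous_partials_H1(1)[OF open_rect bounded_rect DW]) simp
  moreover have "H1_on \<Omega> (weak_partial \<Omega> i w)" for i
    by (rule has_continuous_partials_H1(1)[OF open_rect bounded_rect HW weak_partial_w'])
  moreover have "has_left_trace l1 l2 w (\<lambda>_. 0)" by (rule has_left_trace_zero[OF DW]) (use assms in auto)
  moreover have "has_left_trace l1 l2 (\<lambda>x. u x $ i) (\<lambda>_. 0)" for i
    by (rule has_left_trace_zero[OF DU[of i]]) (use assms in auto)
  moreover have "has_left_trace l1 l2 (weak_partial \<Omega> i w) (\<lambda>_. 0)" for i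
    by (rule has_left_trace_zero[OF HW[of i] _ weak_partial_w']) (use assms in auto)
  ultimately show ?thesis using assms by (auto simp: admissible_def H2_on_def)
qed

lemma energy_eq:
  "energy \<sigma> \<gamma> u w l1 l2 =
     (\<integral>\<^sup>+x. ennreal (\<Sum>i\<in>UNIV. \<Sum>j\<in>UNIV.
        (DU i j x + DU j i x + DW i x * DW j x - (if i = j then 1 else 0))\<^sup>2) \<partial>lebesgue_on \<Omega>)
     + ennreal ((\<sigma> * l1)\<^sup>2) * (\<integral>\<^sup>+x. ennreal (\<Sum>i\<in>UNIV. \<Sum>j\<in>UNIV. (HW i j x)\<^sup>2) \<partial>lebesgue_on \<Omega>)
     + ennreal \<gamma> * emeasure lebesgue {x \<in> \<Omega>. 0 < w x}"
proof -
  have norm_sq: "(norm M)\<^sup>2 = (\<Sum>i\<in>UNIV. \<Sum>j\<in>UNIV. (M $ i $ j)\<^sup>2)" for M :: "real ^ 2 ^ 2"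
    unfolding power2_norm_eq_inner inner_vec_def by (simp add: power2_eq_square)
  have AE: "AE x in lebesgue_on \<Omega>. \<forall>i\<in>UNIV. \<forall>j\<in>UNIV. weak_partial \<Omega> j (\<lambda>y. u y $ i) x = DU i j x"
    "AE x in lebesgue_on \<Omega>. \<forall>i\<in>UNIV. weak_partial \<Omega> i w x = DW i x"
    "AE x in lebesgue_on \<Omega>. \<forall>i\<in>UNIV. \<forall>j\<in>UNIV. weak_partial \<Omega> j (weak_partial \<Omega> i w) x = HW i j x"
    by (intro AE_finite_allI weak_partial_u weak_partial_w weak_partial_weak_partial_w finite)+
  have 1: "(\<integral>\<^sup>+x. ennreal ((norm (weak_jacobian \<Omega> u x + transpose (weak_jacobian \<Omega> u x)
        + tensor (weak_grad \<Omega> w x) (weak_grad \<Omega> w x) - mat 1))\<^sup>2) \<partial>lebesgue_on \<Omega>)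
    = (\<integral>\<^sup>+x. ennreal (\<Sum>i\<in>UNIV. \<Sum>j\<in>UNIV.
        (DU i j x + DU j i x + DW i x * DW j x - (if i = j then 1 else 0))\<^sup>2) \<partial>lebesgue_on \<Omega>)"
    by (rule nn_integral_cong_AE, use AE(1,2) in eventually_elim)
       (simp add: norm_sq weak_jacobian_def weak_grad_def transpose_def tensor_def mat_def)
  have 2: "(\<integral>\<^sup>+x. ennreal ((norm (weak_hessian \<Omega> w x))\<^sup>2) \<partial>lebesgue_on \<Omega>)
    = (\<integral>\<^sup>+x. ennreal (\<Sum>i\<in>UNIV. \<Sum>j\<in>UNIV. (HW i j x)\<^sup>2) \<partial>lebesgue_on \<Omega>)"
    by (rule nn_integral_cong_AE, use AE(3) in eventually_elim)
       (simp add: norm_sq weak_hessian_def weak_jacobian_def weak_grad_def)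
  show ?thesis unfolding energy_def Let_def 1 2 ..
qed

end

lemma min_energy_le: "(u, w) \<in> admissible l1 l2 \<Longrightarrow> min_energy \<sigma> \<gamma> l1 l2 \<le> energy \<sigma> \<gamma> u w l1 l2"
  unfolding min_energy_def by (rule INF_lower2) auto

lemma has_continuous_partials_separable:
  fixes a b a' b' :: "real \<Rightarrow> real"
  assumes a: "\<And>s. (a has_real_derivative a' s) (at s)" "continuous_on UNIV a'"
    and b: "\<And>s. (b has_real_derivative b' s) (at s)" "continuous_on UNIV b'"
  shows "has_continuous_partials (\<lambda>x. a (x $ 1) * b (x $ 2))
    (\<lambda>i x :: real ^ 2. if i = 1 then a' (x $ 1) * b (x $ 2) else a (x $ 1) * b' (x $ 2))"
proof -
  have c: "continuous_on UNIV a" "continuous_on UNIV b"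
    using a(1) b(1) by (meson DERIV_continuous_on)+
  have cc: "continuous_on UNIV (\<lambda>x :: real ^ 2. h (x $ i))" if "continuous_on UNIV h" for h :: "real \<Rightarrow> real" and i
    by (rule continuous_on_compose2[OF that]) (auto intro!: continuous_intros)
  have D: "((\<lambda>t. a (x $ 1 + t)) has_real_derivative a' (x $ 1)) (at 0)"
    "((\<lambda>t. b (x $ 2 + t)) has_real_derivative b' (x $ 2)) (at 0)" for x :: "real ^ 2"
    using DERIV_shift[of a "a' (x $ 1)" 0 "x $ 1"] a(1)[of "x $ 1"]
      DERIV_shift[of b "b' (x $ 2)" 0 "x $ 2"] b(1)[of "x $ 2"] by (simp_all add: add.commute)
  show ?thesis
    unfolding has_continuous_partials_def
  proof (intro conjI allI)
    show "continuous_on UNIV (\<lambda>x :: real ^ 2. a (x $ 1) * b (x $ 2))"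
      using c cc by (intro continuous_on_mult) auto
    show "continuous_on UNIV (\<lambda>x :: real ^ 2. if i = 1 then a' (x $ 1) * b (x $ 2) else a (x $ 1) * b' (x $ 2))"
      for i :: 2
      using c cc a b by (cases "i = 1") (auto intro!: continuous_on_mult)
    show "((\<lambda>t. a ((x + t *\<^sub>R axis i 1) $ 1) * b ((x + t *\<^sub>R axis i 1) $ 2)) has_real_derivative
      (if i = 1 then a' (x $ 1) * b (x $ 2) else a (x $ 1) * b' (x $ 2))) (at 0)" for i and x :: "real ^ 2"
    proof (cases "i = 1")
      case True
      then show ?thesis using DERIV_cmult_right[OF D(1)[of x], of "b (x $ 2)"] by (simp add: axis_def)
    next
      case False
      then have "i = 2" using exhaust_2[of i] by simp
      then show ?thesis using DERIV_cmult[OF D(2)[of x], of "a (x $ 1)"] by (simp add: axis_def)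
    qed
  qed
qed

lemma has_continuous_partials_add:
  assumes "has_continuous_partials f D" "has_continuous_partials g E"
  shows "has_continuous_partials (\<lambda>x. f x + g x) (\<lambda>i x. D i x + E i x)"
  using assms unfolding has_continuous_partials_def by (auto intro!: continuous_intros derivative_intros)

lemma has_continuous_partials_sum:
  assumes "\<And>j. j \<in> J \<Longrightarrow> has_continuous_partials (f j) (D j)"
  shows "has_continuous_partials (\<lambda>x. \<Sum>j\<in>J. f j x) (\<lambda>i x. \<Sum>j\<in>J. D j i x)"
  using assms unfolding has_continuous_partials_def by (auto intro!: continuous_intros derivative_intros)

section \<open>Weights of the layers\<close>

lemma has_real_derivative_max_0_power:
  "((\<lambda>t::real. (max 0 t) ^ Suc (Suc n)) has_real_derivative real (Suc (Suc n)) * (max 0 t) ^ Suc n) (at t)"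
proof (cases t "0::real" rule: linorder_cases)
  case less
  have "((\<lambda>t::real. (max 0 t) ^ Suc (Suc n)) has_real_derivative 0) (at t)"
    by (rule has_field_derivative_transform_within_open[of "\<lambda>_. 0" _ _ "{..<0}"]) (use less in auto)
  then show ?thesis using less by simp
next
  case greater
  have "((\<lambda>t. t ^ Suc (Suc n)) has_real_derivative real (Suc (Suc n)) * t ^ Suc n) (at t)"
    using DERIV_pow[of "Suc (Suc n)" t] by simp
  then have "((\<lambda>t::real. (max 0 t) ^ Suc (Suc n)) has_real_derivative real (Suc (Suc n)) * t ^ Suc n) (at t)"
    by (rule has_field_derivative_transform_within_open[of _ _ _ "{0<..}"]) (use greater in auto)
  then show ?thesis using greater by simp
next
  case equal
  have "((\<lambda>h::real. (max 0 h) ^ Suc n) \<longlongrightarrow> (max 0 0) ^ Suc n) (at 0)" by (intro tendsto_intros)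
  then have "((\<lambda>h::real. (max 0 h) ^ Suc n) \<longlongrightarrow> 0) (at 0)" by simp
  moreover have "\<forall>\<^sub>F h::real in at 0. (max 0 h) ^ Suc n = (max 0 h) ^ Suc (Suc n) / h"
    by (auto simp: eventually_at_filter max_def)
  ultimately have "((\<lambda>h::real. (max 0 h) ^ Suc (Suc n) / h) \<longlongrightarrow> 0) (at 0)"
    by (rule Lim_transform_eventually)
  then show ?thesis unfolding equal by (simp add: DERIV_def)
qed

lemma max_0_cube_derivs:
  "((\<lambda>t::real. (max 0 t) ^ 3) has_real_derivative 3 * (max 0 t) ^ 2) (at t)"
  "((\<lambda>t::real. (max 0 t) ^ 2) has_real_derivative 2 * max 0 t) (at t)"
  using has_real_derivative_max_0_power[of 1 t] has_real_derivative_max_0_power[of 0 t]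
  by (simp_all add: numeral_eq_Suc)

lemma bounded_if_compact_support:
  fixes f :: "real \<Rightarrow> real"
  assumes "continuous_on UNIV f" "\<And>t. t \<notin> {a..b} \<Longrightarrow> f t = 0"
  obtains K where "K \<ge> 0" "\<And>t. \<bar>f t\<bar> \<le> K"
proof -
  have "compact (f ` {a..b})" by (rule compact_continuous_image[OF continuous_on_subset[OF assms(1)]]) auto
  then have "bounded (f ` {a..b})" by (rule compact_imp_bounded)
  then obtain B where B: "\<forall>t\<in>{a..b}. \<bar>f t\<bar> \<le> B" by (auto simp: bounded_iff)
  have "\<bar>f t\<bar> \<le> max B 0" for t
    using B assms(2)[of t] by (cases "t \<in> {a..b}") (auto simp: le_max_iff_disj)
  then show ?thesis using that[of "max B 0"] by simp
qed

text \<open>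
  The step is a cubic spline: the third difference of \<open>t\<^sub>+\<^sup>3 / 6\<close>. Its first derivative is the
  quadratic B-spline, which is nonnegative, so the step increases from \<open>0\<close> to \<open>1\<close>.
\<close>

lemma smooth_step_exists:
  "\<exists>\<psi> \<psi>1 \<psi>2 :: real \<Rightarrow> real. (\<forall>z. (\<psi> has_real_derivative \<psi>1 z) (at z)) \<and>
     (\<forall>z. (\<psi>1 has_real_derivative \<psi>2 z) (at z)) \<and> continuous_on UNIV \<psi>2 \<and>
     (\<forall>z\<le>1. \<psi> z = 0 \<and> \<psi>1 z = 0 \<and> \<psi>2 z = 0) \<and> (\<forall>z\<ge>4. \<psi> z = 1 \<and> \<psi>1 z = 0 \<and> \<psi>2 z = 0) \<and>
     (\<forall>z. 0 \<le> \<psi> z \<and> \<psi> z \<le> 1)"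
proof -
  define p where "p = (\<lambda>(n::nat) z::real. (max 0 (z - 1)) ^ n - 3 * (max 0 (z - 2)) ^ n + 3 * (max 0 (z - 3)) ^ n - (max 0 (z - 4)) ^ n)"
  have sh: "((\<lambda>z. z - c) has_real_derivative 1) (at z)" for c z :: real
    by (auto intro!: derivative_eq_intros)
  have 3: "((\<lambda>z. (max 0 (z - c)) ^ 3) has_real_derivative 3 * (max 0 (z - c)) ^ 2) (at z)" for c z :: real
    using DERIV_chain'[OF sh max_0_cube_derivs(1), of c z] by simp
  have 2: "((\<lambda>z. (max 0 (z - c)) ^ 2) has_real_derivative 2 * max 0 (z - c)) (at z)" for c z :: real
    using DERIV_chain'[OF sh max_0_cube_derivs(2), of c z] by simp
  have d3: "((\<lambda>z. p 3 z / 6) has_real_derivative p 2 z / 2) (at z)" for z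
    unfolding p_def by (rule derivative_eq_intros 3 | simp)+
  have d2: "((\<lambda>z. p 2 z / 2) has_real_derivative p 1 z) (at z)" for z
    unfolding p_def by (rule derivative_eq_intros 2 | simp)+
  have nonneg: "0 \<le> p 2 z / 2" for z
  proof -
    consider "z \<le> 1" | "1 \<le> z" "z \<le> 2" | "2 \<le> z" "z \<le> 3" | "3 \<le> z" "z \<le> 4" | "4 \<le> z" by linarith
    then show ?thesis
    proof cases
      case 3
      then have "0 \<le> 1 + 2 * ((z - 2) * (3 - z))" by simp
      moreover have "p 2 z = 1 + 2 * ((z - 2) * (3 - z))" using 3 by (simp add: p_def power2_eq_square algebra_simps)
      ultimately show ?thesis by simp
    next
      case 4
      then have "p 2 z = (4 - z)\<^sup>2" by (simp add: p_def power2_eq_square algebra_simps)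
      then show ?thesis by simp
    next
      case 5
      then have "p 2 z = 0" by (simp add: p_def power2_eq_square algebra_simps)
      then show ?thesis by simp
    qed (auto simp: p_def)
  qed
  have one: "p 3 z / 6 = 1 \<and> p 2 z / 2 = 0 \<and> p 1 z = 0" if "z \<ge> 4" for z
    using that by (simp add: p_def power2_eq_square power3_eq_cube) (simp add: algebra_simps)
  have mono: "p 3 y / 6 \<le> p 3 z / 6" if "y \<le> z" for y z
    by (rule DERIV_nonneg_imp_nondecreasing[OF that]) (use d3 nonneg in blast)
  show ?thesis
  proof (intro exI conjI allI)
    show "0 \<le> p 3 z / 6" for z using mono[of "min 1 z" z] by (simp add: p_def min_def split: if_splits)
    show "p 3 z / 6 \<le> 1" for z using mono[of z "max 4 z"] one[of "max 4 z"] by linarith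
    show "((\<lambda>z. p 3 z / 6) has_real_derivative p 2 z / 2) (at z)" for z by (rule d3)
    show "((\<lambda>z. p 2 z / 2) has_real_derivative p 1 z) (at z)" for z by (rule d2)
    show "continuous_on UNIV (p 1)" unfolding p_def by (intro continuous_intros)
    show "z \<le> 1 \<longrightarrow> p 3 z / 6 = 0 \<and> p 2 z / 2 = 0 \<and> p 1 z = 0" for z by (simp add: p_def)
    show "z \<ge> 4 \<longrightarrow> p 3 z / 6 = 1 \<and> p 2 z / 2 = 0 \<and> p 1 z = 0" for z
      using one by blast
  qed
qed

text \<open>
  The functions \<open>s (x / X j)\<close> with \<open>X j = 32^j X 0\<close> are the weights of the layers. The support of
  each meets only the supports of its two neighbours, since \<open>128 < 32\<^sup>2\<close>, and by the identity with
  \<open>\<beta>\<close> the sum of their squares telescopes to a function that is \<open>1\<close> away from the two ends.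
\<close>

definition is_cutoff :: "real \<Rightarrow> (real \<Rightarrow> real) \<Rightarrow> (real \<Rightarrow> real) \<Rightarrow> (real \<Rightarrow> real) \<Rightarrow> (real \<Rightarrow> real) \<Rightarrow> bool" where
  "is_cutoff K s s1 s2 \<beta> \<longleftrightarrow>
     (\<forall>z. (s has_real_derivative s1 z) (at z)) \<and> (\<forall>z. (s1 has_real_derivative s2 z) (at z)) \<and>
     continuous_on UNIV s2 \<and>
     (\<forall>z. z \<le> 1 \<or> 128 \<le> z \<longrightarrow> s z = 0 \<and> s1 z = 0 \<and> s2 z = 0) \<and>
     (\<forall>z. 0 \<le> s z \<and> s z \<le> 1 \<and> \<bar>s1 z\<bar> \<le> K \<and> \<bar>s2 z\<bar> \<le> K) \<and>
     (\<forall>z. (s z)\<^sup>2 = \<beta> z - \<beta> (z / 32)) \<and> (\<forall>z. 0 \<le> \<beta> z \<and> \<beta> z \<le> 1) \<and>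
     (\<forall>z\<le>1. \<beta> z = 0) \<and> (\<forall>z\<ge>4. \<beta> z = 1)"

text \<open>
  Take \<open>s z = sin (\<pi>/2 (\<psi> z + \<psi> (z / 32)))\<close> with the smooth step \<open>\<psi>\<close>. For \<open>z \<le> 32\<close> the second
  step is still \<open>0\<close>, and for \<open>z \<ge> 32\<close> the first one is already \<open>1\<close> and turns the sine into a
  cosine, so \<open>s\<^sup>2\<close> is the difference of two values of \<open>\<beta> = sin\<^sup>2 (\<pi>/2 \<psi>)\<close>.
\<close>

lemma cutoff_exists: "\<exists>K s s1 s2 \<beta>. K \<ge> 1 \<and> is_cutoff K s s1 s2 \<beta>"
proof -
  obtain \<psi> \<psi>1 \<psi>2 :: "real \<Rightarrow> real" where
    \<psi>: "\<And>z. (\<psi> has_real_derivative \<psi>1 z) (at z)" "\<And>z. (\<psi>1 has_real_derivative \<psi>2 z) (at z)"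
      "continuous_on UNIV \<psi>2"
    and \<psi>0: "\<And>z. z \<le> 1 \<Longrightarrow> \<psi> z = 0 \<and> \<psi>1 z = 0 \<and> \<psi>2 z = 0"
    and \<psi>1: "\<And>z. 4 \<le> z \<Longrightarrow> \<psi> z = 1 \<and> \<psi>1 z = 0 \<and> \<psi>2 z = 0"
    and \<psi>01: "\<And>z. 0 \<le> \<psi> z \<and> \<psi> z \<le> 1"
    using smooth_step_exists by blast
  have \<psi>s: "((\<lambda>z. f (z / 32)) has_real_derivative f' (z / 32) / 32) (at z)"
    if "\<And>z. (f has_real_derivative f' z) (at z)" for f f' :: "real \<Rightarrow> real" and z
  proof -
    have "((\<lambda>z. z / 32) has_real_derivative 1 / 32) (at z)" by (auto intro!: derivative_eq_intros)
    from DERIV_chain'[OF this that] show ?thesis by simp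
  qed
  define \<theta> \<theta>1 \<theta>2 where "\<theta> = (\<lambda>z. pi / 2 * (\<psi> z + \<psi> (z / 32)))"
    and "\<theta>1 = (\<lambda>z. pi / 2 * (\<psi>1 z + \<psi>1 (z / 32) / 32))"
    and "\<theta>2 = (\<lambda>z. pi / 2 * (\<psi>2 z + \<psi>2 (z / 32) / 32 / 32))"
  have \<theta>: "(\<theta> has_real_derivative \<theta>1 z) (at z)" "(\<theta>1 has_real_derivative \<theta>2 z) (at z)" for z
    unfolding \<theta>_def \<theta>1_def \<theta>2_def
    by (rule DERIV_cmult[OF DERIV_add[OF \<psi>(1) \<psi>s[OF \<psi>(1)]]]
        DERIV_cmult[OF DERIV_add[OF \<psi>(2) DERIV_cdivide[OF \<psi>s[OF \<psi>(2)]]]])+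
  have "continuous_on UNIV (\<lambda>z. \<psi>2 (z / 32))"
    by (rule continuous_on_compose2[OF \<psi>(3)]) (auto intro!: continuous_intros)
  then have \<theta>c: "continuous_on UNIV \<theta>" "continuous_on UNIV \<theta>1" "continuous_on UNIV \<theta>2"
    using DERIV_continuous_on[OF \<theta>(1)] DERIV_continuous_on[OF \<theta>(2)] \<psi>(3)
    by (auto intro!: continuous_intros simp: \<theta>2_def)
  define s s1 s2 \<beta> where "s = (\<lambda>z. sin (\<theta> z))" and "s1 = (\<lambda>z. cos (\<theta> z) * \<theta>1 z)"
    and "s2 = (\<lambda>z. - sin (\<theta> z) * (\<theta>1 z)\<^sup>2 + cos (\<theta> z) * \<theta>2 z)"
    and "\<beta> = (\<lambda>z. (sin (pi / 2 * \<psi> z))\<^sup>2)"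
  have sd: "(s has_real_derivative s1 z) (at z)" "(s1 has_real_derivative s2 z) (at z)" for z
    unfolding s_def s1_def s2_def
    by (rule derivative_eq_intros \<theta> refl | simp add: power2_eq_square)+
  have sc: "continuous_on UNIV s1" "continuous_on UNIV s2"
    unfolding s1_def s2_def by (intro continuous_intros \<theta>c)+
  have \<theta>out: "(\<theta> z = 0 \<or> \<theta> z = pi) \<and> \<theta>1 z = 0 \<and> \<theta>2 z = 0" if "z \<le> 1 \<or> 128 \<le> z" for z
  proof (cases "z \<le> 1")
    case True
    then have "z / 32 \<le> 1" by simp
    then show ?thesis using \<psi>0[OF True] \<psi>0[of "z / 32"] by (simp add: \<theta>_def \<theta>1_def \<theta>2_def)
  next
    case False
    with that have "4 \<le> z" "4 \<le> z / 32" by auto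
    then show ?thesis using \<psi>1[of z] \<psi>1[of "z / 32"] by (simp add: \<theta>_def \<theta>1_def \<theta>2_def)
  qed
  then have out: "s z = 0 \<and> s1 z = 0 \<and> s2 z = 0" if "z \<le> 1 \<or> 128 \<le> z" for z
    using \<theta>out[OF that] by (auto simp: s_def s1_def s2_def)
  obtain K1 where K1: "\<And>z. \<bar>s1 z\<bar> \<le> K1"
    by (rule bounded_if_compact_support[OF sc(1), of 1 128]) (use out in force)+
  obtain K2 where K2: "\<And>z. \<bar>s2 z\<bar> \<le> K2"
    by (rule bounded_if_compact_support[OF sc(2), of 1 128]) (use out in force)+
  have \<theta>0: "0 \<le> \<theta> z" "\<theta> z \<le> pi" for z
  proof -
    have "\<psi> z + \<psi> (z / 32) \<le> 2" using \<psi>01[of z] \<psi>01[of "z / 32"] by simp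
    then have "pi / 2 * (\<psi> z + \<psi> (z / 32)) \<le> pi / 2 * 2" by (intro mult_left_mono) auto
    then show "\<theta> z \<le> pi" by (simp add: \<theta>_def)
    show "0 \<le> \<theta> z" using \<psi>01[of z] \<psi>01[of "z / 32"] by (simp add: \<theta>_def)
  qed
  have tele: "(s z)\<^sup>2 = \<beta> z - \<beta> (z / 32)" for z
  proof (cases "z \<le> 32")
    case True
    then show ?thesis using \<psi>0[of "z / 32"] by (simp add: s_def \<theta>_def \<beta>_def)
  next
    case False
    have "sin (\<theta> z) = cos (pi / 2 * \<psi> (z / 32))"
      using False \<psi>1[of z] by (simp add: \<theta>_def distrib_left sin_add)
    then show ?thesis using False \<psi>1[of z] by (simp add: s_def \<beta>_def cos_squared_eq)
  qed
  have "is_cutoff (1 + \<bar>K1\<bar> + \<bar>K2\<bar>) s s1 s2 \<beta>"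
    unfolding is_cutoff_def
  proof (intro conjI allI)
    show "\<bar>s1 z\<bar> \<le> 1 + \<bar>K1\<bar> + \<bar>K2\<bar>" "\<bar>s2 z\<bar> \<le> 1 + \<bar>K1\<bar> + \<bar>K2\<bar>" for z
      using K1[of z] K2[of z] by linarith+
    show "0 \<le> s z" "s z \<le> 1" for z unfolding s_def using \<theta>0 by (auto intro: sin_ge_zero)
    show "\<beta> z \<le> 1" for z unfolding \<beta>_def by (simp add: abs_square_le_1)
  qed (use sd sc out tele \<psi>0 \<psi>1 in \<open>auto simp: \<beta>_def\<close>)
  then show ?thesis by (intro exI[of _ "1 + \<bar>K1\<bar> + \<bar>K2\<bar>"]) auto
qed

section \<open>Periodic arrays of folds\<close>

text \<open>
  The representative of \<open>y - c\<close> modulo \<open>h\<close> that is closest to \<open>0\<close>. Composing a function with it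
  extends the function periodically from a cell of length \<open>h\<close> centred at \<open>c\<close>.
\<close>

definition residue :: "real \<Rightarrow> real \<Rightarrow> real \<Rightarrow> real" where
  "residue h c y = y - c - h * of_int (round ((y - c) / h))"

lemma abs_residue_le: "h > 0 \<Longrightarrow> \<bar>residue h c y\<bar> \<le> h / 2"
proof -
  assume h: "h > 0"
  have "residue h c y = h * ((y - c) / h - of_int (round ((y - c) / h)))"
    using h by (simp add: residue_def field_simps)
  then have "\<bar>residue h c y\<bar> = h * \<bar>of_int (round ((y - c) / h)) - (y - c) / h\<bar>"
    using h by (simp add: abs_mult abs_minus_commute)
  also have "\<dots> \<le> h * (1 / 2)"
    using h of_int_round_abs_le[of "(y - c) / h"] by (intro mult_left_mono) auto
  finally show ?thesis by simp
qed

text \<open>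
  The residue jumps by \<open>h\<close> in the middle between two centres. If \<open>F\<close> takes matching values around
  \<open>h / 2\<close> and \<open>- h / 2\<close>, the jump is invisible, and near every point the periodic extension is a
  single translate of \<open>F\<close>. Derivatives and continuity are inherited from \<open>F\<close>.
\<close>

lemma periodic_extension_local:
  assumes h: "h > 0" and F: "\<And>t. h / 4 < t \<Longrightarrow> t < 3 * h / 4 \<Longrightarrow> F t = F (t - h)"
    and s: "\<bar>s - y\<bar> < h / 4"
  shows "F (residue h c s) = F (s - c - h * of_int (round ((y - c) / h)))"
proof -
  define m n where "m = round ((s - c) / h)" and "n = round ((y - c) / h)"
  define t where "t = s - c - h * of_int n"
  have r: "residue h c s = t - h * of_int (m - n)"
    by (simp add: residue_def t_def m_def n_def algebra_simps)
  have "t = residue h c y + (s - y)" by (simp add: residue_def t_def n_def)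
  then have t: "\<bar>t\<bar> < 3 * h / 4" using abs_residue_le[OF h, of c y] s by linarith
  have rs: "\<bar>t - h * of_int (m - n)\<bar> \<le> h / 2" using abs_residue_le[OF h, of c s] r by simp
  then have "\<bar>h * of_int (m - n)\<bar> < h * 2" using t h by linarith
  then have "\<bar>real_of_int (m - n)\<bar> < 2" using h by (simp add: abs_mult)
  then have "\<bar>m - n\<bar> < 2" by linarith
  then consider "m - n = 0" | "m - n = 1" | "m - n = - 1" by linarith
  then have "F (residue h c s) = F t"
  proof cases
    case 1
    then show ?thesis using r by simp
  next
    case 2
    then show ?thesis using r rs t F[of t] h by simp
  next
    case 3
    then show ?thesis using r rs t F[of "t + h"] h by simp
  qed
  then show ?thesis by (simp add: t_def n_def)
qed

lemma periodic_extension_has_derivative: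
  assumes h: "h > 0" and F: "\<And>t. h / 4 < t \<Longrightarrow> t < 3 * h / 4 \<Longrightarrow> F t = F (t - h)"
    and d: "\<And>t. (F has_real_derivative F' t) (at t)"
  shows "((\<lambda>y. F (residue h c y)) has_real_derivative F' (residue h c y)) (at y)"
proof -
  let ?k = "c + h * of_int (round ((y - c) / h))"
  have k: "residue h c y = y - ?k" by (simp add: residue_def)
  have "((\<lambda>s. s - ?k) has_real_derivative 1) (at y)" by (auto intro!: derivative_eq_intros)
  from DERIV_chain'[OF this d] have "((\<lambda>s. F (s - ?k)) has_real_derivative F' (residue h c y)) (at y)"
    by (simp add: k)
  then show ?thesis
    by (rule has_field_derivative_transform_within_open[of _ _ _ "ball y (h / 4)"])
       (use h periodic_extension_local[where F = F, OF h F] in \<open>auto simp: dist_real_def abs_minus_commute diff_diff_eq\<close>)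
qed

lemma periodic_extension_continuous:
  assumes h: "h > 0" and F: "\<And>t. h / 4 < t \<Longrightarrow> t < 3 * h / 4 \<Longrightarrow> F t = F (t - h)"
    and c: "continuous_on UNIV F"
  shows "continuous_on UNIV (\<lambda>y. F (residue h c y) :: real)"
proof (rule continuous_at_imp_continuous_on, rule ballI)
  fix y
  let ?k = "c + h * of_int (round ((y - c) / h))"
  have "continuous_on (ball y (h / 4)) (\<lambda>s. F (s - ?k))"
    by (rule continuous_on_compose2[OF c]) (auto intro!: continuous_intros)
  then have "continuous_on (ball y (h / 4)) (\<lambda>s. F (residue h c s))"
    by (rule continuous_on_eq)
       (use periodic_extension_local[where F = F, OF h F] in \<open>auto simp: dist_real_def abs_minus_commute diff_diff_eq\<close>)
  then show "isCont (\<lambda>s. F (residue h c s)) y"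
    using h by (simp add: continuous_on_eq_continuous_at)
qed

lemma real_antiderivative_exists:
  fixes g :: "real \<Rightarrow> real"
  assumes "continuous_on UNIV g"
  obtains G where "\<And>t. (G has_real_derivative g t) (at t)" "G 0 = 0"
proof -
  have "\<exists>F. \<forall>x::real. - \<infinity> < ereal x \<longrightarrow> ereal x < \<infinity> \<longrightarrow> (F has_vector_derivative g x) (at x)"
    by (rule einterval_antiderivative) (use assms in \<open>auto simp: continuous_on_eq_continuous_at\<close>)
  then obtain F where F: "\<And>x. (F has_real_derivative g x) (at x)"
    by (auto simp: has_real_derivative_iff_has_vector_derivative)
  show ?thesis
    by (rule that[of "\<lambda>t. F t - F 0"]) (auto intro!: derivative_eq_intros F)
qed

lemma DERIV_0_eq:
  fixes f :: "real \<Rightarrow> real"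
  assumes "\<And>t. (f has_real_derivative f' t) (at t)" "a \<le> b" "\<And>t. a < t \<Longrightarrow> t < b \<Longrightarrow> f' t = 0"
  shows "f a = f b"
proof (cases "a = b")
  case False
  then obtain z where "a < z" "z < b" "f b - f a = (b - a) * f' z"
    using MVT2[of a b f f'] assms by force
  then show ?thesis using assms(3)[of z] by simp
qed simp

lemma bump_exists:
  "\<exists>b b1 b2 :: real \<Rightarrow> real. (\<forall>t. (b has_real_derivative b1 t) (at t)) \<and>
     (\<forall>t. (b1 has_real_derivative b2 t) (at t)) \<and> continuous_on UNIV b2 \<and> (\<forall>t. 0 \<le> b t) \<and>
     (\<forall>t. \<bar>t\<bar> \<ge> 1 \<longrightarrow> b t = 0 \<and> b1 t = 0 \<and> b2 t = 0) \<and> (\<forall>t. b1 (- t) = - b1 t) \<and>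
     (\<forall>t. 0 < t \<and> t < 1 \<longrightarrow> b1 t \<noteq> 0)"
proof -
  define p where "p = (\<lambda>(n::nat) t::real. (max 0 (1 - t\<^sup>2)) ^ n)"
  have sq: "((\<lambda>t::real. 1 - t\<^sup>2) has_real_derivative - (2 * t)) (at t)" for t
    by (auto intro!: derivative_eq_intros)
  have p3: "(p 3 has_real_derivative - (2 * t) * (3 * p 2 t)) (at t)" for t
    using DERIV_chain'[OF sq max_0_cube_derivs(1), of t] by (simp add: p_def mult.commute)
  have p2: "(p 2 has_real_derivative - (2 * t) * (2 * p 1 t)) (at t)" for t
    using DERIV_chain'[OF sq max_0_cube_derivs(2), of t] by (simp add: p_def mult.commute)
  have 0: "p (Suc n) t = 0" if "\<bar>t\<bar> \<ge> 1" for n t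
    using that by (simp add: p_def max_def abs_le_square_iff[of 1 t, simplified])
  show ?thesis
  proof (intro exI conjI allI)
    show "(p 3 has_real_derivative - 6 * t * p 2 t) (at t)" for t using p3[of t] by (simp add: algebra_simps)
    show "((\<lambda>t. - 6 * t * p 2 t) has_real_derivative - 6 * p 2 t + 24 * t\<^sup>2 * p 1 t) (at t)" for t
      by (rule derivative_eq_intros p2 refl | simp add: power2_eq_square)+
    show "continuous_on UNIV (\<lambda>t. - 6 * p 2 t + 24 * t\<^sup>2 * p 1 t)"
      unfolding p_def by (intro continuous_intros)
    show "0 \<le> p 3 t" for t by (simp add: p_def)
    show "\<bar>t\<bar> \<ge> 1 \<longrightarrow> p 3 t = 0 \<and> - 6 * t * p 2 t = 0 \<and> - 6 * p 2 t + 24 * t\<^sup>2 * p 1 t = 0" for t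
      using 0[of t 0] 0[of t 1] 0[of t 2] by (simp add: numeral_eq_Suc)
    show "- 6 * - t * p 2 (- t) = - (- 6 * t * p 2 t)" for t by (simp add: p_def)
    show "0 < t \<and> t < 1 \<longrightarrow> - 6 * t * p 2 t \<noteq> 0" for t
      using power_strict_decreasing[of 0 2 t] by (auto simp: p_def max_def power2_eq_square mult_less_le_imp_less) 
  qed
qed

text \<open>
  The height profile \<open>b\<close> of a single fold. The primitive \<open>v\<close> of \<open>b1\<^sup>2\<close> increases from \<open>- 1/2\<close> to \<open>1/2\<close>, a
  normalisation which says that the fold takes up one unit of film. The primitive
  \<open>W\<close> of \<open>v\<close> has the same constant \<open>W0\<close> on both sides, which later makes a second primitive periodic.
\<close>

definition is_fold_profile :: "real \<Rightarrow> (real \<Rightarrow> real) \<Rightarrow> (real \<Rightarrow> real) \<Rightarrow> (real \<Rightarrow> real) \<Rightarrow>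
    (real \<Rightarrow> real) \<Rightarrow> (real \<Rightarrow> real) \<Rightarrow> real \<Rightarrow> bool" where
  "is_fold_profile K b b1 b2 v W W0 \<longleftrightarrow> K \<ge> 1 \<and> (\<forall>t. (b has_real_derivative b1 t) (at t)) \<and>
     (\<forall>t. (b1 has_real_derivative b2 t) (at t)) \<and> continuous_on UNIV b2 \<and>
     (\<forall>t. 0 \<le> b t \<and> b t \<le> K \<and> \<bar>b1 t\<bar> \<le> K \<and> \<bar>b2 t\<bar> \<le> K) \<and>
     (\<forall>t. \<bar>t\<bar> \<ge> 1 \<longrightarrow> b t = 0 \<and> b1 t = 0 \<and> b2 t = 0) \<and>
     (\<forall>t. (v has_real_derivative (b1 t)\<^sup>2) (at t)) \<and> (\<forall>t. (W has_real_derivative v t) (at t)) \<and>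
     (\<forall>t\<ge>1. v t = 1 / 2 \<and> v (- t) = - 1 / 2 \<and> W t = W0 + t / 2 \<and> W (- t) = W0 + t / 2) \<and>
     (\<forall>t. \<bar>W t\<bar> \<le> \<bar>t\<bar>)"

text \<open>
  Scale the bump so that \<open>b1\<^sup>2\<close> has integral one. As \<open>b1\<close> is odd, \<open>v\<close> can be chosen odd and then \<open>W\<close>
  is even, which gives the equal constants.
\<close>

lemma fold_profile_exists: "\<exists>K b b1 b2 v W W0. is_fold_profile K b b1 b2 v W W0"
proof -
  obtain a a1 a2 :: "real \<Rightarrow> real" where
    a: "\<And>t. (a has_real_derivative a1 t) (at t)" "\<And>t. (a1 has_real_derivative a2 t) (at t)"
      "continuous_on UNIV a2" "\<And>t. 0 \<le> a t" "\<And>t. \<bar>t\<bar> \<ge> 1 \<Longrightarrow> a t = 0 \<and> a1 t = 0 \<and> a2 t = 0"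
      and odd: "\<And>t. a1 (- t) = - a1 t" and pos: "\<And>t. 0 < t \<Longrightarrow> t < 1 \<Longrightarrow> a1 t \<noteq> 0"
    using bump_exists by blast
  have ac: "continuous_on UNIV a" "continuous_on UNIV a1" using a(1,2) by (auto intro: DERIV_continuous_on)
  have "continuous_on UNIV (\<lambda>t. (a1 t)\<^sup>2)" using ac by (intro continuous_intros)
  then obtain m where m: "\<And>t. (m has_real_derivative (a1 t)\<^sup>2) (at t)" "m 0 = 0"
    using real_antiderivative_exists by blast
  have "\<exists>y. (m has_real_derivative y) (at x) \<and> y > 0" if "0 < x" "x < 1" for x
    using m(1)[of x] pos[OF that] by (intro exI[of _ "(a1 x)\<^sup>2"]) simp
  then have "m 0 < m 1"
    using DERIV_pos_imp_increasing_open[of 0 1 m] DERIV_continuous_on[OF m(1)] continuous_on_subset by force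
  then have m1: "0 < m 1" using m(2) by simp
  have neg: "((\<lambda>t. f (- t)) has_real_derivative - f' (- t)) (at t)"
    if "\<And>t. (f has_real_derivative f' t) (at t)" for f f' :: "real \<Rightarrow> real" and t
  proof -
    have "(uminus has_real_derivative - 1) (at t)" by (auto intro!: derivative_eq_intros)
    from DERIV_chain'[OF this that] show ?thesis by simp
  qed
  have m_odd: "m (- t) = - m t" for t
  proof -
    have d: "((\<lambda>t. m t + m (- t)) has_real_derivative 0) (at s)" for s
      using DERIV_add[OF m(1)[of s] neg[of m "\<lambda>t. (a1 t)\<^sup>2" s, OF m(1)]] odd[of s] by simp
    have "m 0 + m (- 0) = m \<bar>t\<bar> + m (- \<bar>t\<bar>)"
      by (rule DERIV_0_eq[where f = "\<lambda>t. m t + m (- t)" and f' = "\<lambda>_. 0"]) (use d in auto)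
    then show ?thesis using m(2) by (cases "t \<ge> 0") auto
  qed
  have m_const: "m t = m 1" if "t \<ge> 1" for t
    by (rule sym, rule DERIV_0_eq[OF m(1) that]) (use a(5) in auto)
  have m_mono: "m s \<le> m t" if "s \<le> t" for s t
    by (rule DERIV_nonneg_imp_nondecreasing[OF that]) (use m(1) in \<open>auto intro!: exI[of _ "(a1 _)\<^sup>2"]\<close>)
  define k where "k = 1 / sqrt (2 * m 1)"
  have k: "k > 0" "k\<^sup>2 = 1 / (2 * m 1)" using m1 by (simp_all add: k_def power_divide)
  define v where "v = (\<lambda>t. k\<^sup>2 * m t)"
  have v: "(v has_real_derivative (k * a1 t)\<^sup>2) (at t)" for t
    unfolding v_def power_mult_distrib by (rule DERIV_cmult[OF m(1)])
  have v_out: "v t = 1 / 2" "v (- t) = - 1 / 2" if "t \<ge> 1" for t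
    using m_const[OF that] m_odd[of t] m1 k by (auto simp: v_def)
  have v_bound: "\<bar>v t\<bar> \<le> 1" for t
  proof -
    have "m t \<le> m 1" "- m 1 \<le> m t"
      using m_mono[of t "max t 1"] m_const[of "max t 1"] m_mono[of "min t (- 1)" t] m_const[of "- min t (- 1)"]
        m_odd[of "- min t (- 1)"] by auto
    then have "\<bar>m t\<bar> \<le> m 1" by linarith
    then have "k\<^sup>2 * \<bar>m t\<bar> \<le> k\<^sup>2 * m 1" by (intro mult_left_mono) auto
    then show ?thesis using k m1 by (simp add: v_def abs_mult)
  qed
  obtain W where W: "\<And>t. (W has_real_derivative v t) (at t)" "W 0 = 0"
    using real_antiderivative_exists[OF DERIV_continuous_on[OF v]] by blast
  have W_even: "W (- t) = W t" for t
  proof -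
    have d: "((\<lambda>t. W t - W (- t)) has_real_derivative 0) (at s)" for s
      using DERIV_diff[OF W(1)[of s] neg[of W v s, OF W(1)]] m_odd[of s] by (simp add: v_def)
    have "W 0 - W (- 0) = W \<bar>t\<bar> - W (- \<bar>t\<bar>)"
      by (rule DERIV_0_eq[where f = "\<lambda>t. W t - W (- t)" and f' = "\<lambda>_. 0"]) (use d in auto)
    then show ?thesis using W(2) by (cases "t \<ge> 0") auto
  qed
  have W_out: "W t = (W 1 - 1 / 2) + t / 2" if "t \<ge> 1" for t
  proof -
    have "W 1 - 1 / 2 = W t - t / 2"
      by (rule DERIV_0_eq[where f = "\<lambda>t. W t - t / 2" and f' = "\<lambda>t. v t - 1 / 2"])
         (use that v_out W(1) in \<open>auto intro!: derivative_eq_intros\<close>)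
    then show ?thesis by simp
  qed
  have W_bound: "\<bar>W t\<bar> \<le> \<bar>t\<bar>" for t
  proof (cases "t = 0")
    case False
    then obtain z where "W \<bar>t\<bar> - W 0 = (\<bar>t\<bar> - 0) * v z" using MVT2[of 0 "\<bar>t\<bar>" W v] W(1) by auto
    moreover have "W \<bar>t\<bar> = W t" using W_even[of t] by (cases "t \<ge> 0") auto
    ultimately have "\<bar>W t\<bar> = \<bar>t\<bar> * \<bar>v z\<bar>" using W(2) by (simp add: abs_mult)
    then show ?thesis using v_bound[of z] by (simp add: mult_left_le)
  qed (use W(2) in simp)
  obtain K0 where K0: "K0 \<ge> 0" "\<And>t. \<bar>k * a t\<bar> \<le> K0"
    by (rule bounded_if_compact_support[of "\<lambda>t. k * a t" "- 1" 1]) (use a ac in \<open>auto intro!: continuous_intros\<close>)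
  obtain K1 where K1: "K1 \<ge> 0" "\<And>t. \<bar>k * a1 t\<bar> \<le> K1"
    by (rule bounded_if_compact_support[of "\<lambda>t. k * a1 t" "- 1" 1]) (use a ac in \<open>auto intro!: continuous_intros\<close>)
  obtain K2 where K2: "K2 \<ge> 0" "\<And>t. \<bar>k * a2 t\<bar> \<le> K2"
    by (rule bounded_if_compact_support[of "\<lambda>t. k * a2 t" "- 1" 1]) (use a ac in \<open>auto intro!: continuous_intros\<close>)
  show ?thesis
    unfolding is_fold_profile_def
  proof (intro exI conjI allI)
    show "1 + K0 + K1 + K2 \<ge> 1" using K0 K1 K2 by simp
    show "((\<lambda>t. k * a t) has_real_derivative k * a1 t) (at t)"
      "((\<lambda>t. k * a1 t) has_real_derivative k * a2 t) (at t)" for t by (intro DERIV_cmult a)+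
    show "continuous_on UNIV (\<lambda>t. k * a2 t)" by (intro continuous_intros a)
    show "0 \<le> k * a t" for t using k a by simp
    show "k * a t \<le> 1 + K0 + K1 + K2" "\<bar>k * a1 t\<bar> \<le> 1 + K0 + K1 + K2" "\<bar>k * a2 t\<bar> \<le> 1 + K0 + K1 + K2" for t
      using K0 K1 K2 K0(2)[of t] K1(2)[of t] K2(2)[of t] by linarith+
    show "(v has_real_derivative (k * a1 t)\<^sup>2) (at t)" for t by (rule v)
    show "(W has_real_derivative v t) (at t)" for t by (rule W)
    show "\<bar>t\<bar> \<ge> 1 \<longrightarrow> k * a t = 0 \<and> k * a1 t = 0 \<and> k * a2 t = 0" for t using a(5) by simp
    show "1 \<le> t \<longrightarrow> v t = 1 / 2 \<and> v (- t) = - 1 / 2 \<and> W t = (W 1 - 1 / 2) + t / 2 \<and> W (- t) = (W 1 - 1 / 2) + t / 2" for t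
      using v_out[of t] W_out[of t] W_even[of t] by metis
    show "\<bar>W t\<bar> \<le> \<bar>t\<bar>" for t by (rule W_bound)
  qed
qed

text \<open>
  \<open>A\<close> is an array of folds with centres in \<open>c + h \<int>\<close> and half-width \<open>\<delta>\<close>, which takes up all of the
  excess film: \<open>A1\<^sup>2\<close> has mean \<open>1\<close> over a period. Therefore the
  displacement \<open>P\<close> with \<open>2 P' + A1\<^sup>2 = 1\<close> can be periodic, and with \<open>P\<close> odd about the centres so can be
  the primitive \<open>Q\<close> that later compensates the shear. This shows in the
  bound on \<open>Q\<close>, which holds on the whole line.
\<close>

definition is_blister :: "real \<Rightarrow> real \<Rightarrow> real \<Rightarrow> real \<Rightarrow> (real \<Rightarrow> real) \<Rightarrow> (real \<Rightarrow> real) \<Rightarrow>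
    (real \<Rightarrow> real) \<Rightarrow> (real \<Rightarrow> real) \<Rightarrow> (real \<Rightarrow> real) \<Rightarrow> bool" where
  "is_blister K h \<delta> c A A1 A2 P Q \<longleftrightarrow>
     (\<forall>y. (A has_real_derivative A1 y) (at y)) \<and> (\<forall>y. (A1 has_real_derivative A2 y) (at y)) \<and>
     continuous_on UNIV A2 \<and> (\<forall>y. (P has_real_derivative (1 - (A1 y)\<^sup>2) / 2) (at y)) \<and>
     (\<forall>y. (Q has_real_derivative 2 * P y + A y * A1 y) (at y)) \<and>
     (\<forall>y. 0 \<le> A y \<and> (A y)\<^sup>2 \<le> K * h * \<delta> \<and> (A1 y)\<^sup>2 \<le> K * h / \<delta> \<and> (A2 y)\<^sup>2 \<le> K * h / \<delta> ^ 3 \<and>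
        (Q y)\<^sup>2 \<le> K * h ^ 4) \<and>
     (\<forall>y. A y \<noteq> 0 \<or> A1 y \<noteq> 0 \<or> A2 y \<noteq> 0 \<longrightarrow> (\<exists>n::int. \<bar>y - c - h * of_int n\<bar> < \<delta>))"

text \<open>
  The profile is scaled to width \<open>\<delta>\<close> and height \<open>sqrt (h \<delta>)\<close>, so that the slope is of order
  \<open>sqrt (h / \<delta>)\<close> and its square has integral \<open>h\<close>. The three parts \<open>A\<close>, \<open>P\<close>, \<open>Q\<close> are given on the
  cell around one centre and extended by means of \<open>residue\<close>.
\<close>

lemma blister_exists:
  "\<exists>K\<ge>1. \<forall>h \<delta> c. 0 < \<delta> \<longrightarrow> \<delta> \<le> h / 4 \<longrightarrow> (\<exists>A A1 A2 P Q. is_blister K h \<delta> c A A1 A2 P Q)"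
proof -
  obtain K b b1 b2 v W W0 where "is_fold_profile K b b1 b2 v W W0"
    using fold_profile_exists by blast
  then have K: "K \<ge> 1"
    and b: "\<And>t. (b has_real_derivative b1 t) (at t)" "\<And>t. (b1 has_real_derivative b2 t) (at t)"
      "continuous_on UNIV b2"
    and b_bd: "\<And>t. 0 \<le> b t" "\<And>t. \<bar>b t\<bar> \<le> K" "\<And>t. \<bar>b1 t\<bar> \<le> K" "\<And>t. \<bar>b2 t\<bar> \<le> K"
    and b_out: "\<And>t. \<bar>t\<bar> \<ge> 1 \<Longrightarrow> b t = 0 \<and> b1 t = 0 \<and> b2 t = 0"
    and v: "\<And>t. (v has_real_derivative (b1 t)\<^sup>2) (at t)" and W: "\<And>t. (W has_real_derivative v t) (at t)"
    and out: "\<And>t. t \<ge> 1 \<Longrightarrow> v t = 1 / 2 \<and> v (- t) = - 1 / 2 \<and> W t = W0 + t / 2 \<and> W (- t) = W0 + t / 2"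
    and W_bd: "\<And>t. \<bar>W t\<bar> \<le> \<bar>t\<bar>"
    unfolding is_fold_profile_def by simp_all
  show ?thesis
  proof (intro exI[of _ "4 * K ^ 4"] conjI allI impI)
    show "1 \<le> 4 * K ^ 4" using one_le_power[OF K, of 4] by linarith
    have K2: "K\<^sup>2 \<le> 4 * K ^ 4"
      using K power_increasing[of 2 4 K] zero_le_power[of K 4] by linarith
    fix h \<delta> c :: real
    assume \<delta>: "0 < \<delta>" "\<delta> \<le> h / 4"
    then have h: "h > 0" by linarith
    let ?r = "residue h c"
    define FA FA1 FA2 FP FQ where "FA = (\<lambda>t. sqrt (h * \<delta>) * b (t / \<delta>))"
      and "FA1 = (\<lambda>t. sqrt (h / \<delta>) * b1 (t / \<delta>))" and "FA2 = (\<lambda>t. sqrt (h / \<delta>) / \<delta> * b2 (t / \<delta>))"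
      and "FP = (\<lambda>t. (t - h * v (t / \<delta>)) / 2)"
      and "FQ = (\<lambda>t. t\<^sup>2 / 2 - h * \<delta> * W (t / \<delta>) + h * \<delta> / 2 * (b (t / \<delta>))\<^sup>2)"
    have sc: "((\<lambda>t. f (t / \<delta>)) has_real_derivative f' (t / \<delta>) / \<delta>) (at t)"
      if "\<And>t. (f has_real_derivative f' t) (at t)" for f f' :: "real \<Rightarrow> real" and t
    proof -
      have "((\<lambda>z. z / \<delta>) has_real_derivative 1 / \<delta>) (at t)" using \<delta> by (auto intro!: derivative_eq_intros)
      from DERIV_chain'[OF this that] show ?thesis by simp
    qed
    have sq: "sqrt (h * \<delta>) = sqrt (h / \<delta>) * \<delta>"
      using \<delta> h by (simp add: real_sqrt_mult real_sqrt_divide field_simps)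
    have sq2: "sqrt (h * \<delta>) * sqrt (h / \<delta>) = h"
      using \<delta> h by (simp add: real_sqrt_mult[symmetric])
    have dA: "(FA has_real_derivative FA1 t) (at t)" for t
      using DERIV_cmult[OF sc[OF b(1)], of "sqrt (h * \<delta>)" t] \<delta> by (simp add: FA_def FA1_def sq)
    have dA1: "(FA1 has_real_derivative FA2 t) (at t)" for t
      using DERIV_cmult[OF sc[OF b(2)], of "sqrt (h / \<delta>)" t] by (simp add: FA1_def FA2_def)
    have cA2: "continuous_on UNIV FA2"
      unfolding FA2_def using \<delta>
      by (intro continuous_intros continuous_on_compose2[OF b(3)]) auto
    have dP: "(FP has_real_derivative (1 - (FA1 t)\<^sup>2) / 2) (at t)" for t
    proof -
      have "(FP has_real_derivative (1 - h * ((b1 (t / \<delta>))\<^sup>2 / \<delta>)) / 2) (at t)"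
        unfolding FP_def by (intro DERIV_cdivide DERIV_diff DERIV_ident DERIV_cmult sc[OF v])
      then show ?thesis using \<delta> h by (simp add: FA1_def power_mult_distrib)
    qed
    have dQ: "(FQ has_real_derivative 2 * FP t + FA t * FA1 t) (at t)" for t
    proof -
      have "(FQ has_real_derivative 2 * t / 2 - h * \<delta> * (v (t / \<delta>) / \<delta>)
          + h * \<delta> / 2 * (2 * b (t / \<delta>) * (b1 (t / \<delta>) / \<delta>))) (at t)"
        unfolding FQ_def
        by (rule derivative_eq_intros sc[OF W] sc[OF b(1)] refl | simp)+
      moreover have "FA t * FA1 t = h * b (t / \<delta>) * b1 (t / \<delta>)"
        using sq2 by (simp add: FA_def FA1_def algebra_simps)
      then have "2 * FP t + FA t * FA1 t = 2 * t / 2 - h * \<delta> * (v (t / \<delta>) / \<delta>)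
          + h * \<delta> / 2 * (2 * b (t / \<delta>) * (b1 (t / \<delta>) / \<delta>))"
        using \<delta> by (simp add: FP_def field_simps)
      ultimately show ?thesis by (simp only:)
    qed
    \<comment> \<open>Around half a period the profile has already taken its constant values.\<close>
    have far: "1 \<le> t / \<delta>" "1 \<le> (h - t) / \<delta>" "(t - h) / \<delta> = - ((h - t) / \<delta>)" if "h / 4 < t" "t < 3 * h / 4" for t
      using that \<delta> by (auto simp: field_simps)
    have per: "FA t = FA (t - h)" "FA1 t = FA1 (t - h)" "FA2 t = FA2 (t - h)" "FP t = FP (t - h)" "FQ t = FQ (t - h)"
      if t: "h / 4 < t" "t < 3 * h / 4" for t
    proof -
      note f = far[OF t]
      have b0: "b (t / \<delta>) = 0 \<and> b1 (t / \<delta>) = 0 \<and> b2 (t / \<delta>) = 0"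
        by (rule b_out, rule order_trans[OF f(1) abs_ge_self])
      have b0': "b ((t - h) / \<delta>) = 0 \<and> b1 ((t - h) / \<delta>) = 0 \<and> b2 ((t - h) / \<delta>) = 0"
        unfolding f(3) by (rule b_out, subst abs_minus_cancel, rule order_trans[OF f(2) abs_ge_self])
      show "FA t = FA (t - h)" "FA1 t = FA1 (t - h)" "FA2 t = FA2 (t - h)"
        using b0 b0' by (auto simp: FA_def FA1_def FA2_def)
      show "FP t = FP (t - h)"
        unfolding FP_def f(3) using out[OF f(1)] out[OF f(2)] by (simp add: field_simps)
      show "FQ t = FQ (t - h)"
      proof -
        have W12: "W (t / \<delta>) = W0 + t / \<delta> / 2" "W (- ((h - t) / \<delta>)) = W0 + (h - t) / \<delta> / 2"
          using out[OF f(1)] out[OF f(2)] by auto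
        have e: "h * \<delta> * (W0 + s / \<delta> / 2) = h * \<delta> * W0 + h * s / 2" for s
          using \<delta> by (simp add: field_simps)
        have b: "b (t / \<delta>) = 0" "b (- ((h - t) / \<delta>)) = 0" using b0 b0' unfolding f(3) by auto
        show ?thesis unfolding FQ_def f(3) W12 b e by (simp add: field_simps power2_eq_square)
      qed
    qed
    have bsq: "(f t)\<^sup>2 \<le> 4 * K ^ 4" if "\<And>t. \<bar>f t\<bar> \<le> K" for f :: "real \<Rightarrow> real" and t
    proof -
      have "(f t)\<^sup>2 \<le> K\<^sup>2" using that[of t] K abs_le_square_iff[of "f t" K] by simp
      then show ?thesis using K2 by linarith
    qed
    show "\<exists>A A1 A2 P Q. is_blister (4 * K ^ 4) h \<delta> c A A1 A2 P Q"
      unfolding is_blister_def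
    proof (intro exI conjI allI impI)
      fix y
      show "((\<lambda>y. FA (?r y)) has_real_derivative FA1 (?r y)) (at y)"
        by (rule periodic_extension_has_derivative[OF h per(1) dA])
      show "((\<lambda>y. FA1 (?r y)) has_real_derivative FA2 (?r y)) (at y)"
        by (rule periodic_extension_has_derivative[OF h per(2) dA1])
      show "continuous_on UNIV (\<lambda>y. FA2 (?r y))"
        by (rule periodic_extension_continuous[OF h per(3) cA2])
      show "((\<lambda>y. FP (?r y)) has_real_derivative (1 - (FA1 (?r y))\<^sup>2) / 2) (at y)"
        by (rule periodic_extension_has_derivative[OF h per(4) dP])
      show "((\<lambda>y. FQ (?r y)) has_real_derivative 2 * FP (?r y) + FA (?r y) * FA1 (?r y)) (at y)"
        by (rule periodic_extension_has_derivative[OF h per(5) dQ])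
      show "0 \<le> FA (?r y)" using b_bd(1) \<delta> h by (simp add: FA_def)
      have "(FA (?r y))\<^sup>2 = (h * \<delta>) * (b (?r y / \<delta>))\<^sup>2"
        using \<delta> h by (simp add: FA_def power_mult_distrib)
      also have "\<dots> \<le> (h * \<delta>) * (4 * K ^ 4)" using \<delta> h by (intro mult_left_mono bsq b_bd(2)) auto
      finally show "(FA (?r y))\<^sup>2 \<le> 4 * K ^ 4 * h * \<delta>" by (simp add: algebra_simps)
      have "(FA1 (?r y))\<^sup>2 = (h / \<delta>) * (b1 (?r y / \<delta>))\<^sup>2"
        using \<delta> h by (simp add: FA1_def power_mult_distrib)
      also have "\<dots> \<le> (h / \<delta>) * (4 * K ^ 4)" using \<delta> h by (intro mult_left_mono bsq b_bd(3)) auto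
      finally show "(FA1 (?r y))\<^sup>2 \<le> 4 * K ^ 4 * h / \<delta>" by (simp add: algebra_simps)
      have "(FA2 (?r y))\<^sup>2 = (h / \<delta> ^ 3) * (b2 (?r y / \<delta>))\<^sup>2"
      proof -
        have "(sqrt (h / \<delta>) / \<delta>)\<^sup>2 = h / \<delta> ^ 3"
          using \<delta> h by (simp add: power_divide) (simp add: eval_nat_numeral)
        then show ?thesis by (simp only: FA2_def power_mult_distrib)
      qed
      also have "\<dots> \<le> (h / \<delta> ^ 3) * (4 * K ^ 4)" using \<delta> h by (intro mult_left_mono bsq b_bd(4)) auto
      finally show "(FA2 (?r y))\<^sup>2 \<le> 4 * K ^ 4 * h / \<delta> ^ 3" by (simp add: algebra_simps)
      show "(FQ (?r y))\<^sup>2 \<le> 4 * K ^ 4 * h ^ 4"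
      proof -
        have r: "\<bar>?r y\<bar> \<le> h / 2" by (rule abs_residue_le[OF h])
        have 1: "(?r y)\<^sup>2 / 2 \<le> h\<^sup>2 / 8" using power_mono[OF r, of 2] by (simp add: power_divide)
        have "h * \<delta> * \<bar>W (?r y / \<delta>)\<bar> \<le> h * \<delta> * \<bar>?r y / \<delta>\<bar>" by (rule mult_left_mono[OF W_bd]) (use h \<delta> in simp)
        also have "\<dots> = h * \<bar>?r y\<bar>" using \<delta> by (simp add: abs_divide)
        also have "\<dots> \<le> h * (h / 2)" using h r by (intro mult_left_mono) auto
        finally have 2: "\<bar>h * \<delta> * W (?r y / \<delta>)\<bar> \<le> h\<^sup>2 / 2" using h \<delta> by (simp add: abs_mult power2_eq_square)
        have "(b (?r y / \<delta>))\<^sup>2 \<le> K\<^sup>2" using b_bd(2)[of "?r y / \<delta>"] K abs_le_square_iff[of "b (?r y / \<delta>)" K] by simp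
        then have "h * \<delta> / 2 * (b (?r y / \<delta>))\<^sup>2 \<le> h * (h / 4) / 2 * K\<^sup>2"
          using h \<delta> by (intro mult_mono) auto
        then have 3: "h * \<delta> / 2 * (b (?r y / \<delta>))\<^sup>2 \<le> h\<^sup>2 * K\<^sup>2 / 8" by (simp add: power2_eq_square)
        have 4: "0 \<le> h * \<delta> / 2 * (b (?r y / \<delta>))\<^sup>2" "0 \<le> (?r y)\<^sup>2 / 2" using h \<delta> by auto
        have K1: "h\<^sup>2 \<le> h\<^sup>2 * K\<^sup>2" using K one_le_power[of K 2] by (simp add: mult_le_cancel_left1)
        have "\<bar>X - Y + Z\<bar> \<le> 2 * M" if "X \<le> H / 8" "\<bar>Y\<bar> \<le> H / 2" "Z \<le> M / 8" "0 \<le> Z" "0 \<le> X" "H \<le> M"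
          for X Y Z H M :: real using that by linarith
        from this[OF 1 2 3 4 K1] have "\<bar>FQ (?r y)\<bar> \<le> 2 * K\<^sup>2 * h\<^sup>2"
          by (simp add: FQ_def algebra_simps)
        then have "(FQ (?r y))\<^sup>2 \<le> (2 * K\<^sup>2 * h\<^sup>2)\<^sup>2"
          using abs_le_square_iff[of "FQ (?r y)" "2 * K\<^sup>2 * h\<^sup>2"] by simp
        then show ?thesis by (simp add: power_mult_distrib flip: power_mult)
      qed
      assume "FA (?r y) \<noteq> 0 \<or> FA1 (?r y) \<noteq> 0 \<or> FA2 (?r y) \<noteq> 0"
      then have "\<not> \<bar>?r y / \<delta>\<bar> \<ge> 1" using b_out[of "?r y / \<delta>"] by (auto simp: FA_def FA1_def FA2_def)
      then have "\<bar>?r y\<bar> < \<delta>" using \<delta> by (simp add: abs_divide)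
      then show "\<bar>y - c - h * of_int (round ((y - c) / h))\<bar> < \<delta>" by (simp add: residue_def)
    qed
  qed
qed

section \<open>Sums over layers and areas of folds\<close>

lemma sum_mult_sum_disjoint:
  fixes T U :: "nat \<Rightarrow> real"
  assumes "\<And>i j. i \<noteq> j \<Longrightarrow> T i * U j = 0"
  shows "(\<Sum>j<n. T j) * (\<Sum>j<n. U j) = (\<Sum>j<n. T j * U j)"
proof -
  have "(\<Sum>j<n. T i * U j) = T i * U i" if "i < n" for i
    by (subst sum.mono_neutral_right[of _ "{i}"]) (use that assms[of i] in auto)
  then show ?thesis by (simp add: sum_product)
qed

text \<open>
  At most neighbouring terms interact, so every term is charged at most three times.
\<close>

lemma sum_square_le_neighbours:
  fixes T :: "nat \<Rightarrow> real"
  assumes "\<And>i j. i + 2 \<le> j \<Longrightarrow> T i * T j = 0"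
  shows "(\<Sum>j<n. T j)\<^sup>2 \<le> 3 * (\<Sum>j<n. (T j)\<^sup>2)"
proof -
  have step: "(\<Sum>j<Suc n. T j)\<^sup>2 \<le> 3 * (\<Sum>j<n. (T j)\<^sup>2) + 2 * (T n)\<^sup>2" for n
  proof (induction n)
    case (Suc n)
    have "(\<Sum>j<n. T j) * T (Suc n) = 0"
      unfolding sum_distrib_right by (rule sum.neutral) (use assms in auto)
    then have "(\<Sum>j<Suc n. T j) * T (Suc n) = T n * T (Suc n)" by (simp add: distrib_right)
    then have "(\<Sum>j<Suc (Suc n). T j)\<^sup>2 = (\<Sum>j<Suc n. T j)\<^sup>2 + 2 * (T n * T (Suc n)) + (T (Suc n))\<^sup>2"
      by (simp only: sum.lessThan_Suc[of _ "Suc n"] power2_sum)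
    moreover have "2 * (T n * T (Suc n)) \<le> (T n)\<^sup>2 + (T (Suc n))\<^sup>2"
      using sum_squares_bound[of "T n" "T (Suc n)"] by simp
    ultimately show ?case using Suc by simp
  qed simp
  show ?thesis
  proof (cases n)
    case (Suc m)
    then show ?thesis using step[of m] by (simp add: zero_le_power2 order_trans)
  qed simp
qed

lemma sum_power_le:
  fixes q :: real
  assumes "0 \<le> q" "q < 1" shows "(\<Sum>j<n. q ^ j) \<le> 1 / (1 - q)"
  using sum_le_suminf[of "\<lambda>j. q ^ j" "{..<n}"] assms by (simp add: summable_geometric suminf_geometric)

lemma nn_integral_step_bound:
  fixes f :: "'a::euclidean_space \<Rightarrow> real"
  assumes \<Omega>: "\<Omega> \<in> sets lebesgue" and J: "finite J"
    and B: "\<And>j. j \<in> J \<Longrightarrow> B j \<in> sets lebesgue" and c: "\<And>j. j \<in> J \<Longrightarrow> 0 \<le> c j"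
    and m: "\<And>j. j \<in> J \<Longrightarrow> emeasure lebesgue (B j \<inter> \<Omega>) \<le> ennreal (m j)" "\<And>j. j \<in> J \<Longrightarrow> 0 \<le> m j"
    and f: "\<And>x. x \<in> \<Omega> \<Longrightarrow> f x \<le> (\<Sum>j\<in>J. c j * indicator (B j) x)"
  shows "(\<integral>\<^sup>+x. ennreal (f x) \<partial>lebesgue_on \<Omega>) \<le> ennreal (\<Sum>j\<in>J. c j * m j)"
proof -
  have "(\<integral>\<^sup>+x. ennreal (f x) \<partial>lebesgue_on \<Omega>) \<le> (\<integral>\<^sup>+x. (\<Sum>j\<in>J. ennreal (c j) * indicator (B j) x) \<partial>lebesgue_on \<Omega>)"
  proof (rule nn_integral_mono)
    fix x assume "x \<in> space (lebesgue_on \<Omega>)"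
    then have "x \<in> \<Omega>" by (simp add: space_restrict_space)
    then have "ennreal (f x) \<le> ennreal (\<Sum>j\<in>J. c j * indicator (B j) x)" by (intro ennreal_leI f)
    also have "\<dots> = (\<Sum>j\<in>J. ennreal (c j) * indicator (B j) x)"
      using c by (subst sum_ennreal[symmetric]) (auto simp: ennreal_mult ennreal_indicator intro!: sum.cong)
    finally show "ennreal (f x) \<le> (\<Sum>j\<in>J. ennreal (c j) * indicator (B j) x)" .
  qed
  also have "\<dots> = (\<Sum>j\<in>J. \<integral>\<^sup>+x. ennreal (c j) * indicator (B j) x \<partial>lebesgue_on \<Omega>)"
    using B by (intro nn_integral_sum) (auto intro!: borel_measurable_times_ennreal borel_measurable_indicator' measurable_restrict_space1)
  also have "\<dots> \<le> (\<Sum>j\<in>J. ennreal (c j * m j))"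
  proof (rule sum_mono)
    fix j assume j: "j \<in> J"
    have "(\<integral>\<^sup>+x. ennreal (c j) * indicator (B j) x \<partial>lebesgue_on \<Omega>)
      = (\<integral>\<^sup>+x. ennreal (c j) * indicator (B j \<inter> \<Omega>) x \<partial>lebesgue)"
      using \<Omega> by (subst nn_integral_restrict_space) (auto intro!: nn_integral_cong simp: indicator_def)
    also have "\<dots> = ennreal (c j) * emeasure lebesgue (B j \<inter> \<Omega>)"
      using B[OF j] \<Omega> by (intro nn_integral_cmult_indicator) auto
    also have "\<dots> \<le> ennreal (c j) * ennreal (m j)" by (rule mult_left_mono[OF m(1)[OF j]]) simp
    finally show "(\<integral>\<^sup>+x. ennreal (c j) * indicator (B j) x \<partial>lebesgue_on \<Omega>) \<le> ennreal (c j * m j)"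
      using c[OF j] m(2)[OF j] by (simp add: ennreal_mult)
  qed
  also have "\<dots> = ennreal (\<Sum>j\<in>J. c j * m j)" using c m(2) by (intro sum_ennreal) auto
  finally show ?thesis .
qed

lemma emeasure_cbox_2:
  assumes "a \<le> b" "c \<le> d"
  shows "emeasure lborel (cbox (vector [a, c]) (vector [b, d] :: real ^ 2)) = ennreal ((b - a) * (d - c))"
proof -
  let ?B = "cbox (vector [a, c]) (vector [b, d]) :: (real ^ 2) set"
  have "?B \<noteq> {}" using assms by (auto simp: interval_ne_empty_cart forall_2)
  then have "measure lborel ?B = (b - a) * (d - c)" by (simp add: content_cbox_cart UNIV_2)
  moreover have "emeasure lborel ?B \<noteq> \<infinity>" using emeasure_lborel_cbox_finite[of "vector [a, c]" "vector [b, d] :: real ^ 2"] by simp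
  ultimately show ?thesis by (simp add: emeasure_eq_ennreal_measure)
qed

text \<open>
  The part of the vertical strip \<open>X < x\<^sub>1 < Y\<close> in which an array of folds with period \<open>h\<close>, half-width
  \<open>\<delta>\<close> and a centre at \<open>c\<close> is supported.
\<close>

definition stripes :: "real \<Rightarrow> real \<Rightarrow> real \<Rightarrow> real \<Rightarrow> real \<Rightarrow> (real ^ 2) set" where
  "stripes X Y h \<delta> c = {x. X < x $ 1 \<and> x $ 1 < Y \<and> (\<exists>n::int. \<bar>x $ 2 - c - h * of_int n\<bar> < \<delta>)}"

lemma open_stripes: "open (stripes X Y h \<delta> c)"
proof -
  have "stripes X Y h \<delta> c = {x. X < x $ 1} \<inter> {x. x $ 1 < Y} \<inter> (\<Union>n::int. {x. \<bar>x $ 2 - c - h * of_int n\<bar> < \<delta>})"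
    by (auto simp: stripes_def)
  then show ?thesis by (auto intro!: open_Int open_UN open_Collect_less continuous_intros)
qed

text \<open>
  At most \<open>(l2 + 2 \<delta>) / h + 1\<close> folds meet the rectangle, and this number is at most \<open>3 l2 / h\<close>.
\<close>

lemma emeasure_stripes_le:
  assumes "0 < \<delta>" "\<delta> \<le> h / 4" "h \<le> l2" "0 \<le> X" "0 < Y"
  shows "emeasure lebesgue (stripes X Y h \<delta> c \<inter> rect l1 l2) \<le> ennreal (6 * Y * l2 * \<delta> / h)"
proof -
  have h: "h > 0" using assms by linarith
  define I where "I = {\<lceil>(- c - \<delta>) / h\<rceil> .. \<lfloor>(l2 - c + \<delta>) / h\<rfloor>}"
  let ?B = "\<lambda>n::int. cbox (vector [0, c + h * of_int n - \<delta>]) (vector [Y, c + h * of_int n + \<delta>]) :: (real ^ 2) set"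
  have "stripes X Y h \<delta> c \<inter> rect l1 l2 \<subseteq> (\<Union>n\<in>I. ?B n)"
  proof
    fix x assume x: "x \<in> stripes X Y h \<delta> c \<inter> rect l1 l2"
    then obtain n :: int where n: "\<bar>x $ 2 - c - h * of_int n\<bar> < \<delta>" by (auto simp: stripes_def)
    have x': "0 < x $ 1" "x $ 1 < Y" "0 < x $ 2" "x $ 2 < l2" using x assms by (auto simp: stripes_def rect_def)
    have "(- c - \<delta>) / h \<le> of_int n" "of_int n \<le> (l2 - c + \<delta>) / h"
      using n x' h by (auto simp: field_simps abs_less_iff)
    then have "n \<in> I" by (simp add: I_def ceiling_le_iff le_floor_iff)
    moreover have "x \<in> ?B n" using n x' by (auto simp: mem_box_cart forall_2)
    ultimately show "x \<in> (\<Union>n\<in>I. ?B n)" by blast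
  qed
  then have "emeasure lebesgue (stripes X Y h \<delta> c \<inter> rect l1 l2) \<le> emeasure lebesgue (\<Union>n\<in>I. ?B n)"
    by (rule emeasure_mono) (auto simp: I_def)
  also have "\<dots> \<le> (\<Sum>n\<in>I. emeasure lebesgue (?B n))"
    by (rule emeasure_subadditive_finite) (auto simp: I_def)
  also have "\<dots> = (\<Sum>n\<in>I. ennreal (Y * (2 * \<delta>)))"
    using assms by (intro sum.cong refl) (simp add: emeasure_cbox_2)
  also have "\<dots> = ennreal (real (card I) * (Y * (2 * \<delta>)))"
    using assms by (subst sum_ennreal) auto
  also have "\<dots> \<le> ennreal (6 * Y * l2 * \<delta> / h)"
  proof (rule ennreal_leI)
    have "real (card I) \<le> (l2 + 2 * \<delta>) / h + 1"
    proof (cases "\<lceil>(- c - \<delta>) / h\<rceil> \<le> \<lfloor>(l2 - c + \<delta>) / h\<rfloor> + 1")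
      case True
      then have "real (card I) = of_int \<lfloor>(l2 - c + \<delta>) / h\<rfloor> + 1 - of_int \<lceil>(- c - \<delta>) / h\<rceil>"
        by (simp add: I_def)
      also have "\<dots> \<le> (l2 - c + \<delta>) / h + 1 - (- c - \<delta>) / h"
        using of_int_floor_le[of "(l2 - c + \<delta>) / h"] le_of_int_ceiling[of "(- c - \<delta>) / h"] by linarith
      also have "\<dots> = (l2 + 2 * \<delta>) / h + 1" using h by (simp add: field_simps)
      finally show ?thesis .
    next
      case False
      then have "card I = 0" by (simp add: I_def)
      then show ?thesis using h assms by (simp add: field_simps)
    qed
    also have "\<dots> = (l2 + 2 * \<delta> + h) / h" using h by (simp add: field_simps)
    also have "\<dots> \<le> 3 * l2 / h" using h assms by (intro divide_right_mono) auto
    finally have "real (card I) * (Y * (2 * \<delta>)) \<le> 3 * l2 / h * (Y * (2 * \<delta>))"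
      using assms by (intro mult_right_mono) auto
    then show "real (card I) * (Y * (2 * \<delta>)) \<le> 6 * Y * l2 * \<delta> / h" by (simp add: field_simps)
  qed
  finally show ?thesis .
qed

lemma emeasure_strip_le:
  assumes "0 < l2" "0 < Y"
  shows "emeasure lebesgue ({x. x $ 1 < Y} \<inter> rect l1 l2) \<le> ennreal (Y * l2)"
proof -
  have "{x. x $ 1 < Y} \<inter> rect l1 l2 \<subseteq> cbox (vector [0, 0]) (vector [Y, l2])"
    by (auto simp: rect_def mem_box_cart forall_2)
  then have "emeasure lebesgue ({x. x $ 1 < Y} \<inter> rect l1 l2) \<le> emeasure lebesgue (cbox (vector [0, 0]) (vector [Y, l2]) :: (real ^ 2) set)"
    by (rule emeasure_mono) simp
  then show ?thesis using assms by (simp add: emeasure_cbox_2)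
qed

section \<open>The branching construction\<close>

text \<open>
  Layer \<open>j\<close> carries folds of period \<open>E L 12^j\<close> and half-width \<open>\<sigma> L 6^j / 16\<close>, in the range of \<open>x\<^sub>1\<close> where
  \<open>s (x\<^sub>1 / (E L 32^j))\<close> does not vanish. The number \<open>N\<close> of layers is the first one for which layer
  \<open>N\<close> starts at or beyond the right edge. The centres of layer \<open>j + 1\<close> are centres of layer \<open>j\<close> shifted by
  half a period of layer \<open>j\<close>.
\<close>

locale refined_folds =
  fixes L \<sigma> E :: real and N :: nat
    and Kc :: real and s s1 s2 \<beta> :: "real \<Rightarrow> real"
    and Kb :: real and c :: "nat \<Rightarrow> real" and A A1 A2 P Q :: "nat \<Rightarrow> real \<Rightarrow> real"
  assumes L: "0 < L" and \<sigma>: "0 < \<sigma>" "\<sigma> \<le> E" "E \<le> 1"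
    and N: "1 \<le> E * 32 ^ N" "\<And>j. j < N \<Longrightarrow> E * 32 ^ j < 1"
    and Kc: "1 \<le> Kc" and cutoff: "is_cutoff Kc s s1 s2 \<beta>"
    and Kb: "1 \<le> Kb"
    and blister: "\<And>j. is_blister Kb (E * L * 12 ^ j) (\<sigma> * L * 6 ^ j / 16) (c j) (A j) (A1 j) (A2 j) (P j) (Q j)"
    and c: "\<And>j. c (Suc j) = c j + E * L * 12 ^ j / 2"
begin

definition X :: "nat \<Rightarrow> real" where "X j = E * L * 32 ^ j"
definition h :: "nat \<Rightarrow> real" where "h j = E * L * 12 ^ j"
definition d :: "nat \<Rightarrow> real" where "d j = \<sigma> * L * 6 ^ j / 16"

definition a :: "nat \<Rightarrow> real \<Rightarrow> real" where "a j x = s (x / X j)"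
definition a1 :: "nat \<Rightarrow> real \<Rightarrow> real" where "a1 j x = s1 (x / X j) / X j"
definition a2 :: "nat \<Rightarrow> real \<Rightarrow> real" where "a2 j x = s2 (x / X j) / (X j)\<^sup>2"

definition w :: "real ^ 2 \<Rightarrow> real" where
  "w x = (\<Sum>j<N. a j (x $ 1) * A j (x $ 2))"

text \<open>
  The second component restores the length in the \<open>x\<^sub>2\<close>-direction. Its dependence on \<open>x\<^sub>1\<close> and the
  product of the two slopes of \<open>w\<close> produce shear, and the sum in the first component is the
  primitive in \<open>x\<^sub>2\<close> that cancels it.
\<close>

definition u :: "real ^ 2 \<Rightarrow> real ^ 2" where
  "u x = vector [x $ 1 / 2 * 1 + (\<Sum>j<N. - (a j (x $ 1) * a1 j (x $ 1)) * Q j (x $ 2)),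
                 \<Sum>j<N. (a j (x $ 1))\<^sup>2 * P j (x $ 2)]"

definition DU :: "2 \<Rightarrow> 2 \<Rightarrow> real ^ 2 \<Rightarrow> real" where
  "DU i k x = (if i = 1
     then (if k = 1 then 1 / 2 * 1 else x $ 1 / 2 * 0) +
       (\<Sum>j<N. if k = 1 then - ((a1 j (x $ 1))\<^sup>2 + a j (x $ 1) * a2 j (x $ 1)) * Q j (x $ 2)
          else - (a j (x $ 1) * a1 j (x $ 1)) * (2 * P j (x $ 2) + A j (x $ 2) * A1 j (x $ 2)))
     else (\<Sum>j<N. if k = 1 then 2 * a j (x $ 1) * a1 j (x $ 1) * P j (x $ 2)
          else (a j (x $ 1))\<^sup>2 * ((1 - (A1 j (x $ 2))\<^sup>2) / 2)))"

definition DW :: "2 \<Rightarrow> real ^ 2 \<Rightarrow> real" where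
  "DW i x = (\<Sum>j<N. if i = 1 then a1 j (x $ 1) * A j (x $ 2) else a j (x $ 1) * A1 j (x $ 2))"

definition HW :: "2 \<Rightarrow> 2 \<Rightarrow> real ^ 2 \<Rightarrow> real" where
  "HW i k x = (if i = 1
     then (\<Sum>j<N. if k = 1 then a2 j (x $ 1) * A j (x $ 2) else a1 j (x $ 1) * A1 j (x $ 2))
     else (\<Sum>j<N. if k = 1 then a1 j (x $ 1) * A1 j (x $ 2) else a j (x $ 1) * A2 j (x $ 2)))"

lemma E: "0 < E" using \<sigma> by linarith

lemma X_pos: "0 < X j" and h_pos: "0 < h j" and d_pos: "0 < d j"
  using L \<sigma> E by (simp_all add: X_def h_def d_def)

lemma h_le_X: "h j \<le> X j"
  unfolding h_def X_def using L E by (intro mult_left_mono power_mono) auto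

lemma d_le_h: "d j \<le> h j / 16"
proof -
  have "\<sigma> * L * 6 ^ j \<le> E * L * 12 ^ j" using L \<sigma> by (intro mult_mono power_mono) auto
  then show ?thesis unfolding d_def h_def by (rule divide_right_mono) simp
qed

lemma cut:
  "\<And>z. (s has_real_derivative s1 z) (at z)" "\<And>z. (s1 has_real_derivative s2 z) (at z)"
  "continuous_on UNIV s2"
  "\<And>z. 0 \<le> s z" "\<And>z. s z \<le> 1" "\<And>z. \<bar>s1 z\<bar> \<le> Kc" "\<And>z. \<bar>s2 z\<bar> \<le> Kc"
  "\<And>z. (s z)\<^sup>2 = \<beta> z - \<beta> (z / 32)" "\<And>z. 0 \<le> \<beta> z" "\<And>z. \<beta> z \<le> 1"
  "\<And>z. z \<le> 1 \<Longrightarrow> \<beta> z = 0" "\<And>z. 4 \<le> z \<Longrightarrow> \<beta> z = 1"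
  using cutoff unfolding is_cutoff_def by simp_all

lemma cut_zero: "z \<le> 1 \<or> 128 \<le> z \<Longrightarrow> s z = 0 \<and> s1 z = 0 \<and> s2 z = 0"
  using cutoff unfolding is_cutoff_def by blast

lemma blist:
  "\<And>y. (A j has_real_derivative A1 j y) (at y)" "\<And>y. (A1 j has_real_derivative A2 j y) (at y)"
  "continuous_on UNIV (A2 j)" "\<And>y. (P j has_real_derivative (1 - (A1 j y)\<^sup>2) / 2) (at y)"
  "\<And>y. (Q j has_real_derivative 2 * P j y + A j y * A1 j y) (at y)"
  "\<And>y. 0 \<le> A j y" "\<And>y. (A j y)\<^sup>2 \<le> Kb * h j * d j" "\<And>y. (A1 j y)\<^sup>2 \<le> Kb * h j / d j"
  "\<And>y. (A2 j y)\<^sup>2 \<le> Kb * h j / d j ^ 3" "\<And>y. (Q j y)\<^sup>2 \<le> Kb * h j ^ 4"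
  "\<And>y. A j y \<noteq> 0 \<or> A1 j y \<noteq> 0 \<or> A2 j y \<noteq> 0 \<Longrightarrow> \<exists>n::int. \<bar>y - c j - h j * of_int n\<bar> < d j"
  using blister[of j] unfolding is_blister_def h_def[symmetric] d_def[symmetric] by simp_all

lemma a_der: "(a j has_real_derivative a1 j x) (at x)" "(a1 j has_real_derivative a2 j x) (at x)"
proof -
  have *: "((\<lambda>x. x / X j) has_real_derivative 1 / X j) (at x)"
    using X_pos[of j] by (auto intro!: derivative_eq_intros)
  show "(a j has_real_derivative a1 j x) (at x)"
    using DERIV_chain'[OF * cut(1)] unfolding a_def a1_def by simp
  have "((\<lambda>x. s1 (x / X j)) has_real_derivative 1 / X j * s2 (x / X j)) (at x)"
    using DERIV_chain'[OF * cut(2)] by simp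
  from DERIV_cdivide[OF this, of "X j"] show "(a1 j has_real_derivative a2 j x) (at x)"
    unfolding a1_def a2_def by (simp add: power2_eq_square)
qed

lemma a2_cont: "continuous_on UNIV (a2 j)"
  unfolding a2_def by (rule continuous_on_divide, rule continuous_on_compose2[OF cut(3)])
    (use X_pos[of j] in \<open>auto intro!: continuous_intros\<close>)

lemma a_bounds: "0 \<le> a j x" "a j x \<le> 1" "\<bar>a1 j x\<bar> \<le> Kc / X j" "\<bar>a2 j x\<bar> \<le> Kc / (X j)\<^sup>2"
  using cut X_pos[of j] by (auto simp: a_def a1_def a2_def abs_divide intro!: divide_right_mono)

lemma a_zero: "\<not> (X j < x \<and> x < 128 * X j) \<Longrightarrow> a j x = 0 \<and> a1 j x = 0 \<and> a2 j x = 0"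
proof -
  assume "\<not> (X j < x \<and> x < 128 * X j)"
  then have "x / X j \<le> 1 \<or> 128 \<le> x / X j" using X_pos[of j] by (auto simp: field_simps)
  then show ?thesis using cut_zero[of "x / X j"] by (simp add: a_def a1_def a2_def)
qed

lemma conts: "continuous_on UNIV (a j)" "continuous_on UNIV (a1 j)" "continuous_on UNIV (A j)"
  "continuous_on UNIV (A1 j)" "continuous_on UNIV (P j)"
  by (fact DERIV_continuous_on[OF a_der(1)] DERIV_continuous_on[OF a_der(2)] DERIV_continuous_on[OF blist(1)]
    DERIV_continuous_on[OF blist(2)] DERIV_continuous_on[OF blist(4)])+

sublocale classical_pair L l2 u w DU DW HW for l2
proof
  show "has_continuous_partials w DW"
    unfolding w_def DW_def
    by (intro has_continuous_partials_sum has_continuous_partials_separable a_der blist conts)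
  show "has_continuous_partials (DW i) (HW i)" for i
  proof (cases "i = 1")
    case True
    show ?thesis unfolding True DW_def HW_def if_True
      by (simp only: if_True refl)
        (intro has_continuous_partials_sum has_continuous_partials_separable a_der blist conts a2_cont)
  next
    case False
    show ?thesis unfolding DW_def HW_def if_not_P[OF False]
      by (intro has_continuous_partials_sum has_continuous_partials_separable a_der blist conts)
  qed
  have u1: "has_continuous_partials (\<lambda>x. x $ 1 / 2 * 1 + (\<Sum>j<N. - (a j (x $ 1) * a1 j (x $ 1)) * Q j (x $ 2))) (DU 1)"
    unfolding DU_def
  proof (simp only: if_True refl, intro has_continuous_partials_add has_continuous_partials_sum)
    show "has_continuous_partials (\<lambda>x. x $ 1 / 2 * 1) (\<lambda>k (x :: real ^ 2). if k = 1 then 1 / 2 * 1 else x $ 1 / 2 * 0)"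
      by (rule has_continuous_partials_separable[of "\<lambda>t. t / 2" "\<lambda>_. 1 / 2" "\<lambda>_. 1" "\<lambda>_. 0"])
        (auto intro!: derivative_eq_intros)
    show "has_continuous_partials (\<lambda>x :: real ^ 2. - (a j (x $ 1) * a1 j (x $ 1)) * Q j (x $ 2))
      (\<lambda>k x. if k = 1 then - ((a1 j (x $ 1))\<^sup>2 + a j (x $ 1) * a2 j (x $ 1)) * Q j (x $ 2)
          else - (a j (x $ 1) * a1 j (x $ 1)) * (2 * P j (x $ 2) + A j (x $ 2) * A1 j (x $ 2)))" for j
    proof (rule has_continuous_partials_separable)
      show "((\<lambda>x. - (a j x * a1 j x)) has_real_derivative - ((a1 j x)\<^sup>2 + a j x * a2 j x)) (at x)" for x
        using DERIV_minus[OF DERIV_mult[OF a_der(1)[of j x] a_der(2)[of j x]]] 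
        by (simp add: power2_eq_square algebra_simps)
    qed (intro continuous_intros conts a2_cont blist)+
  qed
  have u2: "has_continuous_partials (\<lambda>x. \<Sum>j<N. (a j (x $ 1))\<^sup>2 * P j (x $ 2)) (DU 2)"
  proof -
    have DU2: "DU 2 = (\<lambda>k x. \<Sum>j<N. if k = 1 then 2 * a j (x $ 1) * a1 j (x $ 1) * P j (x $ 2)
          else (a j (x $ 1))\<^sup>2 * ((1 - (A1 j (x $ 2))\<^sup>2) / 2))"
      by (simp add: DU_def fun_eq_iff)
    show ?thesis unfolding DU2
    proof (intro has_continuous_partials_sum)
      show "has_continuous_partials (\<lambda>x :: real ^ 2. (a j (x $ 1))\<^sup>2 * P j (x $ 2))
        (\<lambda>k x. if k = 1 then 2 * a j (x $ 1) * a1 j (x $ 1) * P j (x $ 2)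
            else (a j (x $ 1))\<^sup>2 * ((1 - (A1 j (x $ 2))\<^sup>2) / 2))" for j
      proof (rule has_continuous_partials_separable)
        show "((\<lambda>x. (a j x)\<^sup>2) has_real_derivative 2 * a j x * a1 j x) (at x)" for x
          using DERIV_power[OF a_der(1)[of j x], of 2] by (simp add: algebra_simps)
      qed (intro continuous_intros conts a2_cont blist | simp)+
    qed
  qed
  show "has_continuous_partials (\<lambda>x. u x $ i) (DU i)" for i
    using u1 u2 exhaust_2[of i] by (auto simp: u_def)
qed

lemma admissible: "(u, w) \<in> admissible L l2"
proof (rule admissibleI)
  have z: "a j 0 = 0 \<and> a1 j 0 = 0 \<and> a2 j 0 = 0" for j using a_zero[of j 0] X_pos[of j] by auto
  show "u (vector [0, t]) $ i = 0" for t i using z exhaust_2[of i] by (auto simp: u_def)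
  show "w (vector [0, t]) = 0" for t using z by (simp add: w_def)
  show "DW i (vector [0, t]) = 0" for t i using z by (cases "i = 1") (simp_all add: DW_def)
  show "0 \<le> w x" for x using a_bounds blist by (auto simp: w_def intro!: sum_nonneg mult_nonneg_nonneg)
qed

definition R :: "nat \<Rightarrow> (real ^ 2) set" where "R j = stripes (X j) (128 * X j) (h j) (d j) (c j)"

text \<open>
  Layers that are not neighbours do not overlap, as \<open>32\<^sup>2 = 1024 > 128\<close>.
\<close>

lemma layers_far: "i + 2 \<le> j \<Longrightarrow> x < 128 * X i \<Longrightarrow> x < X j"
proof -
  assume "i + 2 \<le> j" "x < 128 * X i"
  have "(32::real) ^ (i + 2) \<le> 32 ^ j" by (rule power_increasing) (use \<open>i + 2 \<le> j\<close> in auto)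
  then have "E * L * 32 ^ (i + 2) \<le> X j" unfolding X_def using E L by (intro mult_left_mono) auto
  moreover have "E * L * 32 ^ (i + 2) = 1024 * X i" by (simp add: X_def power_add)
  ultimately show ?thesis using \<open>x < 128 * X i\<close> X_pos[of i] by linarith
qed

text \<open>
  A period of layer \<open>j + 1\<close> is an integer multiple of a period of layer \<open>j\<close>, so the shift by half a
  period keeps the centres of both layers at least \<open>h j / 2\<close> apart. The widths add up to at most
  \<open>7 h j / 16\<close>.
\<close>

lemma blisters_disjoint:
  assumes "\<bar>y - c j - h j * of_int m\<bar> < d j" "\<bar>y - c (Suc j) - h (Suc j) * of_int n\<bar> < d (Suc j)"
  shows False
proof -
  have d1: "d j \<le> h j / 16" "d (Suc j) \<le> 6 * (h j / 16)" 
  proof -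
    have "d (Suc j) = 6 * d j" by (simp add: d_def)
    then show "d j \<le> h j / 16" "d (Suc j) \<le> 6 * (h j / 16)" using d_le_h[of j] by auto
  qed
  have "y - c (Suc j) - h (Suc j) * of_int n = y - c j - h j * (1 / 2 + 12 * of_int n)"
    by (simp add: c h_def algebra_simps)
  then have "\<bar>h j * (1 / 2 + 12 * of_int n - of_int m)\<bar> < d j + d (Suc j)"
    using assms by (simp add: algebra_simps abs_less_iff)
  also have "\<dots> \<le> h j * (7 / 16)" using d1 by simp
  finally have "\<bar>1 / 2 + 12 * real_of_int n - of_int m\<bar> < 7 / 16"
    using h_pos[of j] by (simp add: abs_mult)
  moreover have "1 / 2 + 12 * real_of_int n - of_int m = 1 / 2 + of_int (12 * n - m)" by simp
  ultimately have "\<bar>1 / 2 + real_of_int (12 * n - m)\<bar> < 7 / 16" by simp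
  moreover have "12 * n - m \<ge> 0 \<or> 12 * n - m \<le> - 1" by linarith
  ultimately show False by linarith
qed

lemma R_disjoint: "i \<noteq> j \<Longrightarrow> x \<in> R i \<Longrightarrow> x \<notin> R j"
proof (induction i j rule: linorder_less_wlog)
  case (less i j)
  show ?case
  proof
    assume j: "x \<in> R j"
    show False
    proof (cases "j = Suc i")
      case True
      then show ?thesis using less j blisters_disjoint[of "x $ 2" i] unfolding R_def stripes_def by blast
    next
      case False
      then have "x $ 1 < X j" using less by (intro layers_far[of i j]) (auto simp: R_def stripes_def)
      then show ?thesis using j by (simp add: R_def stripes_def)
    qed
  qed
next
  case (sym i j)
  then show ?case by blast
qed simp

lemma off_R:
  assumes "x \<notin> R j"
  shows "a j (x $ 1) * A j (x $ 2) = 0" "a1 j (x $ 1) * A j (x $ 2) = 0" "a2 j (x $ 1) * A j (x $ 2) = 0"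
    "a j (x $ 1) * A1 j (x $ 2) = 0" "a1 j (x $ 1) * A1 j (x $ 2) = 0" "a j (x $ 1) * A2 j (x $ 2) = 0"
  using assms a_zero[of j "x $ 1"] blist(11)[of j "x $ 2"] by (auto simp: R_def stripes_def)

text \<open>
  The basis of the construction: quantities that live on the folds of different layers never
  meet, so products of sums have no cross terms.
\<close>

lemma sum_off_R:
  assumes "\<And>j. x \<notin> R j \<Longrightarrow> T j = 0" "\<And>j. x \<notin> R j \<Longrightarrow> U j = 0"
  shows "(\<Sum>j<N. T j) * (\<Sum>j<N. U j) = (\<Sum>j<N. T j * (U j :: real))"
proof (rule sum_mult_sum_disjoint)
  show "T i * U j = 0" if "i \<noteq> j" for i j
    using assms(1)[of i] assms(2)[of j] R_disjoint[OF that, of x] by auto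
qed

section \<open>Pointwise bounds for strain and curvature\<close>

definition layer :: "nat \<Rightarrow> (real ^ 2) set" where "layer j = {x. X j < x $ 1 \<and> x $ 1 < 128 * X j}"

text \<open>
  The choice of \<open>Q\<close> as a primitive of \<open>2 P + A A1\<close> makes the terms cancel layer by layer.
\<close>

lemma strain_12: "DU 1 2 x + DU 2 1 x + DW 1 x * DW 2 x = 0"
proof -
  have "DW 1 x * DW 2 x = (\<Sum>j<N. a1 j (x $ 1) * A j (x $ 2) * (a j (x $ 1) * A1 j (x $ 2)))"
    using sum_off_R[of x "\<lambda>j. a1 j (x $ 1) * A j (x $ 2)" "\<lambda>j. a j (x $ 1) * A1 j (x $ 2)"] off_R[of x]
    by (simp add: DW_def)
  then have "DU 1 2 x + DU 2 1 x + DW 1 x * DW 2 x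
    = (\<Sum>j<N. - (a j (x $ 1) * a1 j (x $ 1)) * (2 * P j (x $ 2) + A j (x $ 2) * A1 j (x $ 2))
        + 2 * a j (x $ 1) * a1 j (x $ 1) * P j (x $ 2)
        + a1 j (x $ 1) * A j (x $ 2) * (a j (x $ 1) * A1 j (x $ 2)))"
    by (simp only: DU_def sum.distrib) simp
  also have "\<dots> = 0" by (rule sum.neutral) (simp add: algebra_simps)
  finally show ?thesis .
qed

text \<open>
  In each layer \<open>2 P' + A1\<^sup>2 = 1\<close>, so what remains is the sum of the squared weights, which telescopes. At the
  outer end nothing is lost because layer \<open>N\<close> starts at or beyond the right edge.
\<close>

lemma strain_22:
  assumes "x $ 1 \<le> L"
  shows "DU 2 2 x + DU 2 2 x + DW 2 x * DW 2 x - 1 = \<beta> (x $ 1 / X 0) - 1"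
proof -
  have "DW 2 x * DW 2 x = (\<Sum>j<N. a j (x $ 1) * A1 j (x $ 2) * (a j (x $ 1) * A1 j (x $ 2)))"
    using sum_off_R[of x "\<lambda>j. a j (x $ 1) * A1 j (x $ 2)" "\<lambda>j. a j (x $ 1) * A1 j (x $ 2)"] off_R[of x]
    by (simp add: DW_def)
  then have "DU 2 2 x + DU 2 2 x + DW 2 x * DW 2 x
    = (\<Sum>j<N. (a j (x $ 1))\<^sup>2 * ((1 - (A1 j (x $ 2))\<^sup>2) / 2) + (a j (x $ 1))\<^sup>2 * ((1 - (A1 j (x $ 2))\<^sup>2) / 2)
        + a j (x $ 1) * A1 j (x $ 2) * (a j (x $ 1) * A1 j (x $ 2)))"
    by (simp only: DU_def sum.distrib) simp
  also have "\<dots> = (\<Sum>j<N. (a j (x $ 1))\<^sup>2)"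
    by (rule sum.cong) (simp_all add: power2_eq_square field_simps)
  also have "\<dots> = (\<Sum>j<N. \<beta> (x $ 1 / X j) - \<beta> (x $ 1 / X (Suc j)))"
  proof -
    have "X (Suc j) = X j * 32" for j by (simp add: X_def)
    then show ?thesis by (simp add: a_def cut(8))
  qed
  also have "\<dots> = \<beta> (x $ 1 / X 0) - \<beta> (x $ 1 / X N)"
    by (rule sum_lessThan_telescope')
  also have "\<beta> (x $ 1 / X N) = 0"
  proof (rule cut(11))
    have "L * 1 \<le> L * (E * 32 ^ N)" using N(1) L by (intro mult_left_mono) auto
    then have "L \<le> X N" by (simp add: X_def algebra_simps)
    then show "x $ 1 / X N \<le> 1" using assms X_pos[of N] by simp
  qed
  finally show ?thesis by simp
qed

lemma strain_11:
  "DU 1 1 x + DU 1 1 x + DW 1 x * DW 1 x - 1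
    = 2 * (\<Sum>j<N. - ((a1 j (x $ 1))\<^sup>2 + a j (x $ 1) * a2 j (x $ 1)) * Q j (x $ 2))
      + (\<Sum>j<N. (a1 j (x $ 1) * A j (x $ 2))\<^sup>2)"
proof -
  have "DW 1 x * DW 1 x = (\<Sum>j<N. a1 j (x $ 1) * A j (x $ 2) * (a1 j (x $ 1) * A j (x $ 2)))"
    using sum_off_R[of x "\<lambda>j. a1 j (x $ 1) * A j (x $ 2)" "\<lambda>j. a1 j (x $ 1) * A j (x $ 2)"] off_R[of x]
    by (simp add: DW_def)
  then show ?thesis by (simp add: DU_def power2_eq_square)
qed

lemma h_over_X: "h j / X j = (3 / 8) ^ j"
proof -
  have "(12::real) ^ j / 32 ^ j = (3 / 8) ^ j" by (simp flip: power_divide)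
  then show ?thesis using E L by (simp add: h_def X_def)
qed

text \<open>
  With weights varying on the scale \<open>X j\<close>, both contributions are of order \<open>(h j / X j)\<^sup>2\<close> on layer
  \<open>j\<close>: the first since \<open>Q\<close> is of order \<open>(h j)\<^sup>2\<close>, the second since \<open>A\<^sup>2\<close> is of order
  \<open>h j * d j\<close> and \<open>d j \<le> h j\<close>.
\<close>

lemma strain_11_bound:
  "(DU 1 1 x + DU 1 1 x + DW 1 x * DW 1 x - 1)\<^sup>2
     \<le> (\<Sum>j<N. 102 * Kb\<^sup>2 * Kc ^ 4 * (81 / 4096) ^ j * indicator (layer j) x)"
proof -
  define T where "T = (\<lambda>j. - ((a1 j (x $ 1))\<^sup>2 + a j (x $ 1) * a2 j (x $ 1)) * Q j (x $ 2))"
  define U where "U = (\<lambda>j. (a1 j (x $ 1) * A j (x $ 2))\<^sup>2)"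
  have out: "T j = 0 \<and> U j = 0" if "x \<notin> layer j" for j
    using that a_zero[of j "x $ 1"] by (simp add: layer_def T_def U_def)
  have far: "T i * T j = 0 \<and> U i * U j = 0" if "i + 2 \<le> j" for i j
  proof (cases "x \<in> layer i")
    case True
    then have "x \<notin> layer j" using layers_far[OF that, of "x $ 1"] by (simp add: layer_def)
    then show ?thesis using out by simp
  qed (use out in simp)
  have "(2 * (\<Sum>j<N. T j) + (\<Sum>j<N. U j))\<^sup>2 \<le> 8 * (\<Sum>j<N. T j)\<^sup>2 + 2 * (\<Sum>j<N. U j)\<^sup>2"
    using sum_squares_bound[of "2 * (\<Sum>j<N. T j)" "\<Sum>j<N. U j"] by (simp add: power2_sum power_mult_distrib)
  also have "\<dots> \<le> 8 * (3 * (\<Sum>j<N. (T j)\<^sup>2)) + 2 * (3 * (\<Sum>j<N. (U j)\<^sup>2))"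
    using far by (intro add_mono mult_left_mono sum_square_le_neighbours) auto
  also have "\<dots> = (\<Sum>j<N. 24 * (T j)\<^sup>2 + 6 * (U j)\<^sup>2)" by (simp add: sum.distrib sum_distrib_left)
  also have "\<dots> \<le> (\<Sum>j<N. 102 * Kb\<^sup>2 * Kc ^ 4 * (81 / 4096) ^ j * indicator (layer j) x)"
  proof (rule sum_mono)
    fix j
    show "24 * (T j)\<^sup>2 + 6 * (U j)\<^sup>2 \<le> 102 * Kb\<^sup>2 * Kc ^ 4 * (81 / 4096) ^ j * indicator (layer j) x"
    proof (cases "x \<in> layer j")
      case True
      have K2: "Kc \<le> Kc\<^sup>2" "Kb \<le> Kb\<^sup>2" using Kc Kb by (simp_all add: power2_eq_square)
      have a1sq: "(a1 j (x $ 1))\<^sup>2 \<le> Kc\<^sup>2 / (X j)\<^sup>2"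
        using a_bounds(3)[of j "x $ 1"] abs_le_square_iff[of "a1 j (x $ 1)" "Kc / X j"] Kc X_pos[of j]
        by (simp add: power_divide)
      have "\<bar>a j (x $ 1) * a2 j (x $ 1)\<bar> \<le> 1 * (Kc / (X j)\<^sup>2)"
        unfolding abs_mult using a_bounds by (intro mult_mono) auto
      also have "\<dots> \<le> Kc\<^sup>2 / (X j)\<^sup>2" using K2 by (simp add: divide_right_mono)
      finally have "\<bar>(a1 j (x $ 1))\<^sup>2 + a j (x $ 1) * a2 j (x $ 1)\<bar> \<le> 2 * (Kc\<^sup>2 / (X j)\<^sup>2)"
        using a1sq zero_le_power2[of "a1 j (x $ 1)"] by linarith
      then have "((a1 j (x $ 1))\<^sup>2 + a j (x $ 1) * a2 j (x $ 1))\<^sup>2 \<le> (2 * (Kc\<^sup>2 / (X j)\<^sup>2))\<^sup>2"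
        by (subst abs_le_square_iff[symmetric]) simp
      then have "(T j)\<^sup>2 \<le> (2 * (Kc\<^sup>2 / (X j)\<^sup>2))\<^sup>2 * (Kb * h j ^ 4)"
        unfolding T_def power_mult_distrib power2_minus using blist(10) by (intro mult_mono) auto
      also have "\<dots> = 4 * Kb * Kc ^ 4 * (h j / X j) ^ 4"
        by (simp add: power_mult_distrib power_divide flip: power_mult)
      also have "\<dots> \<le> 4 * Kb\<^sup>2 * Kc ^ 4 * (h j / X j) ^ 4"
        using K2 by (intro mult_right_mono) auto
      finally have Tb: "(T j)\<^sup>2 \<le> 4 * Kb\<^sup>2 * Kc ^ 4 * (h j / X j) ^ 4" .
      have "d j \<le> h j" using d_le_h[of j] h_pos[of j] by linarith
      then have "Kb * h j * d j \<le> Kb * h j * h j" using Kb h_pos[of j] by (intro mult_left_mono) auto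
      then have "(A j (x $ 2))\<^sup>2 \<le> Kb * (h j)\<^sup>2"
        using blist(7)[of j "x $ 2"] by (simp add: power2_eq_square algebra_simps)
      then have "U j \<le> Kc\<^sup>2 / (X j)\<^sup>2 * (Kb * (h j)\<^sup>2)"
        unfolding U_def power_mult_distrib using a1sq by (intro mult_mono) auto
      then have "(U j)\<^sup>2 \<le> (Kc\<^sup>2 / (X j)\<^sup>2 * (Kb * (h j)\<^sup>2))\<^sup>2"
        by (rule power_mono) (simp add: U_def)
      also have "\<dots> = Kb\<^sup>2 * Kc ^ 4 * (h j / X j) ^ 4"
        by (simp add: power_mult_distrib power_divide flip: power_mult)
      finally have Ub: "(U j)\<^sup>2 \<le> Kb\<^sup>2 * Kc ^ 4 * (h j / X j) ^ 4" .
      have "(h j / X j) ^ 4 = (81 / 4096) ^ j"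
        by (simp add: h_over_X power_mult[symmetric] mult.commute[of j]) (simp add: power_mult power_divide)
      then show ?thesis using Tb Ub True by simp
    qed (use out in simp)
  qed
  finally show ?thesis unfolding strain_11 by (simp only: T_def U_def)
qed

text \<open>
  The second derivative across the folds dominates, because \<open>d j\<close> is the smallest length scale of
  the layer.
\<close>

lemma hessian_bound:
  "(\<Sum>i\<in>UNIV. \<Sum>k\<in>UNIV. (HW i k x)\<^sup>2) \<le> (\<Sum>j<N. 4 * Kc\<^sup>2 * Kb * (h j / d j ^ 3) * indicator (R j) x)"
proof -
  have *: "(\<Sum>j<N. T j)\<^sup>2 \<le> (\<Sum>j<N. Kc\<^sup>2 * Kb * (h j / d j ^ 3) * indicator (R j) x)"
    if "\<And>j. x \<notin> R j \<Longrightarrow> T j = 0" "\<And>j. (T j)\<^sup>2 \<le> Kc\<^sup>2 * Kb * (h j / d j ^ 3)" for T :: "nat \<Rightarrow> real"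
  proof -
    have "(\<Sum>j<N. T j)\<^sup>2 = (\<Sum>j<N. (T j)\<^sup>2)"
      using sum_off_R[of x T T] that by (simp add: power2_eq_square)
    also have "\<dots> \<le> (\<Sum>j<N. Kc\<^sup>2 * Kb * (h j / d j ^ 3) * indicator (R j) x)"
      using that by (intro sum_mono) (auto simp: indicator_def)
    finally show ?thesis .
  qed
  have dX: "d j \<le> X j" for j using d_le_h[of j] h_le_X[of j] h_pos[of j] by linarith
  have hd: "0 \<le> h j / d j ^ 3" for j using h_pos[of j] d_pos[of j] by simp
  have nn: "0 \<le> Kc\<^sup>2 * Kb * (h j / d j ^ 3)" for j
    by (intro mult_nonneg_nonneg hd) (use Kb in auto)
  have "(HW 1 1 x)\<^sup>2 \<le> (\<Sum>j<N. Kc\<^sup>2 * Kb * (h j / d j ^ 3) * indicator (R j) x)"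
    unfolding HW_def if_P[OF refl]
  proof (rule *)
    fix j
    have "(a2 j (x $ 1))\<^sup>2 \<le> (Kc / (X j)\<^sup>2)\<^sup>2"
      using power_mono[OF a_bounds(4)[of j "x $ 1"] abs_ge_zero, of 2] by (simp only: power2_abs)
    then have "(a2 j (x $ 1) * A j (x $ 2))\<^sup>2 \<le> (Kc / (X j)\<^sup>2)\<^sup>2 * (Kb * h j * d j)"
      unfolding power_mult_distrib using blist(7) by (intro mult_mono) auto
    also have "\<dots> = Kc\<^sup>2 * Kb * (h j / d j ^ 3) * (d j / X j) ^ 4"
    proof -
      have "h j * d j = h j / d j ^ 3 * d j ^ 4" using d_pos[of j] by (simp add: eval_nat_numeral)
      moreover have "(Kc / (X j)\<^sup>2)\<^sup>2 = Kc\<^sup>2 / X j ^ 4" by (simp add: power_divide)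
      ultimately show ?thesis by (simp add: power_divide mult.assoc)
    qed
    also have "\<dots> \<le> Kc\<^sup>2 * Kb * (h j / d j ^ 3) * 1"
      using dX[of j] X_pos[of j] d_pos[of j] by (intro mult_left_mono[OF _ nn] power_le_one) auto
    finally show "(a2 j (x $ 1) * A j (x $ 2))\<^sup>2 \<le> Kc\<^sup>2 * Kb * (h j / d j ^ 3)" by simp
  qed (rule off_R(3))
  moreover have mixed: "(\<Sum>j<N. a1 j (x $ 1) * A1 j (x $ 2))\<^sup>2 \<le> (\<Sum>j<N. Kc\<^sup>2 * Kb * (h j / d j ^ 3) * indicator (R j) x)"
  proof (rule *)
    fix j
    have "(a1 j (x $ 1))\<^sup>2 \<le> (Kc / X j)\<^sup>2"
      using power_mono[OF a_bounds(3)[of j "x $ 1"] abs_ge_zero, of 2] by (simp only: power2_abs)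
    then have "(a1 j (x $ 1) * A1 j (x $ 2))\<^sup>2 \<le> (Kc / X j)\<^sup>2 * (Kb * h j / d j)"
      unfolding power_mult_distrib using blist(8) by (intro mult_mono) auto
    also have "\<dots> = Kc\<^sup>2 * Kb * (h j / d j ^ 3) * (d j / X j)\<^sup>2"
    proof -
      have "h j / d j = h j / d j ^ 3 * (d j)\<^sup>2" using d_pos[of j] by (simp add: eval_nat_numeral)
      then have "Kb * h j / d j = Kb * (h j / d j ^ 3 * (d j)\<^sup>2)" by (simp only: times_divide_eq_right[symmetric])
      then show ?thesis by (simp add: power_divide mult_ac)
    qed
    also have "\<dots> \<le> Kc\<^sup>2 * Kb * (h j / d j ^ 3) * 1"
      using dX[of j] X_pos[of j] d_pos[of j] by (intro mult_left_mono[OF _ nn] power_le_one) auto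
    finally show "(a1 j (x $ 1) * A1 j (x $ 2))\<^sup>2 \<le> Kc\<^sup>2 * Kb * (h j / d j ^ 3)" by simp
  qed (rule off_R(5))
  moreover have "(HW 2 2 x)\<^sup>2 \<le> (\<Sum>j<N. Kc\<^sup>2 * Kb * (h j / d j ^ 3) * indicator (R j) x)"
  proof -
    have "(a j (x $ 1) * A2 j (x $ 2))\<^sup>2 \<le> Kc\<^sup>2 * Kb * (h j / d j ^ 3)" for j
    proof -
      have "(a j (x $ 1))\<^sup>2 \<le> Kc\<^sup>2" using a_bounds(1,2)[of j "x $ 1"] Kc by (intro power_mono) auto
      then have "(a j (x $ 1) * A2 j (x $ 2))\<^sup>2 \<le> Kc\<^sup>2 * (Kb * h j / d j ^ 3)"
        unfolding power_mult_distrib using blist(9) by (intro mult_mono) auto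
      then show ?thesis by simp
    qed
    from *[of "\<lambda>j. a j (x $ 1) * A2 j (x $ 2)", OF off_R(6) this] show ?thesis by (simp add: HW_def)
  qed
  moreover have "(HW 1 2 x)\<^sup>2 = (\<Sum>j<N. a1 j (x $ 1) * A1 j (x $ 2))\<^sup>2" "(HW 2 1 x)\<^sup>2 = (\<Sum>j<N. a1 j (x $ 1) * A1 j (x $ 2))\<^sup>2"
    by (simp_all add: HW_def)
  ultimately have "(\<Sum>i\<in>UNIV. \<Sum>k\<in>UNIV. (HW i k x)\<^sup>2) \<le> 4 * (\<Sum>j<N. Kc\<^sup>2 * Kb * (h j / d j ^ 3) * indicator (R j) x)"
    by (simp add: sum_2)
  then show ?thesis by (simp add: sum_distrib_left mult.assoc)
qed

lemma strain_bound:
  assumes "x \<in> rect L l2"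
  shows "(\<Sum>i\<in>UNIV. \<Sum>k\<in>UNIV. (DU i k x + DU k i x + DW i x * DW k x - (if i = k then 1 else 0))\<^sup>2)
    \<le> indicator {x. x $ 1 < 4 * X 0} x + (\<Sum>j<N. 102 * Kb\<^sup>2 * Kc ^ 4 * (81 / 4096) ^ j * indicator (layer j) x)"
proof -
  have "(DU 2 2 x + DU 2 2 x + DW 2 x * DW 2 x - 1)\<^sup>2 \<le> indicator {x. x $ 1 < 4 * X 0} x"
  proof (cases "x $ 1 < 4 * X 0")
    case True
    have "\<bar>\<beta> (x $ 1 / X 0) - 1\<bar> \<le> 1" using cut(9,10)[of "x $ 1 / X 0"] by linarith
    then show ?thesis using True assms by (subst strain_22) (auto simp: rect_def abs_square_le_1)
  next
    case False
    then have "\<beta> (x $ 1 / X 0) = 1" using X_pos[of 0] by (intro cut(12)) (simp add: field_simps)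
    then show ?thesis using False assms by (subst strain_22) (auto simp: rect_def)
  qed
  moreover have "DU 2 1 x + DU 1 2 x + DW 2 x * DW 1 x = 0"
    using strain_12[of x] by (simp only: mult.commute[of "DW 2 x"] add.commute[of "DU 2 1 x"])
  ultimately show ?thesis using strain_11_bound[of x] strain_12[of x] unfolding sum_2 by simp
qed

section \<open>Energy of the branching construction\<close>

lemma h_le_L: "j < N \<Longrightarrow> h j \<le> L"
proof -
  assume "j < N"
  then have "L * (E * 32 ^ j) \<le> L * 1" using N(2)[of j] L by (intro mult_left_mono) auto
  then show ?thesis using h_le_X[of j] by (simp add: X_def algebra_simps)
qed

lemma emeasure_R:
  assumes "L \<le> l2" "j < N"
  shows "emeasure lebesgue (R j \<inter> rect L l2) \<le> ennreal (768 * X j * l2 * d j / h j)"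
proof -
  have "emeasure lebesgue (R j \<inter> rect L l2) \<le> ennreal (6 * (128 * X j) * l2 * d j / h j)"
    unfolding R_def
    by (rule emeasure_stripes_le) (use d_pos[of j] d_le_h[of j] h_pos[of j] h_le_L assms X_pos[of j] in \<open>auto intro: order_trans\<close>)
  then show ?thesis by simp
qed

text \<open>
  The contributions of the layers form a geometric series with ratio \<open>81 / 128\<close>, and the boundary
  strip contributes \<open>4 X 0 l2\<close>.
\<close>

lemma stretching_energy_le:
  assumes "L \<le> l2"
  shows "(\<integral>\<^sup>+x. ennreal (\<Sum>i\<in>UNIV. \<Sum>k\<in>UNIV.
        (DU i k x + DU k i x + DW i x * DW k x - (if i = k then 1 else 0))\<^sup>2) \<partial>lebesgue_on (rect L l2))
    \<le> ennreal ((4 + 39168 * Kb\<^sup>2 * Kc ^ 4) * E * L * l2)"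
proof -
  \<comment> \<open>The index \<open>N\<close> stands for the boundary strip, the smaller ones for the layers.\<close>
  let ?B = "\<lambda>j. if j = N then {x. x $ 1 < 4 * X 0} else layer j"
  let ?c = "\<lambda>j. if j = N then 1 else 102 * Kb\<^sup>2 * Kc ^ 4 * (81 / 4096) ^ j"
  let ?m = "\<lambda>j. if j = N then 4 * X 0 * l2 else 128 * X j * l2"
  have l2: "0 < l2" using assms L by linarith
  have opn: "open {x :: real ^ 2. x $ 1 < t}" for t by (intro open_Collect_less continuous_intros)
  have opn': "open (layer j)" for j
    unfolding layer_def by (intro open_Collect_conj open_Collect_less continuous_intros)
  have "emeasure lebesgue (layer j \<inter> rect L l2) \<le> ennreal (128 * X j * l2)" for j
  proof -
    have "emeasure lebesgue (layer j \<inter> rect L l2) \<le> emeasure lebesgue ({x. x $ 1 < 128 * X j} \<inter> rect L l2)"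
      by (rule emeasure_mono) (use opn open_rect in \<open>auto simp: layer_def intro!: borel_open\<close>)
    also have "\<dots> \<le> ennreal (128 * X j * l2)" using l2 X_pos by (intro emeasure_strip_le) auto
    finally show ?thesis .
  qed
  moreover have "emeasure lebesgue ({x. x $ 1 < 4 * X 0} \<inter> rect L l2) \<le> ennreal (4 * X 0 * l2)"
    using l2 X_pos by (intro emeasure_strip_le) auto
  ultimately have "(\<integral>\<^sup>+x. ennreal (\<Sum>i\<in>UNIV. \<Sum>k\<in>UNIV.
        (DU i k x + DU k i x + DW i x * DW k x - (if i = k then 1 else 0))\<^sup>2) \<partial>lebesgue_on (rect L l2))
    \<le> ennreal (\<Sum>j\<in>{..N}. ?c j * ?m j)"
    using X_pos l2 Kb opn opn' open_rect strain_bound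
    by (intro nn_integral_step_bound[where B = ?B])
      (auto simp: lessThan_Suc_atMost[symmetric] less_imp_le borel_open add.commute)
  also have "\<dots> \<le> ennreal ((4 + 39168 * Kb\<^sup>2 * Kc ^ 4) * E * L * l2)"
  proof (rule ennreal_leI)
    have "(\<Sum>j\<in>{..N}. ?c j * ?m j) = 4 * X 0 * l2 + (\<Sum>j<N. 102 * Kb\<^sup>2 * Kc ^ 4 * (81 / 4096) ^ j * (128 * X j * l2))"
      by (simp add: lessThan_Suc_atMost[symmetric])
    moreover have "(\<Sum>j<N. 102 * Kb\<^sup>2 * Kc ^ 4 * (81 / 4096) ^ j * (128 * X j * l2))
        = 13056 * Kb\<^sup>2 * Kc ^ 4 * E * L * l2 * (\<Sum>j<N. (81 / 128) ^ j)"
    proof -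
      have "(81 / 4096) ^ j * (32::real) ^ j = (81 / 128) ^ j" for j by (simp flip: power_mult_distrib)
      then show ?thesis by (simp add: sum_distrib_left X_def mult_ac)
    qed
    moreover have "13056 * Kb\<^sup>2 * Kc ^ 4 * E * L * l2 * (\<Sum>j<N. (81 / 128) ^ j) \<le> 13056 * Kb\<^sup>2 * Kc ^ 4 * E * L * l2 * 3"
      using sum_power_le[of "81 / 128" N] Kb Kc E L l2 by (intro mult_left_mono) auto
    moreover have "4 * X 0 * l2 + 13056 * Kb\<^sup>2 * Kc ^ 4 * E * L * l2 * 3 = (4 + 39168 * Kb\<^sup>2 * Kc ^ 4) * E * L * l2"
      by (simp add: X_def algebra_simps)
    ultimately show "(\<Sum>j\<in>{..N}. ?c j * ?m j) \<le> (4 + 39168 * Kb\<^sup>2 * Kc ^ 4) * E * L * l2" by linarith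
  qed
  finally show ?thesis .
qed

text \<open>
  The contributions of the layers form a geometric series with ratio \<open>8 / 9\<close>.
\<close>

lemma bending_energy_le:
  assumes "L \<le> l2"
  shows "ennreal ((\<sigma> * L)\<^sup>2) * (\<integral>\<^sup>+x. ennreal (\<Sum>i\<in>UNIV. \<Sum>k\<in>UNIV. (HW i k x)\<^sup>2) \<partial>lebesgue_on (rect L l2))
    \<le> ennreal (7077888 * Kc\<^sup>2 * Kb * E * L * l2)"
proof -
  have l2: "0 < l2" using assms L by linarith
  have nn: "0 \<le> 768 * X j * l2 * d j / h j" "0 \<le> 4 * Kc\<^sup>2 * Kb * (h j / d j ^ 3)" for j
    using X_pos[of j] d_pos[of j] h_pos[of j] l2 Kb by auto
  have "(\<integral>\<^sup>+x. ennreal (\<Sum>i\<in>UNIV. \<Sum>k\<in>UNIV. (HW i k x)\<^sup>2) \<partial>lebesgue_on (rect L l2))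
    \<le> ennreal (\<Sum>j<N. 4 * Kc\<^sup>2 * Kb * (h j / d j ^ 3) * (768 * X j * l2 * d j / h j))"
    by (rule nn_integral_step_bound[where B = R])
      (use nn emeasure_R[OF assms] hessian_bound open_rect open_stripes in \<open>auto simp: R_def borel_open\<close>)
  also have "(\<Sum>j<N. 4 * Kc\<^sup>2 * Kb * (h j / d j ^ 3) * (768 * X j * l2 * d j / h j))
     = 3072 * Kc\<^sup>2 * Kb * l2 * (\<Sum>j<N. X j / (d j)\<^sup>2)"
    unfolding sum_distrib_left
  proof (rule sum.cong)
    show "4 * Kc\<^sup>2 * Kb * (h j / d j ^ 3) * (768 * X j * l2 * d j / h j) = 3072 * Kc\<^sup>2 * Kb * l2 * (X j / (d j)\<^sup>2)" for j
      using d_pos[of j] h_pos[of j] by (simp add: eval_nat_numeral)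
  qed simp
  finally have "ennreal ((\<sigma> * L)\<^sup>2) * (\<integral>\<^sup>+x. ennreal (\<Sum>i\<in>UNIV. \<Sum>k\<in>UNIV. (HW i k x)\<^sup>2) \<partial>lebesgue_on (rect L l2))
    \<le> ennreal ((\<sigma> * L)\<^sup>2) * ennreal (3072 * Kc\<^sup>2 * Kb * l2 * (\<Sum>j<N. X j / (d j)\<^sup>2))"
    by (rule mult_left_mono) simp
  also have "\<dots> = ennreal ((\<sigma> * L)\<^sup>2 * (3072 * Kc\<^sup>2 * Kb * l2 * (\<Sum>j<N. X j / (d j)\<^sup>2)))"
  proof (rule ennreal_mult[symmetric])
    have "0 \<le> (\<Sum>j<N. X j / (d j)\<^sup>2)" using X_pos by (intro sum_nonneg) (simp add: less_imp_le)
    then show "0 \<le> 3072 * Kc\<^sup>2 * Kb * l2 * (\<Sum>j<N. X j / (d j)\<^sup>2)" using Kb l2 by simp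
  qed simp
  also have "\<dots> \<le> ennreal (7077888 * Kc\<^sup>2 * Kb * E * L * l2)"
  proof (rule ennreal_leI)
    have "(\<sigma> * L)\<^sup>2 * (X j / (d j)\<^sup>2) = 256 * E * L * (8 / 9) ^ j" for j
    proof -
      have "(32::real) ^ j / (6 ^ j)\<^sup>2 = (8 / 9) ^ j"
        by (simp add: power2_eq_square flip: power_mult_distrib power_divide)
      moreover have "(\<sigma> * L)\<^sup>2 * (X j / (d j)\<^sup>2) = 256 * E * L * (32 ^ j / (6 ^ j)\<^sup>2)"
        using \<sigma> L by (simp add: X_def d_def power_mult_distrib power_divide)
      ultimately show ?thesis by simp
    qed
    then have "(\<sigma> * L)\<^sup>2 * (\<Sum>j<N. X j / (d j)\<^sup>2) = 256 * E * L * (\<Sum>j<N. (8 / 9) ^ j)"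
      by (simp add: sum_distrib_left)
    also have "\<dots> \<le> 256 * E * L * 9"
      using sum_power_le[of "8 / 9" N] E L by (intro mult_left_mono) auto
    finally have "3072 * Kc\<^sup>2 * Kb * l2 * ((\<sigma> * L)\<^sup>2 * (\<Sum>j<N. X j / (d j)\<^sup>2)) \<le> 3072 * Kc\<^sup>2 * Kb * l2 * (256 * E * L * 9)"
      using Kb l2 by (intro mult_left_mono) auto
    then show "(\<sigma> * L)\<^sup>2 * (3072 * Kc\<^sup>2 * Kb * l2 * (\<Sum>j<N. X j / (d j)\<^sup>2)) \<le> 7077888 * Kc\<^sup>2 * Kb * E * L * l2"
      by (simp add: algebra_simps)
  qed
  finally show ?thesis .
qed

text \<open>
  The film is detached at most on the folds, and layer \<open>j\<close> has folds of area of order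
  \<open>X j * l2 * d j / h j\<close>, which is a constant times \<open>\<sigma> L l2 16^j\<close>.
\<close>

lemma delamination_energy_le:
  assumes "L \<le> l2" and \<gamma>: "0 \<le> \<gamma>" "\<gamma> * \<sigma> * (\<Sum>j<N. 16 ^ j) \<le> 2 * E"
  shows "ennreal \<gamma> * emeasure lebesgue {x \<in> rect L l2. 0 < w x} \<le> ennreal (96 * E * L * l2)"
proof -
  have l2: "0 < l2" using assms L by linarith
  have Rm: "R j \<inter> rect L l2 \<in> sets lebesgue" for j
    using open_stripes open_rect by (auto simp: R_def borel_open)
  have "{x \<in> rect L l2. 0 < w x} \<subseteq> (\<Union>j\<in>{..<N}. R j \<inter> rect L l2)"
  proof
    fix x assume x: "x \<in> {x \<in> rect L l2. 0 < w x}"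
    then have "w x \<noteq> 0" by simp
    then obtain j where "j < N" "a j (x $ 1) * A j (x $ 2) \<noteq> 0"
      unfolding w_def by (meson lessThan_iff sum.not_neutral_contains_not_neutral)
    then show "x \<in> (\<Union>j\<in>{..<N}. R j \<inter> rect L l2)" using off_R(1)[of x j] x by blast
  qed
  then have "emeasure lebesgue {x \<in> rect L l2. 0 < w x} \<le> emeasure lebesgue (\<Union>j\<in>{..<N}. R j \<inter> rect L l2)"
    using Rm by (intro emeasure_mono sets.finite_UN) auto
  also have "\<dots> \<le> (\<Sum>j<N. emeasure lebesgue (R j \<inter> rect L l2))"
    using Rm by (intro emeasure_subadditive_finite) auto
  also have "\<dots> \<le> (\<Sum>j<N. ennreal (768 * X j * l2 * d j / h j))"
    using emeasure_R[OF assms(1)] by (intro sum_mono) auto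
  also have "\<dots> = ennreal (\<Sum>j<N. 768 * X j * l2 * d j / h j)"
    using X_pos d_pos h_pos l2 by (intro sum_ennreal) (auto simp: less_imp_le)
  also have "(\<Sum>j<N. 768 * X j * l2 * d j / h j) = 48 * \<sigma> * L * l2 * (\<Sum>j<N. 16 ^ j)"
    unfolding sum_distrib_left
  proof (rule sum.cong)
    fix j
    have "(32::real) ^ j * 6 ^ j = 16 ^ j * 12 ^ j" by (simp flip: power_mult_distrib)
    then show "768 * X j * l2 * d j / h j = 48 * \<sigma> * L * l2 * 16 ^ j"
      using E L by (simp add: X_def d_def h_def field_simps)
  qed simp
  finally have "ennreal \<gamma> * emeasure lebesgue {x \<in> rect L l2. 0 < w x}
      \<le> ennreal \<gamma> * ennreal (48 * \<sigma> * L * l2 * (\<Sum>j<N. 16 ^ j))"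
    by (rule mult_left_mono) simp
  also have "\<dots> = ennreal (48 * L * l2 * (\<gamma> * \<sigma> * (\<Sum>j<N. 16 ^ j)))"
    using \<gamma> \<sigma> L l2 by (subst ennreal_mult[symmetric]) (auto intro!: mult_nonneg_nonneg sum_nonneg simp: mult_ac)
  also have "\<dots> \<le> ennreal (48 * L * l2 * (2 * E))"
    using \<gamma> L l2 by (intro ennreal_leI mult_left_mono) auto
  finally show ?thesis by (simp add: mult_ac)
qed

lemma min_energy_bound:
  assumes "L \<le> l2" "0 \<le> \<gamma>" "\<gamma> * \<sigma> * (\<Sum>j<N. 16 ^ j) \<le> 2 * E"
  shows "min_energy \<sigma> \<gamma> L l2 \<le> ennreal ((100 + 39168 * Kb\<^sup>2 * Kc ^ 4 + 7077888 * Kc\<^sup>2 * Kb) * (E * L * l2))"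
proof -
  have l2: "0 < l2" using assms L by linarith
  have "min_energy \<sigma> \<gamma> L l2 \<le> energy \<sigma> \<gamma> u w L l2" by (rule min_energy_le[OF admissible])
  also have "\<dots> \<le> ennreal ((4 + 39168 * Kb\<^sup>2 * Kc ^ 4) * E * L * l2) + ennreal (7077888 * Kc\<^sup>2 * Kb * E * L * l2)
      + ennreal (96 * E * L * l2)"
    unfolding energy_eq
    by (intro add_mono stretching_energy_le bending_energy_le delamination_energy_le assms)
  also have "\<dots> = ennreal ((4 + 39168 * Kb\<^sup>2 * Kc ^ 4) * E * L * l2 + 7077888 * Kc\<^sup>2 * Kb * E * L * l2 + 96 * E * L * l2)"
    using E L l2 Kb Kc by simp
  finally show ?thesis by (simp add: algebra_simps)
qed

end

text \<open>
  With \<open>N\<close> minimal one has \<open>32^(N-1) < 1 / E\<close>, hence \<open>16^(N-1) \<le> E powr (-4/5)\<close>, and the hypothesis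
  on \<open>\<gamma> \<sigma>\<close> bounds the delamination energy.
\<close>

lemma min_energy_le_branching:
  "\<exists>C>0. \<forall>l1 l2 \<sigma> \<gamma> E. 0 < l1 \<longrightarrow> l1 \<le> l2 \<longrightarrow> 0 < \<sigma> \<longrightarrow> \<sigma> \<le> E \<longrightarrow> E \<le> 1 \<longrightarrow> 0 \<le> \<gamma> \<longrightarrow>
     \<gamma> * \<sigma> \<le> E powr (9 / 5) \<longrightarrow> min_energy \<sigma> \<gamma> l1 l2 \<le> ennreal (C * (E * l1 * l2))"
proof -
  obtain Kc s s1 s2 \<beta> where Kc: "Kc \<ge> 1" and cutoff: "is_cutoff Kc s s1 s2 \<beta>"
    using cutoff_exists by blast
  obtain Kb where Kb: "Kb \<ge> 1"
    and bl: "\<And>h \<delta> c. 0 < \<delta> \<Longrightarrow> \<delta> \<le> h / 4 \<Longrightarrow> \<exists>A A1 A2 P Q. is_blister Kb h \<delta> c A A1 A2 P Q"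
    using blister_exists by blast
  let ?C = "100 + 39168 * Kb\<^sup>2 * Kc ^ 4 + 7077888 * Kc\<^sup>2 * Kb"
  have "min_energy \<sigma> \<gamma> l1 l2 \<le> ennreal (?C * (E * l1 * l2))"
    if l: "0 < l1" "l1 \<le> l2" and \<sigma>: "0 < \<sigma>" "\<sigma> \<le> E" "E \<le> 1" and \<gamma>: "0 \<le> \<gamma>" "\<gamma> * \<sigma> \<le> E powr (9 / 5)"
    for l1 l2 \<sigma> \<gamma> E
  proof -
    have E: "0 < E" using \<sigma> by linarith
    obtain n where "1 / E < 32 ^ n" using real_arch_pow[of 32 "1 / E"] by auto
    then have ex: "\<exists>n. 1 \<le> E * 32 ^ n" using E by (intro exI[of _ n]) (simp add: field_simps)
    define N where "N = (LEAST n. 1 \<le> E * 32 ^ n)"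
    have N: "1 \<le> E * 32 ^ N" "\<And>j. j < N \<Longrightarrow> E * 32 ^ j < 1"
      using LeastI_ex[OF ex] not_less_Least[of _ "\<lambda>n. 1 \<le> E * 32 ^ n"] by (auto simp: N_def not_le)
    define c where "c = rec_nat 0 (\<lambda>j c. c + E * l1 * 12 ^ j / 2)"
    have c: "c (Suc j) = c j + E * l1 * 12 ^ j / 2" for j by (simp add: c_def)
    have "\<exists>A A1 A2 P Q. is_blister Kb (E * l1 * 12 ^ j) (\<sigma> * l1 * 6 ^ j / 16) (c j) A A1 A2 P Q" for j
    proof (rule bl)
      show "0 < \<sigma> * l1 * 6 ^ j / 16" using \<sigma> l by simp
      have "\<sigma> * l1 * 6 ^ j \<le> E * l1 * 12 ^ j" using l \<sigma> by (intro mult_mono power_mono) auto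
      moreover have "0 \<le> E * l1 * 12 ^ j" using E l by simp
      ultimately show "\<sigma> * l1 * 6 ^ j / 16 \<le> E * l1 * 12 ^ j / 4" by linarith
    qed
    then obtain A A1 A2 P Q where
      "\<And>j. is_blister Kb (E * l1 * 12 ^ j) (\<sigma> * l1 * 6 ^ j / 16) (c j) (A j) (A1 j) (A2 j) (P j) (Q j)"
      by metis
    then interpret refined_folds l1 \<sigma> E N Kc s s1 s2 \<beta> Kb c A A1 A2 P Q
      using l \<sigma> N Kc cutoff Kb c by unfold_locales auto
    have "\<gamma> * \<sigma> * (\<Sum>j<N. 16 ^ j) \<le> 2 * E"
    proof (cases N)
      case 0
      then show ?thesis using E by simp
    next
      case (Suc m)
      \<comment> \<open>The last layer dominates the sum.\<close>
      have "(\<Sum>j<N. 16 ^ j) \<le> 2 * (16::real) ^ m"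
      proof -
        have "(\<Sum>j<Suc m. 16 ^ j) \<le> 2 * (16::real) ^ m" for m
        proof (induction m)
          case (Suc m)
          have "0 \<le> (16::real) ^ m" by simp
          with Suc show ?case unfolding sum.lessThan_Suc[of _ "Suc m"] power_Suc by linarith
        qed simp
        then show ?thesis using Suc by simp
      qed
      also have "(16::real) ^ m \<le> E powr (- (4 / 5))"
      proof -
        have "(32::real) ^ m \<le> E powr (- 1)"
          using N(2)[of m] Suc E by (simp add: powr_minus field_simps less_imp_le)
        then have "((32::real) ^ m) powr (4 / 5) \<le> (E powr (- 1)) powr (4 / 5)"
          by (intro powr_mono2) auto
        moreover have "((32::real) ^ m) powr (4 / 5) = 16 ^ m"
        proof -
          have "(32::real) ^ m = 2 powr (5 * real m)" "(16::real) ^ m = 2 powr (4 * real m)"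
            by (simp_all flip: powr_powr powr_realpow add: powr_numeral)
          then show ?thesis by (simp add: powr_powr)
        qed
        moreover have "(E powr (- 1)) powr (4 / 5) = E powr (- (4 / 5))" by (simp only: powr_powr) simp
        ultimately show ?thesis by (simp only:)
      qed
      finally have "\<gamma> * \<sigma> * (\<Sum>j<N. 16 ^ j) \<le> E powr (9 / 5) * (2 * E powr (- (4 / 5)))"
        using \<gamma> \<sigma> by (intro mult_mono) (auto intro: sum_nonneg)
      also have "\<dots> = 2 * E" using E by (simp add: mult.left_commute flip: powr_add)
      finally show ?thesis .
    qed
    then show ?thesis by (rule min_energy_bound[OF l(2) \<gamma>(1)])
  qed
  moreover have "0 < ?C" using Kb Kc by (intro add_pos_nonneg) auto
  ultimately show ?thesis by blast
qed

text \<open>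
  The film that stays bonded and unstretched has the energy density \<open>|Id|\<^sup>2 = 2\<close>.
\<close>

lemma min_energy_le_flat:
  assumes "0 < l1" "l1 \<le> l2"
  shows "min_energy \<sigma> \<gamma> l1 l2 \<le> ennreal (2 * (l1 * l2))"
proof -
  have z: "has_continuous_partials (\<lambda>x :: real ^ 2. 0) (\<lambda>_ _. 0)" by (rule has_continuous_partials_zero)
  interpret classical_pair l1 l2 "\<lambda>_. 0" "\<lambda>_. 0" "\<lambda>_ _ _. 0" "\<lambda>_ _. 0" "\<lambda>_ _ _. 0"
    by unfold_locales (simp_all add: z)
  have "min_energy \<sigma> \<gamma> l1 l2 \<le> energy \<sigma> \<gamma> (\<lambda>_. 0) (\<lambda>_. 0) l1 l2"
    by (rule min_energy_le, rule admissibleI) auto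
  also have "\<dots> = 2 * emeasure lebesgue (rect l1 l2)"
    unfolding energy_eq using open_rect[of l1 l2] by (simp add: sum_2 emeasure_restrict_space borel_open space_restrict_space)
  also have "\<dots> \<le> 2 * ennreal (l1 * l2)"
  proof (rule mult_left_mono)
    have "{x. x $ 1 < l1} \<inter> rect l1 l2 = rect l1 l2" by (auto simp: rect_def)
    then show "emeasure lebesgue (rect l1 l2) \<le> ennreal (l1 * l2)"
      using emeasure_strip_le[of l2 l1 l1] assms by simp
  qed simp
  also have "\<dots> = ennreal (2 * (l1 * l2))" using assms by (subst ennreal_mult) auto
  finally show ?thesis .
qed

section \<open>Upper bounds in the four regimes\<close>

theorem theorem2p1:
  shows "\<exists>c::real. c > 0 \<and> (\<forall>l1 l2 \<sigma> \<gamma> :: real. 0 < l1 \<longrightarrow> l1 \<le> l2 \<longrightarrow>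
    ((\<sigma>, \<gamma>) \<in> regime_A \<longrightarrow> min_energy \<sigma> \<gamma> l1 l2 \<le> ennreal (c * l1 * l2)) \<and>
    ((\<sigma>, \<gamma>) \<in> regime_B \<longrightarrow> min_energy \<sigma> \<gamma> l1 l2 \<le> ennreal (c * l1 * l2 * (\<sigma> * \<gamma>) powr (2/5))) \<and>
    ((\<sigma>, \<gamma>) \<in> regime_C \<longrightarrow> min_energy \<sigma> \<gamma> l1 l2 \<le> ennreal (c * l1 * l2 * (\<sigma> powr (1/2) * \<gamma> powr (5/8)))) \<and>
    ((\<sigma>, \<gamma>) \<in> regime_D \<longrightarrow> min_energy \<sigma> \<gamma> l1 l2 \<le> ennreal (c * l1 * l2 * \<sigma>)))"
proof -
  obtain C where C: "C > 0" and branching: "\<And>l1 l2 \<sigma> \<gamma> E. 0 < l1 \<Longrightarrow> l1 \<le> l2 \<Longrightarrow> 0 < \<sigma> \<Longrightarrow> \<sigma> \<le> E \<Longrightarrow> E \<le> 1 \<Longrightarrow>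
      0 \<le> \<gamma> \<Longrightarrow> \<gamma> * \<sigma> \<le> E powr (9 / 5) \<Longrightarrow> min_energy \<sigma> \<gamma> l1 l2 \<le> ennreal (C * (E * l1 * l2))"
    using min_energy_le_branching by blast
  have bound: "min_energy \<sigma> \<gamma> l1 l2 \<le> ennreal ((C + 2) * l1 * l2 * E)"
    if "0 < l1" "l1 \<le> l2" "0 < \<sigma>" "\<sigma> \<le> E" "E \<le> 1" "0 \<le> \<gamma>" "\<gamma> * \<sigma> \<le> E powr (9 / 5)" for l1 l2 \<sigma> \<gamma> E
  proof -
    have "C * (E * l1 * l2) \<le> (C + 2) * (E * l1 * l2)" using that by (intro mult_right_mono) auto
    then have "ennreal (C * (E * l1 * l2)) \<le> ennreal ((C + 2) * l1 * l2 * E)"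
      by (intro ennreal_leI) (simp add: algebra_simps)
    then show ?thesis using branching[OF that] by (rule order_trans[rotated])
  qed
  show ?thesis
  proof (intro exI[of _ "C + 2"] conjI allI impI)
    show "C + 2 > 0" using C by simp
    fix l1 l2 \<sigma> \<gamma> :: real
    assume l: "0 < l1" "l1 \<le> l2"
    show "min_energy \<sigma> \<gamma> l1 l2 \<le> ennreal ((C + 2) * l1 * l2)"
    proof (rule order_trans[OF min_energy_le_flat[OF l]], rule ennreal_leI)
      have "2 * (l1 * l2) \<le> (C + 2) * (l1 * l2)" using C l by (intro mult_right_mono) auto
      then show "2 * (l1 * l2) \<le> (C + 2) * l1 * l2" by (simp add: mult.assoc)
    qed
    show "min_energy \<sigma> \<gamma> l1 l2 \<le> ennreal ((C + 2) * l1 * l2 * (\<sigma> * \<gamma>) powr (2/5))" if "(\<sigma>, \<gamma>) \<in> regime_B"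
    proof -
      have \<sigma>: "0 < \<sigma>" "\<sigma> < 1" and \<gamma>: "\<sigma> powr (- 4 / 9) \<le> \<gamma>" "\<gamma> < \<sigma> powr (- 1)"
        using that by (auto simp: regime_B_def regime_X_def)
      have "0 < \<gamma>" by (rule less_le_trans[OF _ \<gamma>(1)]) (use \<sigma> in simp)
      have "\<sigma> * \<gamma> < \<sigma> * \<sigma> powr (- 1)" using \<sigma> \<gamma> by (intro mult_strict_left_mono)
      then have le1: "\<sigma> * \<gamma> \<le> 1" using \<sigma> by (simp add: powr_minus_divide)
      have "\<sigma> powr (5 / 9) = \<sigma> powr 1 * \<sigma> powr (- 4 / 9)" by (simp only: flip: powr_add) simp
      also have "\<dots> \<le> \<sigma> powr 1 * \<gamma>" using \<gamma> by (intro mult_left_mono) auto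
      finally have ge: "\<sigma> powr (5 / 9) \<le> \<sigma> * \<gamma>" using \<sigma> by simp
      show ?thesis
      proof (rule bound[OF l])
        have "\<sigma> powr 1 \<le> \<sigma> powr (2 / 9)" using \<sigma> by (intro powr_mono') auto
        also have "\<dots> = (\<sigma> powr (5 / 9)) powr (2 / 5)" by (simp add: powr_powr)
        also have "\<dots> \<le> (\<sigma> * \<gamma>) powr (2 / 5)" using ge by (intro powr_mono2) auto
        finally show "\<sigma> \<le> (\<sigma> * \<gamma>) powr (2 / 5)" using \<sigma> by simp
        show "(\<sigma> * \<gamma>) powr (2 / 5) \<le> 1" using le1 \<sigma> \<open>0 < \<gamma>\<close> by (intro powr_le1) auto
        have "(\<sigma> * \<gamma>) powr 1 \<le> (\<sigma> * \<gamma>) powr (18 / 25)" using le1 \<sigma> \<open>0 < \<gamma>\<close> by (intro powr_mono') auto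
        then show "\<gamma> * \<sigma> \<le> ((\<sigma> * \<gamma>) powr (2 / 5)) powr (9 / 5)"
          using \<sigma> \<open>0 < \<gamma>\<close> by (simp add: powr_powr mult.commute)
      qed (use \<sigma> \<open>0 < \<gamma>\<close> in auto)
    qed
    show "min_energy \<sigma> \<gamma> l1 l2 \<le> ennreal ((C + 2) * l1 * l2 * (\<sigma> powr (1/2) * \<gamma> powr (5/8)))" if "(\<sigma>, \<gamma>) \<in> regime_C"
    proof -
      have \<sigma>: "0 < \<sigma>" "\<sigma> < 1" and \<gamma>: "\<sigma> powr (4 / 5) \<le> \<gamma>" "\<gamma> < \<sigma> powr (- 4 / 9)"
        using that by (auto simp: regime_C_def regime_X_def)
      have "0 < \<gamma>" by (rule less_le_trans[OF _ \<gamma>(1)]) (use \<sigma> in simp)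
      show ?thesis
      proof (rule bound[OF l])
        have "\<sigma> = \<sigma> powr (1 / 2) * (\<sigma> powr (4 / 5)) powr (5 / 8)" 
          using \<sigma> by (simp only: powr_powr flip: powr_add) simp
        also have "\<dots> \<le> \<sigma> powr (1 / 2) * \<gamma> powr (5 / 8)" using \<gamma> by (intro mult_left_mono powr_mono2) auto
        finally show "\<sigma> \<le> \<sigma> powr (1 / 2) * \<gamma> powr (5 / 8)" .
        have "\<sigma> powr (1 / 2) * \<gamma> powr (5 / 8) \<le> \<sigma> powr (1 / 2) * (\<sigma> powr (- 4 / 9)) powr (5 / 8)"
          using \<gamma> \<open>0 < \<gamma>\<close> by (intro mult_left_mono powr_mono2) auto
        also have "\<dots> = \<sigma> powr (2 / 9)" by (simp only: powr_powr flip: powr_add) simp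
        also have "\<dots> \<le> 1" using \<sigma> by (intro powr_le1) auto
        finally show "\<sigma> powr (1 / 2) * \<gamma> powr (5 / 8) \<le> 1" .
        have "\<gamma> * \<sigma> = \<gamma> * \<sigma> powr (9 / 10) * (\<sigma> powr (4 / 5)) powr (1 / 8)"
          using \<sigma> by (simp only: powr_powr mult.assoc flip: powr_add) simp
        also have "\<dots> \<le> \<gamma> * \<sigma> powr (9 / 10) * \<gamma> powr (1 / 8)"
          using \<gamma> \<open>0 < \<gamma>\<close> by (intro mult_left_mono powr_mono2) auto
        also have "\<dots> = \<sigma> powr (9 / 10) * (\<gamma> powr 1 * \<gamma> powr (1 / 8))" using \<open>0 < \<gamma>\<close> by simp
        also have "\<dots> = (\<sigma> powr (1 / 2) * \<gamma> powr (5 / 8)) powr (9 / 5)"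
          by (simp only: powr_mult powr_powr flip: powr_add) simp
        finally show "\<gamma> * \<sigma> \<le> (\<sigma> powr (1 / 2) * \<gamma> powr (5 / 8)) powr (9 / 5)" .
      qed (use \<sigma> \<open>0 < \<gamma>\<close> in auto)
    qed
    show "min_energy \<sigma> \<gamma> l1 l2 \<le> ennreal ((C + 2) * l1 * l2 * \<sigma>)" if "(\<sigma>, \<gamma>) \<in> regime_D"
    proof -
      have \<sigma>: "0 < \<sigma>" "\<sigma> < 1" and \<gamma>: "0 \<le> \<gamma>" "\<gamma> < \<sigma> powr (4 / 5)"
        using that by (auto simp: regime_D_def regime_X_def)
      show ?thesis
      proof (rule bound[OF l])
        have "\<gamma> * \<sigma> \<le> \<sigma> powr (4 / 5) * \<sigma> powr 1" using \<sigma> \<gamma> by (simp add: mult_right_mono)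
        also have "\<dots> = \<sigma> powr (9 / 5)" by (simp only: flip: powr_add) simp
        finally show "\<gamma> * \<sigma> \<le> \<sigma> powr (9 / 5)" .
      qed (use \<sigma> \<gamma> in auto)
    qed
  qed
qed

end
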